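(* Let $V_i,W_i$ ($i=1,2,3$) be finite sets, let $\Gamma_1$ be a no-signalling (NS) correlation over $(V_2,W_1,V_1,W_2)$ and $\Gamma_2$ an NS correlation over $(V_3,W_2,V_2,W_3)$. Define the linear map $\Gamma_2\ast\Gamma_1:\mathcal D_{V_3W_1}\to\mathcal D_{V_1W_3}$ by $$(\Gamma_2\ast\Gamma_1)(v_1,w_3|v_3,w_1)=\sum_{v_2\in V_2}\sum_{w_2\in W_2}\Gamma_1(v_1,w_2|v_2,w_1)\,\Gamma_2(v_2,w_3|v_3,w_2).$$ Then $\Gamma_2\ast\Gamma_1$ is an NS correlation over $(V_3,W_1,V_1,W_3)$. Moreover: (i) if ${\rm t}\in\{{\rm loc},{\rm q},{\rm qa},{\rm qc},{\rm ns}\}$ and $\Gamma_i\in\mathcal C_{\rm t}$, $i=1,2$, then $\Gamma_2\ast\Gamma_1\in\mathcal C_{\rm t}$; (ii) if $\mathcal E:\mathcal D_{V_1}\to\mathcal D_{W_1}$ is a channel then $(\Gamma_2\ast\Gamma_1)[\mathcal E]=\Gamma_2[\Gamma_1[\mathcal E]]$.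
   Context: $\mathcal D_V$ is the algebra of complex diagonal $V\times V$ matrices with diagonal matrix units $\epsilon_{v,v}$; $VW=V\times W$. A channel is a positive trace-preserving linear map $\mathcal E:\mathcal D_V\to\mathcal D_W$; $\mathcal E(w|v)$ is the $(w,w)$ entry of $\mathcal E(\epsilon_{v,v})$. A POVM is a finite family of positive operators on a Hilbert space summing to $I$. An NS correlation over a quadruple $(V_2,W_1,V_1,W_2)$ of finite sets is a channel $\Gamma:\mathcal D_{V_2W_1}\to\mathcal D_{V_1W_2}$ such that $\sum_{w_2}\Gamma(v_1,w_2|v_2,w_1)$ does not depend on $w_1$ and $\sum_{v_1}\Gamma(v_1,w_2|v_2,w_1)$ does not depend on $v_2$. $\Gamma$ is: qc if there are a Hilbert space $H$, a unit vector $\xi\in H$ and POVMs $(E_{v_2,v_1})_{v_1}$, $(F_{w_1,w_2})_{w_2}$ on $H$ with $E_{v_2,v_1}F_{w_1,w_2}=F_{w_1,w_2}E_{v_2,v_1}$ and $\Gamma(v_1,w_2|v_2,w_1)=\langle E_{v_2,v_1}F_{w_1,w_2}\xi,\xi\rangle$; q if moreover $H=H_V\otimes H_W$ with $H_V,H_W$ finite dimensional, $E_{v_2,v_1}=E'_{v_2,v_1}\otimes I$, $F_{w_1,w_2}=I\otimes F'_{w_1,w_2}$; qa if it is a limit of quantum correlations; loc if it is a convex combination of $\Phi\otimes\Psi$ with channels $\Phi:\mathcal D_{V_2}\to\mathcal D_{V_1}$, $\Psi:\mathcal D_{W_1}\to\mathcal D_{W_2}$. $\mathcal C_{\rm t}$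 is the set of NS correlations of type ${\rm t}$ (ns = all), over the quadruple understood from the context. For an NS correlation $\Gamma$ over $(V_2,W_1,V_1,W_2)$ and a channel $\mathcal E:\mathcal D_{V_1}\to\mathcal D_{W_1}$, the (simulated) channel $\Gamma[\mathcal E]:\mathcal D_{V_2}\to\mathcal D_{W_2}$ is given by $\Gamma[\mathcal E](w_2|v_2)=\sum_{v_1\in V_1}\sum_{w_1\in W_1}\Gamma(v_1,w_2|v_2,w_1)\mathcal E(w_1|v_1)$. *)

theory Defs
  imports "HOL-Analysis.Analysis" "HOL-Algebra.Module"
begin

section \<open>Diagonal matrices and channels\<close>

text \<open>
  Finite sets are rendered as types of class \<^class>\<open>finite\<close>.  A linear map out of the algebra of
  diagonal matrices is rendered as a function on all square matrices of which only the values on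
  diagonal matrices are ever constrained or compared.
\<close>

type_synonym 'v sqmat = "complex^'v^'v"

definition diagonal :: "('v::finite) sqmat set"  (\<open>\<D>\<close>)
  where "\<D> = {A. \<forall>i j. i \<noteq> j \<longrightarrow> A $ i $ j = 0}"

definition diag_unit :: "'v::finite \<Rightarrow> 'v sqmat"  (\<open>\<epsilon>\<close>)
  where "\<epsilon> v = (\<chi> i j. if i = v \<and> j = v then 1 else 0)"

definition cscale :: "complex \<Rightarrow> ('v::finite) sqmat \<Rightarrow> 'v sqmat"
  where "cscale c A = (\<chi> i j. c * A $ i $ j)"

definition pos_matrix :: "('v::finite) sqmat \<Rightarrow> bool"
  where "pos_matrix A \<longleftrightarrow>
    (\<forall>x::complex^'v. (\<Sum>i\<in>UNIV. \<Sum>j\<in>UNIV. cnj (x $ i) * A $ i $ j * x $ j) \<in> \<real>\<^sub>\<ge>\<^sub>0)"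

definition diag_linear :: "(('v::finite) sqmat \<Rightarrow> ('w::finite) sqmat) \<Rightarrow> bool"
  where "diag_linear \<E> \<longleftrightarrow> \<E> \<in> \<D> \<rightarrow> \<D> \<and>
    (\<forall>A\<in>\<D>. \<forall>B\<in>\<D>. \<E> (A + B) = \<E> A + \<E> B) \<and>
    (\<forall>c. \<forall>A\<in>\<D>. \<E> (cscale c A) = cscale c (\<E> A))"

definition channel :: "(('v::finite) sqmat \<Rightarrow> ('w::finite) sqmat) \<Rightarrow> bool"
  where "channel \<E> \<longleftrightarrow> diag_linear \<E> \<and>
    (\<forall>A\<in>\<D>. pos_matrix A \<longrightarrow> pos_matrix (\<E> A)) \<and>
    (\<forall>A\<in>\<D>. trace (\<E> A) = trace A)"

text \<open>\<open>entry \<E> w v\<close> is \<open>\<E>(w|v)\<close>.\<close>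

definition entry :: "(('v::finite) sqmat \<Rightarrow> ('w::finite) sqmat) \<Rightarrow> 'w \<Rightarrow> 'v \<Rightarrow> complex"
  where "entry \<E> w v = \<E> (\<epsilon> v) $ w $ w"

text \<open>The linear map between diagonal algebras with prescribed entries \<open>p w v\<close>.\<close>

definition map_of_entries :: "('w::finite \<Rightarrow> 'v::finite \<Rightarrow> complex) \<Rightarrow> 'v sqmat \<Rightarrow> 'w sqmat"
  where "map_of_entries p A = (\<Sum>v\<in>UNIV. \<Sum>w\<in>UNIV. cscale (p w v * A $ v $ v) (\<epsilon> w))"

section \<open>No-signalling correlations, simulation and composition\<close>

text \<open>
  A correlation over \<open>(V\<^sub>2, W\<^sub>1, V\<^sub>1, W\<^sub>2)\<close>: input pairs \<open>(v\<^sub>2, w\<^sub>1)\<close>, output pairs \<open>(v\<^sub>1, w\<^sub>2)\<close>.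
\<close>

type_synonym ('v2, 'w1, 'v1, 'w2) corr = "('v2 \<times> 'w1) sqmat \<Rightarrow> ('v1 \<times> 'w2) sqmat"

definition ns_correlation ::
  "('v2::finite, 'w1::finite, 'v1::finite, 'w2::finite) corr \<Rightarrow> bool"
  where "ns_correlation \<Gamma> \<longleftrightarrow> channel \<Gamma> \<and>
    (\<forall>v1 v2 w1 w1'. (\<Sum>w2\<in>UNIV. entry \<Gamma> (v1, w2) (v2, w1))
                  = (\<Sum>w2\<in>UNIV. entry \<Gamma> (v1, w2) (v2, w1'))) \<and>
    (\<forall>w2 w1 v2 v2'. (\<Sum>v1\<in>UNIV. entry \<Gamma> (v1, w2) (v2, w1))
                  = (\<Sum>v1\<in>UNIV. entry \<Gamma> (v1, w2) (v2', w1)))"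

definition simulate ::
  "('v2::finite, 'w1::finite, 'v1::finite, 'w2::finite) corr
    \<Rightarrow> ('v1 sqmat \<Rightarrow> 'w1 sqmat) \<Rightarrow> 'v2 sqmat \<Rightarrow> 'w2 sqmat"
  where "simulate \<Gamma> \<E> = map_of_entries
    (\<lambda>w2 v2. \<Sum>v1\<in>UNIV. \<Sum>w1\<in>UNIV. entry \<Gamma> (v1, w2) (v2, w1) * entry \<E> w1 v1)"

definition compose_corr ::
  "('v3::finite, 'w2::finite, 'v2::finite, 'w3::finite) corr
    \<Rightarrow> ('v2, 'w1::finite, 'v1::finite, 'w2) corr \<Rightarrow> ('v3, 'w1, 'v1, 'w3) corr"
  (infixl \<open>\<star>\<close> 70)
  where "\<Gamma>\<^sub>2 \<star> \<Gamma>\<^sub>1 = map_of_entries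
    (\<lambda>(v1, w3) (v3, w1). \<Sum>v2\<in>UNIV. \<Sum>w2\<in>UNIV.
       entry \<Gamma>\<^sub>1 (v1, w2) (v2, w1) * entry \<Gamma>\<^sub>2 (v2, w3) (v3, w2))"

section \<open>Local correlations\<close>

definition kronecker :: "('a::finite) sqmat \<Rightarrow> ('b::finite) sqmat \<Rightarrow> ('a \<times> 'b) sqmat"
  where "kronecker A B = (\<chi> i j. A $ fst i $ fst j * B $ snd i $ snd j)"

text \<open>
  The tensor product of two linear maps: the linear map on \<open>\<D>\<^sub>V\<^sub>W\<close> that sends
  \<open>\<epsilon> v \<otimes> \<epsilon> w = \<epsilon> (v, w)\<close> to \<open>\<Phi> (\<epsilon> v) \<otimes> \<Psi> (\<epsilon> w)\<close>.
\<close>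

definition tensor_map ::
  "(('v2::finite) sqmat \<Rightarrow> ('v1::finite) sqmat) \<Rightarrow> (('w1::finite) sqmat \<Rightarrow> ('w2::finite) sqmat)
    \<Rightarrow> ('v2, 'w1, 'v1, 'w2) corr"
  where "tensor_map \<Phi> \<Psi> A =
    (\<Sum>v\<in>UNIV. \<Sum>w\<in>UNIV. cscale (A $ (v, w) $ (v, w)) (kronecker (\<Phi> (\<epsilon> v)) (\<Psi> (\<epsilon> w))))"

definition loc_correlation ::
  "('v2::finite, 'w1::finite, 'v1::finite, 'w2::finite) corr \<Rightarrow> bool"
  where "loc_correlation \<Gamma> \<longleftrightarrow> ns_correlation \<Gamma> \<and>
    (\<exists>(n::nat) (c::nat \<Rightarrow> real) (\<Phi> :: nat \<Rightarrow> 'v2 sqmat \<Rightarrow> 'v1 sqmat)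
        (\<Psi> :: nat \<Rightarrow> 'w1 sqmat \<Rightarrow> 'w2 sqmat).
      (\<forall>k<n. 0 \<le> c k \<and> channel (\<Phi> k) \<and> channel (\<Psi> k)) \<and> (\<Sum>k<n. c k) = 1 \<and>
      (\<forall>A\<in>\<D>. \<Gamma> A = (\<Sum>k<n. c k *\<^sub>R tensor_map (\<Phi> k) (\<Psi> k) A)))"

section \<open>Complex Hilbert spaces\<close>

text \<open>
  Hilbert spaces are carrier-based, so that one can quantify over them.  The ring multiplication
  inherited from the record \<^typ>\<open>('a, 'b) module\<close> is unused, as usual for modules in HOL-Algebra.
\<close>

definition complex_field :: "complex ring"  (\<open>\<C>\<close>)
  where "\<C> = \<lparr>carrier = UNIV, mult = (*), one = 1, zero = 0, add = (+)\<rparr>"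

record 'h hilbert = "(complex, 'h) module" +
  ip :: "'h \<Rightarrow> 'h \<Rightarrow> complex"

definition hnorm :: "('h, 'm) hilbert_scheme \<Rightarrow> 'h \<Rightarrow> real"
  where "hnorm H x = sqrt (Re (ip H x x))"

locale pre_hilbert_space = module \<C> H for H :: "('h, 'm) hilbert_scheme" (structure) +
  assumes ip_add: "\<lbrakk>x \<in> carrier H; y \<in> carrier H; z \<in> carrier H\<rbrakk>
      \<Longrightarrow> ip H (x \<oplus>\<^bsub>H\<^esub> y) z = ip H x z + ip H y z"
    and ip_scale: "\<lbrakk>x \<in> carrier H; y \<in> carrier H\<rbrakk> \<Longrightarrow> ip H (c \<odot>\<^bsub>H\<^esub> x) y = c * ip H x y"
    and ip_cnj: "\<lbrakk>x \<in> carrier H; y \<in> carrier H\<rbrakk> \<Longrightarrow> ip H y x = cnj (ip H x y)"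
    and ip_nonneg: "x \<in> carrier H \<Longrightarrow> ip H x x \<in> \<real>\<^sub>\<ge>\<^sub>0"
    and ip_definite: "\<lbrakk>x \<in> carrier H; ip H x x = 0\<rbrakk> \<Longrightarrow> x = \<zero>\<^bsub>H\<^esub>"

locale hilbert_space = pre_hilbert_space +
  assumes complete:
    "\<lbrakk>\<And>n. \<sigma> n \<in> carrier H;
      \<And>e. e > 0 \<Longrightarrow> \<exists>N. \<forall>m\<ge>N. \<forall>n\<ge>N. hnorm H (\<sigma> m \<ominus>\<^bsub>H\<^esub> \<sigma> n) < e\<rbrakk>
      \<Longrightarrow> \<exists>x\<in>carrier H. (\<lambda>n. hnorm H (\<sigma> n \<ominus>\<^bsub>H\<^esub> x)) \<longlonglongrightarrow> 0"

definition bounded_operator :: "('h, 'm) hilbert_scheme \<Rightarrow> ('h \<Rightarrow> 'h) \<Rightarrow> bool"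
  where "bounded_operator H T \<longleftrightarrow> T \<in> carrier H \<rightarrow> carrier H \<and>
    (\<forall>x\<in>carrier H. \<forall>y\<in>carrier H. T (x \<oplus>\<^bsub>H\<^esub> y) = T x \<oplus>\<^bsub>H\<^esub> T y) \<and>
    (\<forall>c. \<forall>x\<in>carrier H. T (c \<odot>\<^bsub>H\<^esub> x) = c \<odot>\<^bsub>H\<^esub> T x) \<and>
    (\<exists>K. \<forall>x\<in>carrier H. hnorm H (T x) \<le> K * hnorm H x)"

definition positive_operator :: "('h, 'm) hilbert_scheme \<Rightarrow> ('h \<Rightarrow> 'h) \<Rightarrow> bool"
  where "positive_operator H T \<longleftrightarrow>
    bounded_operator H T \<and> (\<forall>x\<in>carrier H. ip H (T x) x \<in> \<real>\<^sub>\<ge>\<^sub>0)"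

definition povm :: "('h, 'm) hilbert_scheme \<Rightarrow> ('a::finite \<Rightarrow> 'h \<Rightarrow> 'h) \<Rightarrow> bool"
  where "povm H E \<longleftrightarrow> (\<forall>a. positive_operator H (E a)) \<and>
    (\<forall>x\<in>carrier H. (\<Oplus>\<^bsub>H\<^esub>a\<in>UNIV. E a x) = x)"

definition hspan :: "('h, 'm) hilbert_scheme \<Rightarrow> 'h set \<Rightarrow> 'h set"
  where "hspan H B = \<Inter>{S. submodule S \<C> H \<and> B \<subseteq> S}"

definition finite_dim :: "('h, 'm) hilbert_scheme \<Rightarrow> bool"
  where "finite_dim H \<longleftrightarrow> (\<exists>B. finite B \<and> B \<subseteq> carrier H \<and> hspan H B = carrier H)"

text \<open>
  \<open>tensor_space HV HW H \<tau>\<close>: the Hilbert space \<open>H\<close>, with \<open>\<tau> x y\<close> in the role of \<open>x \<otimes> y\<close>, is the tensor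
  product of the finite dimensional Hilbert spaces \<open>HV\<close> and \<open>HW\<close>.  (In finite dimension no closure
  of the span is needed.)
\<close>

definition tensor_space :: "('a, 'm) hilbert_scheme \<Rightarrow> ('b, 'n) hilbert_scheme
    \<Rightarrow> ('h, 'k) hilbert_scheme \<Rightarrow> ('a \<Rightarrow> 'b \<Rightarrow> 'h) \<Rightarrow> bool"
  where "tensor_space HV HW H \<tau> \<longleftrightarrow>
    (\<forall>x\<in>carrier HV. \<forall>y\<in>carrier HW. \<tau> x y \<in> carrier H) \<and>
    (\<forall>x\<in>carrier HV. \<forall>x'\<in>carrier HV. \<forall>y\<in>carrier HW.
       \<tau> (x \<oplus>\<^bsub>HV\<^esub> x') y = \<tau> x y \<oplus>\<^bsub>H\<^esub> \<tau> x' y) \<and>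
    (\<forall>x\<in>carrier HV. \<forall>y\<in>carrier HW. \<forall>y'\<in>carrier HW.
       \<tau> x (y \<oplus>\<^bsub>HW\<^esub> y') = \<tau> x y \<oplus>\<^bsub>H\<^esub> \<tau> x y') \<and>
    (\<forall>c. \<forall>x\<in>carrier HV. \<forall>y\<in>carrier HW.
       \<tau> (c \<odot>\<^bsub>HV\<^esub> x) y = c \<odot>\<^bsub>H\<^esub> \<tau> x y \<and> \<tau> x (c \<odot>\<^bsub>HW\<^esub> y) = c \<odot>\<^bsub>H\<^esub> \<tau> x y) \<and>
    (\<forall>x\<in>carrier HV. \<forall>x'\<in>carrier HV. \<forall>y\<in>carrier HW. \<forall>y'\<in>carrier HW.
       ip H (\<tau> x y) (\<tau> x' y') = ip HV x x' * ip HW y y') \<and>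
    hspan H {\<tau> x y | x y. x \<in> carrier HV \<and> y \<in> carrier HW} = carrier H"

section \<open>Quantum correlations\<close>

definition qc_model :: "('h, 'm) hilbert_scheme \<Rightarrow> 'h
    \<Rightarrow> ('v2 \<Rightarrow> 'v1 \<Rightarrow> 'h \<Rightarrow> 'h) \<Rightarrow> ('w1 \<Rightarrow> 'w2 \<Rightarrow> 'h \<Rightarrow> 'h)
    \<Rightarrow> ('v2::finite, 'w1::finite, 'v1::finite, 'w2::finite) corr \<Rightarrow> bool"
  where "qc_model H \<xi> E F \<Gamma> \<longleftrightarrow> hilbert_space H \<and> \<xi> \<in> carrier H \<and> hnorm H \<xi> = 1 \<and>
    (\<forall>v2. povm H (E v2)) \<and> (\<forall>w1. povm H (F w1)) \<and>
    (\<forall>v2 v1 w1 w2. \<forall>x\<in>carrier H. E v2 v1 (F w1 w2 x) = F w1 w2 (E v2 v1 x)) \<and>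
    (\<forall>v2 v1 w1 w2. entry \<Gamma> (v1, w2) (v2, w1) = ip H (E v2 v1 (F w1 w2 \<xi>)) \<xi>)"

text \<open>
  \<open>E v\<^sub>2 v\<^sub>1 = E' v\<^sub>2 v\<^sub>1 \<otimes> I\<close> and \<open>F w\<^sub>1 w\<^sub>2 = I \<otimes> F' w\<^sub>1 w\<^sub>2\<close>.
\<close>

definition q_model :: "('a, 'm) hilbert_scheme \<Rightarrow> ('b, 'n) hilbert_scheme
    \<Rightarrow> ('h, 'k) hilbert_scheme \<Rightarrow> ('a \<Rightarrow> 'b \<Rightarrow> 'h) \<Rightarrow> 'h
    \<Rightarrow> ('v2 \<Rightarrow> 'v1 \<Rightarrow> 'a \<Rightarrow> 'a) \<Rightarrow> ('w1 \<Rightarrow> 'w2 \<Rightarrow> 'b \<Rightarrow> 'b)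
    \<Rightarrow> ('v2 \<Rightarrow> 'v1 \<Rightarrow> 'h \<Rightarrow> 'h) \<Rightarrow> ('w1 \<Rightarrow> 'w2 \<Rightarrow> 'h \<Rightarrow> 'h)
    \<Rightarrow> ('v2::finite, 'w1::finite, 'v1::finite, 'w2::finite) corr \<Rightarrow> bool"
  where "q_model HV HW H \<tau> \<xi> E' F' E F \<Gamma> \<longleftrightarrow> qc_model H \<xi> E F \<Gamma> \<and>
    hilbert_space HV \<and> hilbert_space HW \<and> finite_dim HV \<and> finite_dim HW \<and>
    tensor_space HV HW H \<tau> \<and>
    (\<forall>v2 v1. bounded_operator HV (E' v2 v1)) \<and> (\<forall>w1 w2. bounded_operator HW (F' w1 w2)) \<and>
    (\<forall>v2 v1 w1 w2. \<forall>x\<in>carrier HV. \<forall>y\<in>carrier HW.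
       E v2 v1 (\<tau> x y) = \<tau> (E' v2 v1 x) y \<and> F w1 w2 (\<tau> x y) = \<tau> x (F' w1 w2 y))"

text \<open>
  HOL cannot quantify over types inside a formula, so the Hilbert spaces are taken with carrier
  inside one type with the cardinality of the continuum.  This is no restriction: the lemmas
  \<open>qc_correlationI\<close> and \<open>q_correlationI\<close> below show that a model on a Hilbert space with carrier
  in an arbitrary type already yields the property
  (in the first case by passing to the separable subspace generated by \<open>\<xi>\<close>).
\<close>

type_synonym universe = "nat \<Rightarrow> complex"

definition qc_correlation ::
  "('v2::finite, 'w1::finite, 'v1::finite, 'w2::finite) corr \<Rightarrow> bool"
  where "qc_correlation \<Gamma> \<longleftrightarrow> ns_correlation \<Gamma> \<and>
    (\<exists>(H :: universe hilbert) \<xi> E F. qc_model H \<xi> E F \<Gamma>)"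

definition q_correlation ::
  "('v2::finite, 'w1::finite, 'v1::finite, 'w2::finite) corr \<Rightarrow> bool"
  where "q_correlation \<Gamma> \<longleftrightarrow> ns_correlation \<Gamma> \<and>
    (\<exists>(HV :: universe hilbert) (HW :: universe hilbert) (H :: universe hilbert) \<tau> \<xi> E' F' E F.
       q_model HV HW H \<tau> \<xi> E' F' E F \<Gamma>)"

definition qa_correlation ::
  "('v2::finite, 'w1::finite, 'v1::finite, 'w2::finite) corr \<Rightarrow> bool"
  where "qa_correlation \<Gamma> \<longleftrightarrow> ns_correlation \<Gamma> \<and>
    (\<exists>\<Gamma>s. (\<forall>n. q_correlation (\<Gamma>s n)) \<and> (\<forall>A\<in>\<D>. (\<lambda>n. \<Gamma>s n A) \<longlonglongrightarrow> \<Gamma> A))"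

datatype corr_type = Loc | Q | Qa | Qc | Ns

fun corr_class ::
  "corr_type \<Rightarrow> ('v2::finite, 'w1::finite, 'v1::finite, 'w2::finite) corr set"
  where
    "corr_class Loc = {\<Gamma>. loc_correlation \<Gamma>}"
  | "corr_class Q = {\<Gamma>. q_correlation \<Gamma>}"
  | "corr_class Qa = {\<Gamma>. qa_correlation \<Gamma>}"
  | "corr_class Qc = {\<Gamma>. qc_correlation \<Gamma>}"
  | "corr_class Ns = {\<Gamma>. ns_correlation \<Gamma>}"

section \<open>Independence of the type carrying the Hilbert spaces\<close>

lemma complex_field_simps [simp]:
  "carrier \<C> = UNIV" "mult \<C> = (*)" "one \<C> = 1" "zero \<C> = 0" "add \<C> = (+)"
  by (simp_all add: complex_field_def)

lemma cring_complex_field: "cring \<C>"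
proof (rule cringI)
  have "\<exists>y. y + x = 0" for x :: complex by (rule exI[of _ "- x"]) simp
  thus "abelian_group \<C>" by (intro abelian_groupI) (auto simp: algebra_simps)
  show "comm_monoid \<C>" by (rule comm_monoidI) (auto simp: algebra_simps)
qed (auto simp: algebra_simps)

lemma nonneg_Reals_iff: "(z::complex) \<in> \<real>\<^sub>\<ge>\<^sub>0 \<longleftrightarrow> Im z = 0 \<and> 0 \<le> Re z"
  by (simp add: complex_nonneg_Reals_iff conj_commute)

context pre_hilbert_space
begin

lemma scale_in [simp]: "x \<in> carrier H \<Longrightarrow> c \<odot> x \<in> carrier H"
  by (rule smult_closed) auto

lemma ip_add2:
  "\<lbrakk>x \<in> carrier H; y \<in> carrier H; z \<in> carrier H\<rbrakk> \<Longrightarrow> ip H z (x \<oplus> y) = ip H z x + ip H z y"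
  using ip_cnj[of x z] ip_cnj[of y z] ip_cnj[of "x \<oplus> y" z] ip_add[of x y z] by simp

lemma ip_scale2:
  "\<lbrakk>x \<in> carrier H; y \<in> carrier H\<rbrakk> \<Longrightarrow> ip H y (c \<odot> x) = cnj c * ip H y x"
  using ip_cnj[of x y] ip_cnj[of "c \<odot> x" y] ip_scale[of x y c] by simp

lemma ip_zero: "x \<in> carrier H \<Longrightarrow> ip H \<zero> x = 0"
  using ip_add[of \<zero> \<zero> x] by simp

lemma ip_zero2: "x \<in> carrier H \<Longrightarrow> ip H x \<zero> = 0"
  using ip_add2[of \<zero> \<zero> x] by simp

lemma ip_minus: 
  "\<lbrakk>x \<in> carrier H; y \<in> carrier H; z \<in> carrier H\<rbrakk> \<Longrightarrow> ip H (x \<ominus> y) z = ip H x z - ip H y z"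
proof -
  assume a: "x \<in> carrier H" "y \<in> carrier H" "z \<in> carrier H"
  have "(x \<ominus> y) \<oplus> y = x" using a by (simp add: M.minus_eq M.a_assoc M.l_neg)
  thus ?thesis using ip_add[of "x \<ominus> y" y z] a by (simp add: M.minus_eq)
qed

lemma ip_minus2: 
  "\<lbrakk>x \<in> carrier H; y \<in> carrier H; z \<in> carrier H\<rbrakk> \<Longrightarrow> ip H z (x \<ominus> y) = ip H z x - ip H z y"
proof -
  assume a: "x \<in> carrier H" "y \<in> carrier H" "z \<in> carrier H"
  have "(x \<ominus> y) \<oplus> y = x" using a by (simp add: M.minus_eq M.a_assoc M.l_neg)
  thus ?thesis using ip_add2[of "x \<ominus> y" y z] a by (simp add: M.minus_eq)
qed

lemma ip_self: "x \<in> carrier H \<Longrightarrow> ip H x x = of_real ((hnorm H x)\<^sup>2)"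
  using ip_nonneg[of x] by (auto simp: hnorm_def nonneg_Reals_iff complex_eq_iff)

lemma hnorm_nonneg: "x \<in> carrier H \<Longrightarrow> 0 \<le> hnorm H x"
  using ip_nonneg[of x] by (auto simp: hnorm_def nonneg_Reals_iff)

lemma hnorm_eq_0: "x \<in> carrier H \<Longrightarrow> hnorm H x = 0 \<longleftrightarrow> x = \<zero>"
  using ip_self[of x] ip_definite[of x] ip_zero[of \<zero>] by (auto simp: hnorm_def)

lemma Cauchy_Schwarz:
  assumes x: "x \<in> carrier H" and y: "y \<in> carrier H"
  shows "cmod (ip H x y) \<le> hnorm H x * hnorm H y"
proof (cases "y = \<zero>")
  case True thus ?thesis using x by (simp add: ip_zero2 hnorm_nonneg hnorm_eq_0)
next
  case False
  define a N X where "a = ip H x y" "N = (hnorm H y)\<^sup>2" "X = (hnorm H x)\<^sup>2"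
  have N: "N > 0" using False y hnorm_eq_0[OF y] by (simp add: a_N_X_def)
  define z where "z = (of_real N \<odot> x) \<ominus> (a \<odot> y)"
  have z: "z \<in> carrier H" using x y by (simp add: z_def)
  have yx: "ip H y x = cnj a" using ip_cnj[OF x y] by (simp add: a_N_X_def)
  have xx: "ip H x x = of_real X" and yy: "ip H y y = of_real N"
    using ip_self x y by (simp_all add: a_N_X_def)
  have xy: "ip H x y = a" by (simp add: a_N_X_def)
  have "ip H z z = N * N * X - N * cnj a * a - a * (N * cnj a) + a * cnj a * N"
    unfolding z_def using x y 
    by (simp add: ip_minus ip_minus2 ip_scale ip_scale2 xx yy xy yx algebra_simps)
  also have "\<dots> = of_real (N * (N * X - (cmod a)\<^sup>2))"
    unfolding of_real_mult of_real_diff complex_norm_square by (simp add: algebra_simps)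
  finally have "0 \<le> N * (N * X - (cmod a)\<^sup>2)"
    using ip_nonneg[OF z] by (simp add: nonneg_Reals_iff)
  hence "(cmod a)\<^sup>2 \<le> N * X" using N by (simp add: zero_le_mult_iff)
  hence "(cmod a)\<^sup>2 \<le> (hnorm H x * hnorm H y)\<^sup>2" by (simp add: a_N_X_def power_mult_distrib mult.commute)
  thus ?thesis using hnorm_nonneg[OF x] hnorm_nonneg[OF y] unfolding a_N_X_def
    by (meson mult_nonneg_nonneg power2_le_imp_le)
qed

lemma hdist_sq: "\<lbrakk>x \<in> carrier H; y \<in> carrier H\<rbrakk> \<Longrightarrow>
    (hnorm H (x \<ominus> y))\<^sup>2 = Re (ip H x x) - 2 * Re (ip H x y) + Re (ip H y y)"
proof -
  assume a: "x \<in> carrier H" "y \<in> carrier H"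
  have "(hnorm H (x \<ominus> y))\<^sup>2 = Re (ip H (x \<ominus> y) (x \<ominus> y))"
    using ip_self[of "x \<ominus> y"] a by simp
  also have "\<dots> = Re (ip H x x) - 2 * Re (ip H x y) + Re (ip H y y)"
    using a ip_cnj[of x y] by (simp add: ip_minus ip_minus2)
  finally show ?thesis .
qed

lemma hdist_eq: "\<lbrakk>x \<in> carrier H; y \<in> carrier H\<rbrakk> \<Longrightarrow>
    hnorm H (x \<ominus> y) = sqrt (Re (ip H x x) - 2 * Re (ip H x y) + Re (ip H y y))"
  using hdist_sq[of x y] hnorm_nonneg[of "x \<ominus> y"]
  by (metis M.minus_closed real_sqrt_unique)

lemma hnorm_triangle:
  assumes x: "x \<in> carrier H" and y: "y \<in> carrier H"
  shows "hnorm H (x \<oplus> y) \<le> hnorm H x + hnorm H y"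
proof -
  have "(hnorm H (x \<oplus> y))\<^sup>2 = Re (ip H (x \<oplus> y) (x \<oplus> y))"
    using ip_self[of "x \<oplus> y"] x y by simp
  also have "\<dots> = Re (ip H x x) + 2 * Re (ip H x y) + Re (ip H y y)"
    using x y ip_cnj[of x y] by (simp add: ip_add ip_add2)
  also have "\<dots> \<le> (hnorm H x + hnorm H y)\<^sup>2"
    using ip_self[OF x] ip_self[OF y] Cauchy_Schwarz[OF x y] complex_Re_le_cmod[of "ip H x y"]
    by (simp add: power2_sum)
  finally show ?thesis
    using hnorm_nonneg[OF x] hnorm_nonneg[OF y] by (meson add_nonneg_nonneg power2_le_imp_le)
qed


lemma limit_ip:
  assumes "\<And>n. \<sigma> n \<in> carrier H" "x \<in> carrier H" "y \<in> carrier H"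
    and "(\<lambda>n. hnorm H (\<sigma> n \<ominus> x)) \<longlonglongrightarrow> 0" and "\<And>n. ip H (\<sigma> n) y = 0"
  shows "ip H x y = 0"
proof -
  have "cmod (ip H x y) \<le> hnorm H (\<sigma> n \<ominus> x) * hnorm H y" for n
    using Cauchy_Schwarz[of "\<sigma> n \<ominus> x" y] assms by (simp add: ip_minus)
  moreover have "(\<lambda>n. hnorm H (\<sigma> n \<ominus> x) * hnorm H y) \<longlonglongrightarrow> 0"
    using tendsto_mult_right[OF assms(4), of "hnorm H y"] by simp
  ultimately have "cmod (ip H x y) \<le> 0" by (intro LIMSEQ_le_const) auto
  thus ?thesis by simp
qed

lemma positive_selfadjoint:
  assumes "positive_operator H T" "x \<in> carrier H" "y \<in> carrier H"
  shows "ip H (T x) y = ip H x (T y)"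
proof -
  have T: "T u \<in> carrier H" "Im (ip H (T u) u) = 0" if "u \<in> carrier H" for u
    using assms(1) that by (auto simp: positive_operator_def bounded_operator_def nonneg_Reals_iff)
  have lin: "T (u \<oplus> v) = T u \<oplus> T v" "T (c \<odot> u) = c \<odot> T u"
    if "u \<in> carrier H" "v \<in> carrier H" for u v c
    using assms(1) that by (auto simp: positive_operator_def bounded_operator_def)
  have 1: "Im (ip H (T x) y + ip H (T y) x) = 0"
    using T(2)[of "x \<oplus> y"] T[OF assms(2)] T[OF assms(3)] assms(2,3) 
    by (simp add: lin ip_add ip_add2)
  have 2: "Im (\<i> * ip H (T y) x - \<i> * ip H (T x) y) = 0"
    using T(2)[of "x \<oplus> \<i> \<odot> y"] T[OF assms(2)] T[OF assms(3)] assms(2,3)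
    by (simp add: lin ip_add ip_add2 ip_scale ip_scale2)
  have "ip H x (T y) = cnj (ip H (T y) x)" using T assms by (intro ip_cnj) auto
  thus ?thesis using 1 2 by (simp add: complex_eq_iff)
qed

end

text \<open>
  The closed span \<open>K\<close> of a sequence \<open>s\<close> in \<open>H\<close>, given as a double orthocomplement, is carried over to
  a Hilbert space \<open>T\<close> inside the type \<^typ>\<open>universe\<close> along the injection \<open>j\<close> that lists the inner
  products of a vector with the members of \<open>s\<close>.
\<close>

locale restriction = hilbert_space +
  fixes s :: "nat \<Rightarrow> 'b"
  assumes s_in [simp]: "s n \<in> carrier H"
begin

definition K :: "'b set" where
  "K = {x \<in> carrier H. \<forall>y\<in>carrier H. (\<forall>n. ip H y (s n) = 0) \<longrightarrow> ip H x y = 0}"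

definition j :: "'b \<Rightarrow> universe" where "j x = (\<lambda>n. ip H x (s n))"

definition g :: "universe \<Rightarrow> 'b" where "g = inv_into K j"

definition T :: "universe hilbert" where
  "T = \<lparr>carrier = j ` K, mult = (\<lambda>_ _. j \<zero>), one = j \<zero>, zero = j \<zero>, 
       add = (\<lambda>u v. j (g u \<oplus> g v)), smult = (\<lambda>c u. j (c \<odot> g u)),
       ip = (\<lambda>u v. ip H (g u) (g v))\<rparr>"

lemma K_in: "x \<in> K \<Longrightarrow> x \<in> carrier H" by (simp add: K_def)

lemma K_add [simp]: "x \<in> K \<Longrightarrow> y \<in> K \<Longrightarrow> x \<oplus> y \<in> K" by (auto simp: K_def ip_add)
lemma K_scale [simp]: "x \<in> K \<Longrightarrow> c \<odot> x \<in> K" by (auto simp: K_def ip_scale)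
lemma K_zero [simp]: "\<zero> \<in> K" by (auto simp: K_def ip_zero)
lemma K_minus: "x \<in> K \<Longrightarrow> y \<in> K \<Longrightarrow> x \<ominus> y \<in> K" by (auto simp: K_def ip_minus)
lemma s_K: "s n \<in> K"
  unfolding K_def using ip_cnj[OF _ s_in[of n]] by simp

lemma j_inj: "inj_on j K"
proof (rule inj_onI)
  fix x y assume xy: "x \<in> K" "y \<in> K" "j x = j y"
  have d: "x \<ominus> y \<in> K" using xy by (simp add: K_minus)
  have "\<forall>n. ip H (x \<ominus> y) (s n) = 0" 
    using xy K_in by (auto simp: j_def ip_minus fun_eq_iff)
  hence "ip H (x \<ominus> y) (x \<ominus> y) = 0" using d by (auto simp: K_def)
  hence "x \<ominus> y = \<zero>" using d K_in by (intro ip_definite) auto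
  moreover have "(x \<ominus> y) \<oplus> y = x" 
    using xy K_in by (simp add: M.minus_eq M.a_assoc M.l_neg)
  ultimately show "x = y" using xy K_in by (metis M.l_zero)
qed

lemma gj [simp]: "x \<in> K \<Longrightarrow> g (j x) = x" by (simp add: g_def j_inj)

lemma T_simps [simp]: 
  "carrier T = j ` K" "zero T = j \<zero>"
  "x \<in> K \<Longrightarrow> y \<in> K \<Longrightarrow> j x \<oplus>\<^bsub>T\<^esub> j y = j (x \<oplus> y)"
  "x \<in> K \<Longrightarrow> c \<odot>\<^bsub>T\<^esub> j x = j (c \<odot> x)"
  "x \<in> K \<Longrightarrow> y \<in> K \<Longrightarrow> ip T (j x) (j y) = ip H x y"
  by (simp_all add: T_def)

lemma T_hnorm [simp]: "x \<in> K \<Longrightarrow> hnorm T (j x) = hnorm H x"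
  by (simp add: hnorm_def)

lemma T_abelian: "abelian_group T"
proof (rule abelian_groupI)
  fix x assume "x \<in> carrier T"
  then obtain a where a: "x = j a" "a \<in> K" by auto
  have "\<zero> \<ominus> a \<in> K" "(\<zero> \<ominus> a) \<oplus> a = \<zero>"
    using a K_in[of a] by (simp_all add: K_minus) (simp add: M.minus_eq M.l_neg)
  thus "\<exists>y\<in>carrier T. y \<oplus>\<^bsub>T\<^esub> x = \<zero>\<^bsub>T\<^esub>" using a by (auto intro!: bexI[of _ "\<zero> \<ominus> a"])
qed (auto simp: K_in M.a_ac)

lemma T_pre: "pre_hilbert_space T"
proof (intro pre_hilbert_space.intro pre_hilbert_space_axioms.intro)
  show "Module.module \<C> T"
    using cring_complex_field T_abelian 
    by (rule moduleI) (auto simp: K_in smult_l_distr[simplified] smult_r_distr smult_assoc1[simplified] smult_one[simplified])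
next
  fix x assume "x \<in> carrier T" "ip T x x = 0"
  then obtain a where "x = j a" "a \<in> K" "ip H a a = 0" by auto
  thus "x = \<zero>\<^bsub>T\<^esub>" using ip_definite[of a] K_in[of a] by simp
next
  fix x y assume "x \<in> carrier T" "y \<in> carrier T"
  then obtain a b where "x = j a" "a \<in> K" "y = j b" "b \<in> K" by auto
  thus "ip T y x = cnj (ip T x y)" using ip_cnj[of a b] K_in by simp
next
  fix x assume "x \<in> carrier T"
  then obtain a where "x = j a" "a \<in> K" by auto
  thus "ip T x x \<in> \<real>\<^sub>\<ge>\<^sub>0" using ip_nonneg[of a] K_in by simp
qed (auto simp: K_in ip_add ip_scale)

lemma T_dist: 
  assumes "x \<in> K" "y \<in> K" shows "hnorm T (j x \<ominus>\<^bsub>T\<^esub> j y) = hnorm H (x \<ominus> y)"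
  using assms K_in by (simp add: pre_hilbert_space.hdist_eq[OF T_pre] hdist_eq)

lemma T_hilbert: "hilbert_space T"
proof (intro hilbert_space.intro hilbert_space_axioms.intro T_pre)
  fix \<sigma> :: "nat \<Rightarrow> universe" assume a: "\<And>n. \<sigma> n \<in> carrier T" 
    and c: "\<And>e. e > 0 \<Longrightarrow> \<exists>N. \<forall>m\<ge>N. \<forall>n\<ge>N. hnorm T (\<sigma> m \<ominus>\<^bsub>T\<^esub> \<sigma> n) < e"
  have "\<forall>n. \<exists>x\<in>K. \<sigma> n = j x" using a by auto
  then obtain \<rho> where \<rho>: "\<And>n. \<rho> n \<in> K" "\<And>n. \<sigma> n = j (\<rho> n)" by metis
  obtain x where x: "x \<in> carrier H" "(\<lambda>n. hnorm H (\<rho> n \<ominus> x)) \<longlonglongrightarrow> 0"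
    using complete[of \<rho>] c \<rho> K_in by (auto simp: T_dist)
  have "x \<in> K"
    using limit_ip[of \<rho> x, OF K_in[OF \<rho>(1)] x(1) _ x(2)] x(1) \<rho> by (auto simp: K_def)
  thus "\<exists>x\<in>carrier T. (\<lambda>n. hnorm T (\<sigma> n \<ominus>\<^bsub>T\<^esub> x)) \<longlonglongrightarrow> 0"
    using x(2) \<rho> by (auto simp: T_dist)
qed

definition tr :: "('b \<Rightarrow> 'b) \<Rightarrow> universe \<Rightarrow> universe" where "tr A u = j (A (g u))"

lemma tr [simp]: "x \<in> K \<Longrightarrow> tr A (j x) = j (A x)" by (simp add: tr_def)

lemma tr_bounded:
  assumes "bounded_operator H A" "\<And>x. x \<in> K \<Longrightarrow> A x \<in> K"
  shows "bounded_operator T (tr A)"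
proof -
  obtain C where "\<And>x. x \<in> carrier H \<Longrightarrow> hnorm H (A x) \<le> C * hnorm H x"
    using assms(1) unfolding bounded_operator_def by blast
  hence "\<forall>u\<in>carrier T. hnorm T (tr A u) \<le> C * hnorm T u"
    using assms(2) K_in by auto
  thus ?thesis using assms K_in unfolding bounded_operator_def by auto
qed

lemma tr_positive:
  assumes "positive_operator H A" "\<And>x. x \<in> K \<Longrightarrow> A x \<in> K"
  shows "positive_operator T (tr A)"
  using assms K_in tr_bounded[of A] unfolding positive_operator_def by auto

lemma K_invariant:
  assumes A: "positive_operator H A" and r: "\<And>n. A (s n) \<in> range s" and x: "x \<in> K"
  shows "A x \<in> K"
proof -
  have Ac: "A u \<in> carrier H" if "u \<in> carrier H" for u
    using A that by (auto simp: positive_operator_def bounded_operator_def)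
  have "ip H (A x) y = 0" if y: "y \<in> carrier H" "\<forall>n. ip H y (s n) = 0" for y
  proof -
    have "ip H (A y) (s n) = 0" for n
      using r[of n] y positive_selfadjoint[OF A y(1) s_in] by auto
    hence "ip H x (A y) = 0" using x y Ac by (auto simp: K_def)
    thus ?thesis using positive_selfadjoint[OF A K_in[OF x] y(1)] by simp
  qed
  thus ?thesis using x Ac by (auto simp: K_def)
qed

lemma T_finsum:
  assumes "finite A" "\<And>a. a \<in> A \<Longrightarrow> f a \<in> K"
  shows "finsum T (\<lambda>a. j (f a)) A = j (finsum H f A) \<and> finsum H f A \<in> K"
proof -
  interpret T: abelian_group T by (rule T_abelian)
  show ?thesis using assms
  proof (induction A)
    case (insert a A)
    have "finsum T (\<lambda>a. j (f a)) (insert a A) = j (f a) \<oplus>\<^bsub>T\<^esub> finsum T (\<lambda>a. j (f a)) A"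
      using insert by (intro T.finsum_insert) auto
    moreover have "finsum H f (insert a A) = f a \<oplus> finsum H f A"
      using insert K_in by (intro M.finsum_insert) auto
    ultimately show ?case using insert by auto
  qed simp
qed

lemma tr_povm:
  fixes E :: "'x::finite \<Rightarrow> 'b \<Rightarrow> 'b"
  assumes "povm H E" "\<And>a x. x \<in> K \<Longrightarrow> E a x \<in> K"
  shows "povm T (\<lambda>a. tr (E a))"
proof -
  have "finsum T (\<lambda>a. tr (E a) (j x)) UNIV = j x" if "x \<in> K" for x
    using T_finsum[of UNIV "\<lambda>a. E a x"] assms that K_in[OF that] by (simp add: povm_def)
  thus ?thesis using assms by (auto simp: povm_def intro: tr_positive)
qed

lemma tr_qc_model:
  assumes q: "qc_model H \<xi> E F \<Gamma>" and \<xi>: "\<xi> \<in> K" 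
    and EF: "\<And>a b x. x \<in> K \<Longrightarrow> E a b x \<in> K" "\<And>a b x. x \<in> K \<Longrightarrow> F a b x \<in> K"
  shows "qc_model T (j \<xi>) (\<lambda>a b. tr (E a b)) (\<lambda>a b. tr (F a b)) \<Gamma>"
  unfolding qc_model_def
  using q T_hilbert \<xi> EF K_in by (auto simp: qc_model_def intro!: tr_povm)

end

lemma hspan_subset: "pre_hilbert_space H \<Longrightarrow> B \<subseteq> carrier H \<Longrightarrow> hspan H B \<subseteq> carrier H"
  unfolding hspan_def pre_hilbert_space_def using module.carrier_is_submodule by blast

lemma (in pre_hilbert_space) submoduleI':
  assumes "S \<subseteq> carrier H" "\<zero> \<in> S" "\<And>a b. a \<in> S \<Longrightarrow> b \<in> S \<Longrightarrow> a \<oplus> b \<in> S"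
    "\<And>c a. a \<in> S \<Longrightarrow> c \<odot> a \<in> S"
  shows "submodule S \<C> H"
proof (rule submoduleI)
  fix a assume a: "a \<in> S"
  have c: "\<ominus>\<^bsub>\<C>\<^esub> 1 \<in> carrier \<C>" by simp
  have "\<ominus> a = (\<ominus>\<^bsub>\<C>\<^esub> 1) \<odot> a" 
    using smult_l_minus[of 1 a] smult_one[of a] a assms(1) by auto
  thus "\<ominus> a \<in> S" using assms(4) a by simp
qed (use assms in auto)

lemma (in pre_hilbert_space) orth_submodule:
  "z \<in> carrier H \<Longrightarrow> submodule {u \<in> carrier H. ip H z u = 0} \<C> H"
  by (rule submoduleI') (auto simp: ip_zero2 ip_add2 ip_scale2)

lemma hspanD: "u \<in> hspan H B \<Longrightarrow> submodule S \<C> H \<Longrightarrow> B \<subseteq> S \<Longrightarrow> u \<in> S"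
  by (auto simp: hspan_def)

lemma (in pre_hilbert_space) span_orth:
  assumes "hspan H B = carrier H" "B \<subseteq> carrier H" "z \<in> carrier H" "\<And>b. b \<in> B \<Longrightarrow> ip H z b = 0"
  shows "z = \<zero>"
proof -
  have "z \<in> {u \<in> carrier H. ip H z u = 0}"
    by (rule hspanD[OF _ orth_submodule[OF assms(3)], of _ B]) (use assms in auto)
  thus ?thesis using ip_definite by blast
qed

locale total_restriction = restriction +
  assumes total: "\<lbrakk>z \<in> carrier H; \<And>n. ip H z (s n) = 0\<rbrakk> \<Longrightarrow> z = \<zero>"
begin

lemma K_eq: "K = carrier H"
proof
  show "carrier H \<subseteq> K"
  proof
    fix x assume x: "x \<in> carrier H"
    have "ip H x y = 0" if "y \<in> carrier H" "\<forall>n. ip H y (s n) = 0" for y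
    proof -
      have "y = \<zero>" using total[of y] that by blast
      thus ?thesis using x by (simp add: ip_zero2)
    qed
    thus "x \<in> K" using x by (simp add: K_def)
  qed
qed (auto simp: K_in)

lemma span_T:
  assumes "hspan H B = carrier H" "B \<subseteq> carrier H"
  shows "hspan T (j ` B) = carrier T"
proof
  show "hspan T (j ` B) \<subseteq> carrier T"
    using assms by (intro hspan_subset T_pre) (auto simp: K_eq)
  show "carrier T \<subseteq> hspan T (j ` B)"
  proof (clarsimp simp: hspan_def)
    fix x S assume x: "x \<in> K" and S: "submodule S \<C> T" "j ` B \<subseteq> S"
    interpret S: submodule S \<C> T by fact
    have [simp]: "j \<zero> \<in> S" using S.one_closed by simp
    have add: "j (a \<oplus> b) \<in> S" if "a \<in> K" "b \<in> K" "j a \<in> S" "j b \<in> S" for a b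
      using S.m_closed[OF that(3,4)] that by simp
    have sc: "j (c \<odot> a) \<in> S" if "a \<in> K" "j a \<in> S" for a c
      using S.smult_closed[of c "j a"] that by simp
    have "submodule {x \<in> K. j x \<in> S} \<C> H"
      by (rule submoduleI') (auto simp: K_in add sc)
    moreover have "x \<in> hspan H B" "B \<subseteq> {x \<in> K. j x \<in> S}"
      using x assms S(2) by (auto simp: K_eq)
    ultimately have "x \<in> {x \<in> K. j x \<in> S}" by (metis hspanD)
    thus "j x \<in> S" by simp
  qed
qed

end

lemma finite_total_restriction:
  assumes "hilbert_space H" "finite B" "B \<subseteq> carrier H" 
    "\<And>z. \<lbrakk>z \<in> carrier H; \<And>b. b \<in> B \<Longrightarrow> ip H z b = 0\<rbrakk> \<Longrightarrow> z = \<zero>\<^bsub>H\<^esub>"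
  shows "\<exists>s. total_restriction H s"
proof -
  interpret hilbert_space H by fact
  define s where "s = from_nat_into (insert \<zero>\<^bsub>H\<^esub> B)"
  have "countable (insert \<zero>\<^bsub>H\<^esub> B)" using assms(2) by (simp add: countable_finite)
  hence s: "range s = insert \<zero>\<^bsub>H\<^esub> B" 
    unfolding s_def by (rule range_from_nat_into[rotated]) simp
  have "restriction H s"
  proof (intro restriction.intro restriction_axioms.intro assms(1))
    fix n
    have "s n \<in> insert \<zero>\<^bsub>H\<^esub> B" using s by blast
    thus "s n \<in> carrier H" using assms(3) by auto
  qed
  moreover have "total_restriction_axioms H s"
  proof (rule total_restriction_axioms.intro)
    fix z assume z: "z \<in> carrier H" "\<And>n. ip H z (s n) = 0"
    show "z = \<zero>\<^bsub>H\<^esub>"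
    proof (rule assms(4)[OF z(1)])
      fix b assume "b \<in> B"
      hence "b \<in> range s" using s by blast
      thus "ip H z b = 0" using z(2) by blast
    qed
  qed
  ultimately have "total_restriction H s" by (rule total_restriction.intro)
  thus ?thesis by (rule exI[of _ s])
qed

theorem qc_correlationI:
  fixes H :: "'h hilbert"
  assumes ns: "ns_correlation (\<Gamma> :: ('v2::finite, 'w1::finite, 'v1::finite, 'w2::finite) corr)"
    and q: "qc_model H \<xi> E F \<Gamma>"
  shows "qc_correlation \<Gamma>"
proof -
  let ?op = "\<lambda>l. case l of Inl (a, b) \<Rightarrow> E a b | Inr (c, d) \<Rightarrow> F c d"
  define S where "S = (\<lambda>l. foldr ?op l \<xi>) ` lists UNIV"
  have "countable S" unfolding S_def
    by (intro countable_image countable_lists countable_finite) auto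
  moreover have \<xi>S: "\<xi> \<in> S" unfolding S_def by (rule image_eqI[of _ _ "[]"]) auto
  ultimately have "range (from_nat_into S) = S" by (intro range_from_nat_into) auto
  then obtain s :: "nat \<Rightarrow> 'h" where s: "range s = S" by (rule that)
  have S_step: "?op l x \<in> S" if "x \<in> S" for l x
    using that unfolding S_def by (auto intro: image_eqI[of _ _ "l # _"])
  have ES: "E a b x \<in> S" "F c d x \<in> S" if "x \<in> S" for a b c d x
    using S_step[OF that, of "Inl (a, b)"] S_step[OF that, of "Inr (c, d)"] by simp_all
  have pos: "positive_operator H (E a b)" "positive_operator H (F c d)" for a b c d
    using q by (auto simp: qc_model_def povm_def)
  have "foldr ?op l \<xi> \<in> carrier H" for l
    using q pos
    by (induction l) (auto simp: qc_model_def positive_operator_def bounded_operator_def Pi_def split: sum.split)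
  hence "S \<subseteq> carrier H" unfolding S_def by auto
  hence sc: "s n \<in> carrier H" for n using s by blast
  interpret restriction H s
    using q sc by (intro restriction.intro restriction_axioms.intro) (auto simp: qc_model_def)
  have r: "E a b (s n) \<in> range s" "F c d (s n) \<in> range s" for a b c d n
    using ES[of "s n"] s by auto
  have "\<xi> \<in> K" using \<xi>S s s_K by blast
  with tr_qc_model[OF q this K_invariant[OF pos(1) r(1)] K_invariant[OF pos(2) r(2)]] ns
  show ?thesis unfolding qc_correlation_def by blast
qed

theorem q_correlationI:
  fixes HV :: "'a hilbert" and HW :: "'b hilbert" and H :: "'h hilbert"
  assumes ns: "ns_correlation (\<Gamma> :: ('v2::finite, 'w1::finite, 'v1::finite, 'w2::finite) corr)"
    and q: "q_model HV HW H \<tau> \<xi> E' F' E F \<Gamma>"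
  shows "q_correlation \<Gamma>"
proof -
  have hil: "hilbert_space HV" "hilbert_space HW" "hilbert_space H"
    and qc: "qc_model H \<xi> E F \<Gamma>" and ten: "tensor_space HV HW H \<tau>"
    and bd: "\<And>a b. bounded_operator HV (E' a b)" "\<And>a b. bounded_operator HW (F' a b)"
    and EF: "\<And>a b c d x y. x \<in> carrier HV \<Longrightarrow> y \<in> carrier HW \<Longrightarrow>
       E a b (\<tau> x y) = \<tau> (E' a b x) y \<and> F c d (\<tau> x y) = \<tau> x (F' c d y)"
    using q by (auto simp: q_model_def qc_model_def)
  interpret HV: hilbert_space HV by fact
  interpret HW: hilbert_space HW by fact
  interpret H: hilbert_space H by fact
  have \<tau>_in: "\<tau> x y \<in> carrier H" if "x \<in> carrier HV" "y \<in> carrier HW" for x y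
    using ten that by (auto simp: tensor_space_def)
  have \<tau>_add: "\<tau> (x \<oplus>\<^bsub>HV\<^esub> x') y = \<tau> x y \<oplus>\<^bsub>H\<^esub> \<tau> x' y" "\<tau> x (y \<oplus>\<^bsub>HW\<^esub> y') = \<tau> x y \<oplus>\<^bsub>H\<^esub> \<tau> x y'"
    if "x \<in> carrier HV" "x' \<in> carrier HV" "y \<in> carrier HW" "y' \<in> carrier HW" for x x' y y'
    using ten that by (auto simp: tensor_space_def)
  have \<tau>_sc: "\<tau> (c \<odot>\<^bsub>HV\<^esub> x) y = c \<odot>\<^bsub>H\<^esub> \<tau> x y" "\<tau> x (c \<odot>\<^bsub>HW\<^esub> y) = c \<odot>\<^bsub>H\<^esub> \<tau> x y"
    if "x \<in> carrier HV" "y \<in> carrier HW" for c x y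
    using ten that by (auto simp: tensor_space_def)
  have \<tau>_ip: "ip H (\<tau> x y) (\<tau> x' y') = ip HV x x' * ip HW y y'"
    if "x \<in> carrier HV" "x' \<in> carrier HV" "y \<in> carrier HW" "y' \<in> carrier HW" for x x' y y'
    using ten that by (auto simp: tensor_space_def)
  define P where "P = {\<tau> x y | x y. x \<in> carrier HV \<and> y \<in> carrier HW}"
  have P: "hspan H P = carrier H" "P \<subseteq> carrier H"
    using ten \<tau>_in by (auto simp: tensor_space_def P_def)
  have \<tau>0: "\<tau> \<zero>\<^bsub>HV\<^esub> y = \<zero>\<^bsub>H\<^esub>" if "y \<in> carrier HW" for y
    using \<tau>_ip[of "\<zero>\<^bsub>HV\<^esub>" "\<zero>\<^bsub>HV\<^esub>" y y] that \<tau>_in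
    by (intro H.ip_definite) (auto simp: HV.ip_zero)
  have \<tau>0': "\<tau> x \<zero>\<^bsub>HW\<^esub> = \<zero>\<^bsub>H\<^esub>" if "x \<in> carrier HV" for x
    using \<tau>_ip[of x x "\<zero>\<^bsub>HW\<^esub>" "\<zero>\<^bsub>HW\<^esub>"] that \<tau>_in
    by (intro H.ip_definite) (auto simp: HW.ip_zero)
  obtain BV where BV: "finite BV" "BV \<subseteq> carrier HV" "hspan HV BV = carrier HV"
    using q by (auto simp: q_model_def finite_dim_def)
  obtain BW where BW: "finite BW" "BW \<subseteq> carrier HW" "hspan HW BW = carrier HW"
    using q by (auto simp: q_model_def finite_dim_def)
  obtain sV where sV: "total_restriction HV sV"
    using finite_total_restriction[OF hil(1) BV(1,2) HV.span_orth[OF BV(3,2)]] by blast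
  obtain sW where sW: "total_restriction HW sW"
    using finite_total_restriction[OF hil(2) BW(1,2) HW.span_orth[OF BW(3,2)]] by blast
  have "z = \<zero>\<^bsub>H\<^esub>" if z: "z \<in> carrier H" and o: "\<And>b. b \<in> case_prod \<tau> ` (BV \<times> BW) \<Longrightarrow> ip H z b = 0" for z
  proof -
    have 1: "ip H z (\<tau> x y) = 0" if x: "x \<in> BV" and y: "y \<in> carrier HW" for x y
    proof -
      have x': "x \<in> carrier HV" using BV x by auto
      have "submodule {y \<in> carrier HW. ip H z (\<tau> x y) = 0} \<C> HW"
        using x' z by (intro HW.submoduleI')
          (auto simp: \<tau>_add \<tau>_sc \<tau>0' \<tau>_in H.ip_add2 H.ip_scale2 H.ip_zero2)
      moreover have "y \<in> hspan HW BW" "BW \<subseteq> {y \<in> carrier HW. ip H z (\<tau> x y) = 0}"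
        using BW y x o by auto
      ultimately have "y \<in> {y \<in> carrier HW. ip H z (\<tau> x y) = 0}" by (metis hspanD)
      thus ?thesis by simp
    qed
    have 2: "ip H z (\<tau> x y) = 0" if x: "x \<in> carrier HV" and y: "y \<in> carrier HW" for x y
    proof -
      have "submodule {x \<in> carrier HV. ip H z (\<tau> x y) = 0} \<C> HV"
        using y z by (intro HV.submoduleI')
          (auto simp: \<tau>_add \<tau>_sc \<tau>0 \<tau>_in H.ip_add2 H.ip_scale2 H.ip_zero2)
      moreover have "x \<in> hspan HV BV" "BV \<subseteq> {x \<in> carrier HV. ip H z (\<tau> x y) = 0}"
        using BV y x 1 by auto
      ultimately have "x \<in> {x \<in> carrier HV. ip H z (\<tau> x y) = 0}" by (metis hspanD)
      thus ?thesis by simp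
    qed
    show ?thesis using H.span_orth[OF P z] 2 by (auto simp: P_def)
  qed
  moreover have "finite (case_prod \<tau> ` (BV \<times> BW))" "case_prod \<tau> ` (BV \<times> BW) \<subseteq> carrier H"
    using BV(1,2) BW(1,2) by (auto intro!: \<tau>_in)
  ultimately obtain s where s: "total_restriction H s"
    using finite_total_restriction[OF hil(3)] by blast
  interpret V: total_restriction HV sV by fact
  interpret W: total_restriction HW sW by fact
  interpret R: total_restriction H s by fact
  note K = V.K_eq W.K_eq R.K_eq
  define \<tau>' where "\<tau>' u v = R.j (\<tau> (V.g u) (W.g v))" for u v
  have \<tau>' [simp]: "\<tau>' (V.j x) (W.j y) = R.j (\<tau> x y)"
    if "x \<in> carrier HV" "y \<in> carrier HW" for x y
    using that K by (simp add: \<tau>'_def)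
  have P': "{\<tau>' u v | u v. u \<in> carrier V.T \<and> v \<in> carrier W.T} = R.j ` P"
  proof safe
    fix u v assume "u \<in> carrier V.T" "v \<in> carrier W.T"
    then obtain x y where "u = V.j x" "v = W.j y" "x \<in> carrier HV" "y \<in> carrier HW"
      using K by auto
    thus "\<tau>' u v \<in> R.j ` P" by (auto simp: P_def)
  next
    fix z assume "z \<in> P"
    then obtain x y where xy: "z = \<tau> x y" "x \<in> carrier HV" "y \<in> carrier HW"
      by (auto simp: P_def)
    thus "\<exists>u v. R.j z = \<tau>' u v \<and> u \<in> carrier V.T \<and> v \<in> carrier W.T"
      using K by (intro exI[of _ "V.j x"] exI[of _ "W.j y"]) auto
  qed
  have posEF: "positive_operator H (E a b)" "positive_operator H (F c d)" for a b c d
    using qc by (auto simp: qc_model_def povm_def)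
  have in_EF: "E a b x \<in> R.K" "F c d x \<in> R.K" if "x \<in> R.K" for a b c d x
    using posEF(1)[of a b] posEF(2)[of c d] that K by (auto simp: positive_operator_def bounded_operator_def)
  have in_EF': "E' a b x \<in> V.K" "F' c d y \<in> W.K" if "x \<in> V.K" "y \<in> W.K" for a b c d x y
    using bd(1)[of a b] bd(2)[of c d] that K by (auto simp: bounded_operator_def)
  have \<xi>: "\<xi> \<in> R.K" using qc K by (simp add: qc_model_def)
  have qc': "qc_model R.T (R.j \<xi>) (\<lambda>a b. R.tr (E a b)) (\<lambda>a b. R.tr (F a b)) \<Gamma>"
    using R.tr_qc_model[OF qc \<xi> in_EF] .
  have ten': "tensor_space V.T W.T R.T \<tau>'"
    unfolding tensor_space_def P' using R.span_T[OF P]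
    by (auto simp: K \<tau>_in \<tau>_add \<tau>_sc \<tau>_ip)
  have fdV: "finite_dim V.T"
    unfolding finite_dim_def using V.span_T[OF BV(3,2)] BV K
    by (intro exI[of _ "V.j ` BV"]) auto
  have fdW: "finite_dim W.T"
    unfolding finite_dim_def using W.span_T[OF BW(3,2)] BW K
    by (intro exI[of _ "W.j ` BW"]) auto
  have bd': "bounded_operator V.T (V.tr (E' a b))" "bounded_operator W.T (W.tr (F' c d))" for a b c d
    using bd in_EF'(1)[OF _ W.K_zero] in_EF'(2)[OF V.K_zero] by (auto intro!: V.tr_bounded W.tr_bounded)
  have "R.tr (E a b) (\<tau>' u v) = \<tau>' (V.tr (E' a b) u) v \<and> R.tr (F c d) (\<tau>' u v) = \<tau>' u (W.tr (F' c d) v)"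
    if uv: "u \<in> carrier V.T" "v \<in> carrier W.T" for a b c d u v
  proof -
    obtain x y where xy: "u = V.j x" "v = W.j y" "x \<in> V.K" "y \<in> W.K" using uv by auto
    show ?thesis using xy in_EF'[OF xy(3,4)] EF[of x y a b c d] by (simp add: K \<tau>_in)
  qed
  hence "q_model V.T W.T R.T \<tau>' (R.j \<xi>) (\<lambda>a b. V.tr (E' a b)) (\<lambda>a b. W.tr (F' a b))
      (\<lambda>a b. R.tr (E a b)) (\<lambda>a b. R.tr (F a b)) \<Gamma>"
    unfolding q_model_def using qc' ten' fdV fdW bd' V.T_hilbert W.T_hilbert by blast
  thus ?thesis using ns unfolding q_correlation_def by blast
qed

end

theory Submission
  imports Defs
begin

text \<open>
  Given models of \<open>\<Gamma>\<^sub>1\<close> and \<open>\<Gamma>\<^sub>2\<close> with POVMs \<open>E\<^sub>1, F\<^sub>1\<close> and \<open>E\<^sub>2, F\<^sub>2\<close>, the composition is modelled on the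
  tensor product of the two Hilbert spaces, with state \<open>\<xi>\<^sub>1 \<otimes> \<xi>\<^sub>2\<close>, by
  \<open>E v\<^sub>3 v\<^sub>1 = (\<Sum>v\<^sub>2. E\<^sub>1 v\<^sub>2 v\<^sub>1 \<otimes> E\<^sub>2 v\<^sub>3 v\<^sub>2)\<close> and \<open>F w\<^sub>1 w\<^sub>3 = (\<Sum>w\<^sub>2. F\<^sub>1 w\<^sub>1 w\<^sub>2 \<otimes> F\<^sub>2 w\<^sub>2 w\<^sub>3)\<close>.
  The tensor product of \<open>H\<^sub>1\<close> and \<open>H\<^sub>2\<close> is realised as the reproducing kernel Hilbert space of the
  kernel \<open>\<langle>x, x'\<rangle>\<langle>y, y'\<rangle>\<close>, which is positive semidefinite by the Schur product theorem; a tensor product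
  of positive operators then acts on functions by \<open>f \<mapsto> f \<circ> (A \<times> B)\<close>, and the Schur product theorem also
  yields its positivity and boundedness.  In the finite dimensional case the same construction is
  applied to each side of the bipartition, and the vector \<open>\<xi>\<^sub>1 \<otimes> \<xi>\<^sub>2\<close> is regrouped accordingly.
\<close>

section \<open>Channels and their entries\<close>

text \<open>The composition is circular: v2 leaves \<open>\<Gamma>\<^sub>2\<close> and enters
  \<open>\<Gamma>\<^sub>1\<close>, while w2 leaves \<open>\<Gamma>\<^sub>1\<close> and enters
  \<open>\<Gamma>\<^sub>2\<close>. It is not a product of channels, and no-signalling is what lets
  the loop be summed out. On operators each side is a genuine sequence of measurements: the outcome
  of \<open>E\<^sub>2\<close> is the setting of \<open>E\<^sub>1\<close>, the outcome of
  \<open>F\<^sub>1\<close> the setting of \<open>F\<^sub>2\<close>. This is why the sums are POVMs;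
  they commute because they do so in each tensor factor. Kernels are used because vectors then are
  functions: equality is pointwise, no quotient of formal tensors is formed, and composition with a
  map of points is well defined from the start. The quantum class poses two more obstacles. A model
  gives the operators on the factors only as bounded ones, so their being POVMs has to be read off
  from the operators on the tensor product. And the product state is bracketed as (V1 W1)(V2 W2),
  whereas a model needs (V1 V2)(W1 W2); expanding both states into finite sums of simple tensors
  replaces a unitary between the bracketings by an exchange of finite sums.\<close>

lemma map_of_entries_nth:
  "map_of_entries p A $ i $ j = (if i = j then \<Sum>v\<in>UNIV. p i v * A $ v $ v else 0)"
proof -
  have "map_of_entries p A $ i $ j = (\<Sum>v\<in>UNIV. \<Sum>w\<in>UNIV. if i = w \<and> j = w then p w v * A $ v $ v else 0)"
    by (simp add: map_of_entries_def cscale_def diag_unit_def if_distrib cong: if_cong)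
  also have "\<dots> = (if i = j then \<Sum>v\<in>UNIV. p i v * A $ v $ v else 0)"
  proof (cases "i = j")
    case False
    hence "(if i = w \<and> j = w then p w v * A $ v $ v else 0) = 0" for w v by auto
    thus ?thesis using False by simp
  qed simp
  finally show ?thesis .
qed

lemma entry_map_of_entries [simp]: "entry (map_of_entries p) = p"
  by (simp add: fun_eq_iff entry_def map_of_entries_nth diag_unit_def if_distrib cong: if_cong)

lemma diagonalD: "A \<in> \<D> \<Longrightarrow> i \<noteq> j \<Longrightarrow> A $ i $ j = 0"
  by (simp add: diagonal_def)

lemma diag_unit_diagonal [simp]: "\<epsilon> v \<in> \<D>"
  by (auto simp: diagonal_def diag_unit_def)

lemma map_of_entries_diagonal [simp]: "map_of_entries p A \<in> \<D>"
  by (simp add: diagonal_def map_of_entries_nth)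

text \<open>A diagonal matrix is the combination of the units with its diagonal entries as
  coefficients, so linearity leaves only the images of the units, and these are diagonal. From here
  on maps are handled through their entries.\<close>

lemma diag_linear_expand:
  assumes E: "diag_linear \<E>" and A: "A \<in> \<D>"
  shows "\<E> A = map_of_entries (entry \<E>) A"
proof -
  have D: "cscale c B \<in> \<D>" if "B \<in> \<D>" for c and B :: "'a sqmat"
    using that by (auto simp: diagonal_def cscale_def)
  have sum_D: "(\<Sum>v\<in>S. B v) \<in> \<D>" if "\<And>v. B v \<in> \<D>" for S and B :: "'a \<Rightarrow> 'a sqmat"
    using that by (auto simp: diagonal_def)
  have add: "\<E> (B + B') = \<E> B + \<E> B'" and sc: "\<E> (cscale c B) = cscale c (\<E> B)"
    and cl: "\<E> B \<in> \<D>" if "B \<in> \<D>" "B' \<in> \<D>" for B B' c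
    using E that by (auto simp: diag_linear_def)
  have "cscale 0 B = 0" for B :: "'b sqmat" by (simp add: cscale_def vec_eq_iff)
  moreover have "cscale 0 B = 0" for B :: "'a sqmat" by (simp add: cscale_def vec_eq_iff)
  ultimately have z: "\<E> 0 = 0"
    using sc[of 0 0 0] by (simp add: diagonal_def)
  have sum: "\<E> (\<Sum>v\<in>S. B v) = (\<Sum>v\<in>S. \<E> (B v))" if B: "\<And>v. B v \<in> \<D>" for S and B :: "'a \<Rightarrow> 'a sqmat"
    by (induction S rule: infinite_finite_induct) (simp_all add: z add sum_D B)
  have "A $ i $ j = (\<Sum>v\<in>UNIV. cscale (A $ v $ v) (\<epsilon> v)) $ i $ j" for i j
  proof -
    have "(\<Sum>v\<in>UNIV. cscale (A $ v $ v) (\<epsilon> v)) $ i $ j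
        = (\<Sum>v\<in>UNIV. if v = i then if j = i then A $ i $ i else 0 else 0)"
      unfolding sum_component cscale_def diag_unit_def vec_lambda_beta by (rule sum.cong) auto
    thus ?thesis using A by (auto simp: diagonalD)
  qed
  hence "A = (\<Sum>v\<in>UNIV. cscale (A $ v $ v) (\<epsilon> v))"
    unfolding vec_eq_iff by blast
  also have "\<E> \<dots> = (\<Sum>v\<in>UNIV. cscale (A $ v $ v) (\<E> (\<epsilon> v)))"
    by (simp add: sum D sc[OF diag_unit_diagonal diag_unit_diagonal])
  finally have "\<E> A $ i $ j = (\<Sum>v\<in>UNIV. A $ v $ v * \<E> (\<epsilon> v) $ i $ j)" for i j
    by (simp add: cscale_def)
  moreover have "\<E> (\<epsilon> v) $ i $ j = 0" if "i \<noteq> j" for v i j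
    using that cl diagonalD by (metis diag_unit_diagonal)
  ultimately show ?thesis
    by (simp add: vec_eq_iff map_of_entries_nth entry_def mult.commute)
qed

text \<open>On a diagonal matrix the quadratic form is the sum of |x_i|^2 A_ii, and the basis
  vectors \<open>axis i 1\<close> isolate the single entries.\<close>

lemma pos_matrix_diagonal:
  assumes "A \<in> \<D>"
  shows "pos_matrix A \<longleftrightarrow> (\<forall>i. A $ i $ i \<in> \<real>\<^sub>\<ge>\<^sub>0)"
proof -
  have eq: "(\<Sum>i\<in>UNIV. \<Sum>j\<in>UNIV. cnj (x $ i) * A $ i $ j * x $ j)
      = (\<Sum>i\<in>UNIV. of_real ((cmod (x $ i))\<^sup>2) * A $ i $ i)" for x :: "complex^'a"
  proof (rule sum.cong)
    fix i
    have "(\<Sum>j\<in>UNIV. cnj (x $ i) * A $ i $ j * x $ j)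
        = (\<Sum>j\<in>UNIV. if j = i then cnj (x $ i) * A $ i $ i * x $ i else 0)"
      using assms by (intro sum.cong) (auto simp: diagonalD)
    thus "(\<Sum>j\<in>UNIV. cnj (x $ i) * A $ i $ j * x $ j) = of_real ((cmod (x $ i))\<^sup>2) * A $ i $ i"
      unfolding complex_norm_square by simp
  qed simp
  show ?thesis
  proof
    assume p: "pos_matrix A"
    show "\<forall>i. A $ i $ i \<in> \<real>\<^sub>\<ge>\<^sub>0"
    proof
      fix i
      have "(\<Sum>j\<in>UNIV. of_real ((cmod (axis i 1 $ j :: complex))\<^sup>2) * A $ j $ j)
          = (\<Sum>j\<in>UNIV. if j = i then A $ i $ i else 0)"
        by (intro sum.cong) (auto simp: axis_def)
      moreover have "(\<Sum>j\<in>UNIV. of_real ((cmod (axis i 1 $ j :: complex))\<^sup>2) * A $ j $ j) \<in> \<real>\<^sub>\<ge>\<^sub>0"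
        using p unfolding pos_matrix_def eq by blast
      ultimately show "A $ i $ i \<in> \<real>\<^sub>\<ge>\<^sub>0" by simp
    qed
  next
    assume "\<forall>i. A $ i $ i \<in> \<real>\<^sub>\<ge>\<^sub>0"
    thus "pos_matrix A"
      unfolding pos_matrix_def eq nonneg_Reals_iff by (auto intro!: sum_nonneg)
  qed
qed

lemma trace_diagonal_unit: "trace (\<epsilon> v) = 1"
  by (simp add: trace_def diag_unit_def)

lemma channel_diag_linear: "channel \<E> \<Longrightarrow> diag_linear \<E>"
  by (simp add: channel_def)

lemma channel_maps_diagonal: "channel \<E> \<Longrightarrow> A \<in> \<D> \<Longrightarrow> \<E> A \<in> \<D>"
  by (auto simp: channel_def diag_linear_def)

lemma channel_expand: "channel \<E> \<Longrightarrow> A \<in> \<D> \<Longrightarrow> \<E> A = map_of_entries (entry \<E>) A"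
  by (simp add: channel_diag_linear diag_linear_expand)

lemma channel_entry_nonneg:
  assumes "channel \<E>" shows "entry \<E> w v \<in> \<real>\<^sub>\<ge>\<^sub>0"
proof -
  have "pos_matrix (\<epsilon> v)" by (simp add: pos_matrix_diagonal) (simp add: diag_unit_def)
  hence "pos_matrix (\<E> (\<epsilon> v))" using assms by (simp add: channel_def)
  thus ?thesis using assms by (simp add: pos_matrix_diagonal channel_maps_diagonal entry_def)
qed

lemma channel_entry_sum:
  assumes "channel \<E>" shows "(\<Sum>w\<in>UNIV. entry \<E> w v) = 1"
proof -
  have "trace (\<E> (\<epsilon> v)) = 1" using assms by (simp add: channel_def trace_diagonal_unit)
  thus ?thesis by (simp add: trace_def entry_def)
qed

text \<open>With \<open>channel_entry_nonneg\<close> and \<open>channel_entry_sum\<close> this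
  identifies channels with stochastic matrices, the form in which channels are constructed
  below.\<close>

lemma channel_map_of_entries:
  assumes "\<And>w v. p w v \<in> \<real>\<^sub>\<ge>\<^sub>0" "\<And>v. (\<Sum>w\<in>UNIV. p w v) = 1"
  shows "channel (map_of_entries p)"
  unfolding channel_def
proof (intro conjI ballI impI)
  show "diag_linear (map_of_entries p)"
    by (auto simp: diag_linear_def vec_eq_iff map_of_entries_nth cscale_def ring_distribs
        sum.distrib sum_distrib_left mult.left_commute)
next
  fix A :: "'b sqmat" assume "A \<in> \<D>" "pos_matrix A"
  thus "pos_matrix (map_of_entries p A)"
    using assms(1) unfolding pos_matrix_diagonal[OF \<open>A \<in> \<D>\<close>] pos_matrix_diagonal[OF map_of_entries_diagonal]
    by (auto simp: map_of_entries_nth nonneg_Reals_iff intro!: sum_nonneg)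
next
  fix A :: "'b sqmat" assume "A \<in> \<D>"
  have "trace (map_of_entries p A) = (\<Sum>v\<in>UNIV. (\<Sum>w\<in>UNIV. p w v) * A $ v $ v)"
    by (simp add: trace_def map_of_entries_nth sum_distrib_right) (rule sum.swap)
  thus "trace (map_of_entries p A) = trace A" by (simp add: assms(2) trace_def)
qed

lemma channel_comp:
  assumes "channel \<Phi>" "channel \<Psi>" shows "channel (\<Phi> \<circ> \<Psi>)"
  using assms by (auto simp: channel_def diag_linear_def Pi_def)

lemma entry_comp:
  assumes "channel \<Phi>" "channel \<Psi>"
  shows "entry (\<Phi> \<circ> \<Psi>) u w = (\<Sum>v\<in>UNIV. entry \<Phi> u v * entry \<Psi> v w)"
  using channel_expand[OF assms(1) channel_maps_diagonal[OF assms(2) diag_unit_diagonal[of w]]]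
  by (simp add: entry_def map_of_entries_nth)

section \<open>Composition of no-signalling correlations\<close>

lemma entry_compose_corr:
  "entry (\<Gamma>\<^sub>2 \<star> \<Gamma>\<^sub>1) (v1, w3) (v3, w1) =
    (\<Sum>v2\<in>UNIV. \<Sum>w2\<in>UNIV. entry \<Gamma>\<^sub>1 (v1, w2) (v2, w1) * entry \<Gamma>\<^sub>2 (v2, w3) (v3, w2))"
  by (simp add: compose_corr_def)

lemma sum_prod_UNIV: "(\<Sum>p\<in>UNIV. f p) = (\<Sum>a\<in>UNIV. \<Sum>b\<in>UNIV. f (a, b))"
  by (simp add: sum.cartesian_product flip: UNIV_Times_UNIV)

lemma sum_UNIV_product:
  fixes a :: "'a::comm_semiring_0"
  shows "(\<Sum>x\<in>UNIV. \<Sum>y\<in>UNIV. a * (f x * g y)) = a * ((\<Sum>x\<in>UNIV. f x) * (\<Sum>y\<in>UNIV. g y))"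
  by (simp flip: sum_distrib_left sum_distrib_right)

lemma sum_Times: "(\<Sum>p\<in>A \<times> B. f p) = (\<Sum>a\<in>A. \<Sum>b\<in>B. f (a, b))"
  by (simp add: sum.cartesian_product)

text \<open>The order of summation unties the loop. Summing over w3 turns
  \<open>\<Gamma>\<^sub>2\<close> into a marginal independent of w2; only then does the sum over w2
  turn \<open>\<Gamma>\<^sub>1\<close> into a marginal independent of w1. On the other side v1 is
  summed first, then v2.\<close>

lemma ns_correlation_compose:
  fixes \<Gamma>\<^sub>1 :: "('v2::finite, 'w1::finite, 'v1::finite, 'w2::finite) corr"
    and \<Gamma>\<^sub>2 :: "('v3::finite, 'w2, 'v2, 'w3::finite) corr"
  assumes 1: "ns_correlation \<Gamma>\<^sub>1" and 2: "ns_correlation \<Gamma>\<^sub>2"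
  shows "ns_correlation (\<Gamma>\<^sub>2 \<star> \<Gamma>\<^sub>1)"
proof -
  have ch: "channel \<Gamma>\<^sub>1" "channel \<Gamma>\<^sub>2" using assms by (auto simp: ns_correlation_def)
  \<comment> \<open>\<open>undefined\<close> stands for an arbitrary fixed input on the other side;
    by no-signalling the marginal is the same for every input there.\<close>
  define f where "f v1 v2 = (\<Sum>w2\<in>UNIV. entry \<Gamma>\<^sub>1 (v1, w2) (v2, undefined))" for v1 v2
  define f' where "f' w2 w1 = (\<Sum>v1\<in>UNIV. entry \<Gamma>\<^sub>1 (v1, w2) (undefined, w1))" for w2 w1
  define g where "g v2 v3 = (\<Sum>w3\<in>UNIV. entry \<Gamma>\<^sub>2 (v2, w3) (v3, undefined))" for v2 v3
  define g' where "g' w3 w2 = (\<Sum>v2\<in>UNIV. entry \<Gamma>\<^sub>2 (v2, w3) (undefined, w2))" for w3 w2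
  have f: "(\<Sum>w2\<in>UNIV. entry \<Gamma>\<^sub>1 (v1, w2) (v2, w1)) = f v1 v2" for v1 v2 w1
    using 1 unfolding f_def ns_correlation_def by blast
  have f': "(\<Sum>v1\<in>UNIV. entry \<Gamma>\<^sub>1 (v1, w2) (v2, w1)) = f' w2 w1" for w2 v2 w1
    using 1 unfolding f'_def ns_correlation_def by blast
  have g: "(\<Sum>w3\<in>UNIV. entry \<Gamma>\<^sub>2 (v2, w3) (v3, w2)) = g v2 v3" for v2 w2 v3
    using 2 unfolding g_def ns_correlation_def by blast
  have g': "(\<Sum>v2\<in>UNIV. entry \<Gamma>\<^sub>2 (v2, w3) (v3, w2)) = g' w3 w2" for w3 w2 v3
    using 2 unfolding g'_def ns_correlation_def by blast
  have marg: "(\<Sum>w3\<in>UNIV. entry (\<Gamma>\<^sub>2 \<star> \<Gamma>\<^sub>1) (v1, w3) (v3, w1)) = (\<Sum>v2\<in>UNIV. f v1 v2 * g v2 v3)" for v1 v3 w1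
  proof -
    have "(\<Sum>w3\<in>UNIV. entry (\<Gamma>\<^sub>2 \<star> \<Gamma>\<^sub>1) (v1, w3) (v3, w1))
        = (\<Sum>v2\<in>UNIV. \<Sum>w3\<in>UNIV. \<Sum>w2\<in>UNIV. entry \<Gamma>\<^sub>1 (v1, w2) (v2, w1) * entry \<Gamma>\<^sub>2 (v2, w3) (v3, w2))"
      unfolding entry_compose_corr by (rule sum.swap)
    also have "\<dots> = (\<Sum>v2\<in>UNIV. \<Sum>w2\<in>UNIV. \<Sum>w3\<in>UNIV. entry \<Gamma>\<^sub>1 (v1, w2) (v2, w1) * entry \<Gamma>\<^sub>2 (v2, w3) (v3, w2))"
      by (intro sum.cong refl) (rule sum.swap)
    finally show ?thesis by (simp add: f g flip: sum_distrib_left sum_distrib_right)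
  qed
  have marg': "(\<Sum>v1\<in>UNIV. entry (\<Gamma>\<^sub>2 \<star> \<Gamma>\<^sub>1) (v1, w3) (v3, w1)) = (\<Sum>w2\<in>UNIV. f' w2 w1 * g' w3 w2)" for w3 v3 w1
  proof -
    have "(\<Sum>v1\<in>UNIV. entry (\<Gamma>\<^sub>2 \<star> \<Gamma>\<^sub>1) (v1, w3) (v3, w1))
        = (\<Sum>v2\<in>UNIV. \<Sum>v1\<in>UNIV. \<Sum>w2\<in>UNIV. entry \<Gamma>\<^sub>1 (v1, w2) (v2, w1) * entry \<Gamma>\<^sub>2 (v2, w3) (v3, w2))"
      unfolding entry_compose_corr by (rule sum.swap)
    also have "\<dots> = (\<Sum>v2\<in>UNIV. \<Sum>w2\<in>UNIV. \<Sum>v1\<in>UNIV. entry \<Gamma>\<^sub>1 (v1, w2) (v2, w1) * entry \<Gamma>\<^sub>2 (v2, w3) (v3, w2))"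
      by (intro sum.cong refl) (rule sum.swap)
    also have "\<dots> = (\<Sum>v2\<in>UNIV. \<Sum>w2\<in>UNIV. f' w2 w1 * entry \<Gamma>\<^sub>2 (v2, w3) (v3, w2))"
      by (simp add: f' flip: sum_distrib_right)
    also have "\<dots> = (\<Sum>w2\<in>UNIV. \<Sum>v2\<in>UNIV. f' w2 w1 * entry \<Gamma>\<^sub>2 (v2, w3) (v3, w2))"
      by (rule sum.swap)
    finally show ?thesis by (simp add: g' flip: sum_distrib_left)
  qed
  have f1: "(\<Sum>v1\<in>UNIV. f v1 v2) = 1" for v2
    using channel_entry_sum[OF ch(1), of "(v2, undefined)"] by (simp add: sum_prod_UNIV f_def)
  have g1: "(\<Sum>v2\<in>UNIV. g v2 v3) = 1" for v3
    using channel_entry_sum[OF ch(2), of "(v3, undefined)"] by (simp add: sum_prod_UNIV g_def)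
  \<comment> \<open>\<open>f\<close> and \<open>g\<close> are the V-side marginals, both stochastic
    by \<open>f1\<close> and \<open>g1\<close>, so the total mass is that of a product of two
    stochastic matrices.\<close>
  have "(\<Sum>p\<in>UNIV. entry (\<Gamma>\<^sub>2 \<star> \<Gamma>\<^sub>1) p (v3, w1)) = 1" for v3 w1
  proof -
    have "(\<Sum>p\<in>UNIV. entry (\<Gamma>\<^sub>2 \<star> \<Gamma>\<^sub>1) p (v3, w1)) = (\<Sum>v1\<in>UNIV. \<Sum>v2\<in>UNIV. f v1 v2 * g v2 v3)"
      by (simp add: sum_prod_UNIV marg)
    also have "\<dots> = (\<Sum>v2\<in>UNIV. \<Sum>v1\<in>UNIV. f v1 v2 * g v2 v3)" by (rule sum.swap)
    finally show ?thesis by (simp add: f1 g1 flip: sum_distrib_right)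
  qed
  moreover have "entry (\<Gamma>\<^sub>2 \<star> \<Gamma>\<^sub>1) p q \<in> \<real>\<^sub>\<ge>\<^sub>0" for p q
    using channel_entry_nonneg[OF ch(1)] channel_entry_nonneg[OF ch(2)]
    by (cases p; cases q) (auto simp: entry_compose_corr nonneg_Reals_iff intro!: sum_nonneg)
  ultimately have "channel (map_of_entries (entry (\<Gamma>\<^sub>2 \<star> \<Gamma>\<^sub>1)))"
    by (intro channel_map_of_entries) auto
  hence "channel (\<Gamma>\<^sub>2 \<star> \<Gamma>\<^sub>1)"
    unfolding compose_corr_def entry_map_of_entries .
  thus ?thesis unfolding ns_correlation_def by (simp add: marg marg')
qed

text \<open>Both sides are the same fourfold sum. Bundling (v1, w1) into p and (v2, w2) into q
  leaves one exchange of sums.\<close>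

lemma simulate_compose:
  fixes \<Gamma>\<^sub>1 :: "('v2::finite, 'w1::finite, 'v1::finite, 'w2::finite) corr"
    and \<Gamma>\<^sub>2 :: "('v3::finite, 'w2, 'v2, 'w3::finite) corr"
  shows "simulate (\<Gamma>\<^sub>2 \<star> \<Gamma>\<^sub>1) \<E> = simulate \<Gamma>\<^sub>2 (simulate \<Gamma>\<^sub>1 \<E>)"
proof -
  have "(\<Sum>v1\<in>UNIV. \<Sum>w1\<in>UNIV. entry (\<Gamma>\<^sub>2 \<star> \<Gamma>\<^sub>1) (v1, w3) (v3, w1) * entry \<E> w1 v1)
     = (\<Sum>v2\<in>UNIV. \<Sum>w2\<in>UNIV. entry \<Gamma>\<^sub>2 (v2, w3) (v3, w2) * entry (simulate \<Gamma>\<^sub>1 \<E>) w2 v2)" for w3 v3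
  proof -
    have "(\<Sum>v1\<in>UNIV. \<Sum>w1\<in>UNIV. entry (\<Gamma>\<^sub>2 \<star> \<Gamma>\<^sub>1) (v1, w3) (v3, w1) * entry \<E> w1 v1)
      = (\<Sum>p\<in>UNIV. \<Sum>q\<in>UNIV. entry \<Gamma>\<^sub>1 (fst p, snd q) (fst q, snd p) *
           entry \<Gamma>\<^sub>2 (fst q, w3) (v3, snd q) * entry \<E> (snd p) (fst p))"
      by (simp add: sum_prod_UNIV entry_compose_corr sum_distrib_right)
    also have "\<dots> = (\<Sum>q\<in>UNIV. \<Sum>p\<in>UNIV. entry \<Gamma>\<^sub>1 (fst p, snd q) (fst q, snd p) *
           entry \<Gamma>\<^sub>2 (fst q, w3) (v3, snd q) * entry \<E> (snd p) (fst p))"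
      by (rule sum.swap)
    finally show ?thesis
      by (simp add: sum_prod_UNIV simulate_def sum_distrib_left mult_ac)
  qed
  thus ?thesis by (simp add: simulate_def[of "\<Gamma>\<^sub>2 \<star> \<Gamma>\<^sub>1"] simulate_def[of "\<Gamma>\<^sub>2"])
qed

section \<open>Local correlations\<close>

lemma entry_tensor_map:
  "entry (tensor_map \<Phi> \<Psi>) (a, b) (v, w) = entry \<Phi> a v * entry \<Psi> b w"
proof -
  have "entry (tensor_map \<Phi> \<Psi>) (a, b) (v, w) = (\<Sum>v'\<in>UNIV. \<Sum>w'\<in>UNIV.
      if w' = w then if v' = v then entry \<Phi> a v * entry \<Psi> b w else 0 else 0)"
    unfolding entry_def tensor_map_def cscale_def kronecker_def sum_component vec_lambda_beta
    by (intro sum.cong refl) (auto simp: diag_unit_def)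
  thus ?thesis by simp
qed

lemma diag_linear_tensor_map:
  assumes "channel \<Phi>" "channel \<Psi>"
  shows "diag_linear (tensor_map \<Phi> \<Psi>)"
proof -
  have "\<Phi> (\<epsilon> v) $ a $ a' * \<Psi> (\<epsilon> w) $ b $ b' = 0" if "(a, b) \<noteq> (a', b')" for v w a b a' b'
    using that channel_maps_diagonal[OF assms(1) diag_unit_diagonal[of v]]
      channel_maps_diagonal[OF assms(2) diag_unit_diagonal[of w]]
    by (auto simp: diagonal_def)
  hence "tensor_map \<Phi> \<Psi> A \<in> \<D>" for A
    by (auto simp: diagonal_def tensor_map_def cscale_def kronecker_def intro!: sum.neutral)
  thus ?thesis
    by (auto simp: diag_linear_def tensor_map_def cscale_def vec_eq_iff ring_distribs
        sum.distrib sum_distrib_left mult_ac)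
qed

lemma loc_correlation_entry:
  assumes "loc_correlation \<Gamma>"
  obtains n :: nat and c :: "nat \<Rightarrow> real" and \<Phi> \<Psi>
  where "\<And>k. k < n \<Longrightarrow> 0 \<le> c k" "\<And>k. k < n \<Longrightarrow> channel (\<Phi> k)" "\<And>k. k < n \<Longrightarrow> channel (\<Psi> k)"
    "(\<Sum>k<n. c k) = 1"
    "\<And>v1 w2 v2 w1. entry \<Gamma> (v1, w2) (v2, w1) = (\<Sum>k<n. of_real (c k) * (entry (\<Phi> k) v1 v2 * entry (\<Psi> k) w2 w1))"
proof -
  obtain n :: nat and c \<Phi> \<Psi> where *: "\<forall>k<n. 0 \<le> c k \<and> channel (\<Phi> k) \<and> channel (\<Psi> k)" "(\<Sum>k<n. c k) = 1"
      "\<forall>A\<in>\<D>. \<Gamma> A = (\<Sum>k<n. c k *\<^sub>R tensor_map (\<Phi> k) (\<Psi> k) A)"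
    using assms unfolding loc_correlation_def by (elim conjE exE) (rule that; assumption)
  have "entry \<Gamma> p q = (\<Sum>k<n. of_real (c k) * entry (tensor_map (\<Phi> k) (\<Psi> k)) p q)" for p q
    using *(3) by (simp add: entry_def) (simp add: scaleR_conv_of_real)
  thus ?thesis using that[of n c \<Phi> \<Psi>] * by (simp add: entry_tensor_map)
qed

text \<open>A converse of \<open>loc_correlation_entry\<close> over an arbitrary finite index set,
  so that two convex combinations can be multiplied over the product of their index sets; the
  bijection \<open>h\<close> renumbers the result by natural numbers.\<close>

lemma loc_correlationI:
  fixes c :: "'i \<Rightarrow> real"
  assumes ns: "ns_correlation \<Gamma>" and fin: "finite I"
    and I: "\<And>i. i \<in> I \<Longrightarrow> 0 \<le> c i" "\<And>i. i \<in> I \<Longrightarrow> channel (\<Phi> i)" "\<And>i. i \<in> I \<Longrightarrow> channel (\<Psi> i)"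
    and c1: "(\<Sum>i\<in>I. c i) = 1"
    and e: "\<And>v1 w2 v2 w1. entry \<Gamma> (v1, w2) (v2, w1) = (\<Sum>i\<in>I. of_real (c i) * (entry (\<Phi> i) v1 v2 * entry (\<Psi> i) w2 w1))"
  shows "loc_correlation \<Gamma>"
proof -
  obtain h where h: "bij_betw h {..<card I} I"
    using ex_bij_betw_nat_finite[OF fin] by (auto simp: lessThan_atLeast0)
  have hI: "h k \<in> I" if "k < card I" for k using h that by (auto simp: bij_betw_def)
  have "\<Gamma> A = (\<Sum>k<card I. c (h k) *\<^sub>R tensor_map (\<Phi> (h k)) (\<Psi> (h k)) A)" if A: "A \<in> \<D>" for A
  proof -
    have "\<Gamma> A = map_of_entries (entry \<Gamma>) A"
      using ns A by (intro channel_expand) (auto simp: ns_correlation_def)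
    also have "\<dots> = (\<Sum>i\<in>I. c i *\<^sub>R map_of_entries (entry (tensor_map (\<Phi> i) (\<Psi> i))) A)"
    proof -
      have "map_of_entries (entry \<Gamma>) A $ p $ q
        = (\<Sum>i\<in>I. c i *\<^sub>R map_of_entries (entry (tensor_map (\<Phi> i) (\<Psi> i))) A) $ p $ q" for p q
      proof (cases "p = q")
        case True
        have "(\<Sum>v\<in>UNIV. entry \<Gamma> p v * A $ v $ v)
            = (\<Sum>v\<in>UNIV. \<Sum>i\<in>I. of_real (c i) * (entry (tensor_map (\<Phi> i) (\<Psi> i)) p v * A $ v $ v))"
          by (cases p) (auto simp: e entry_tensor_map sum_distrib_left mult_ac intro!: sum.cong)
        also have "\<dots> = (\<Sum>i\<in>I. of_real (c i) * (\<Sum>v\<in>UNIV. entry (tensor_map (\<Phi> i) (\<Psi> i)) p v * A $ v $ v))"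
          unfolding sum_distrib_left by (rule sum.swap)
        finally show ?thesis using True
          by (simp add: map_of_entries_nth) (simp add: scaleR_conv_of_real)
      qed (simp add: map_of_entries_nth)
      thus ?thesis by (simp add: vec_eq_iff)
    qed
    also have "\<dots> = (\<Sum>i\<in>I. c i *\<^sub>R tensor_map (\<Phi> i) (\<Psi> i) A)"
      using I A by (intro sum.cong refl) (simp add: diag_linear_expand[OF diag_linear_tensor_map])
    also have "\<dots> = (\<Sum>k<card I. c (h k) *\<^sub>R tensor_map (\<Phi> (h k)) (\<Psi> (h k)) A)"
      by (rule sum.reindex_bij_betw[OF h, symmetric])
    finally show ?thesis .
  qed
  moreover have "(\<Sum>k<card I. c (h k)) = 1" using sum.reindex_bij_betw[OF h, of c] c1 by simp
  moreover have "\<forall>k<card I. 0 \<le> c (h k) \<and> channel (\<Phi> (h k)) \<and> channel (\<Psi> (h k))"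
    using I hI by blast
  ultimately show ?thesis using ns unfolding loc_correlation_def
    by (intro conjI exI[of _ "card I"] exI[of _ "\<lambda>k. c (h k)"] exI[of _ "\<lambda>k. \<Phi> (h k)"]
        exI[of _ "\<lambda>k. \<Psi> (h k)"] ballI) simp_all
qed

text \<open>The two sides compose in opposite orders, since labels run from v3 through v2 to v1 but
  from w1 through w2 to w3. The sums over v2 and w2 are absorbed as the matrix products of
  \<open>entry_comp\<close>.\<close>

lemma loc_correlation_compose:
  fixes \<Gamma>\<^sub>1 :: "('v2::finite, 'w1::finite, 'v1::finite, 'w2::finite) corr"
    and \<Gamma>\<^sub>2 :: "('v3::finite, 'w2, 'v2, 'w3::finite) corr"
  assumes 1: "loc_correlation \<Gamma>\<^sub>1" and 2: "loc_correlation \<Gamma>\<^sub>2"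
  shows "loc_correlation (\<Gamma>\<^sub>2 \<star> \<Gamma>\<^sub>1)"
proof -
  obtain m :: nat and c \<Phi> \<Psi> where m: "\<And>k. k < m \<Longrightarrow> 0 \<le> c k"
    "\<And>k. k < m \<Longrightarrow> channel (\<Phi> k)" "\<And>k. k < m \<Longrightarrow> channel (\<Psi> k)" "(\<Sum>k<m. c k) = 1"
    and e1: "\<And>v1 w2 v2 w1. entry \<Gamma>\<^sub>1 (v1, w2) (v2, w1) = (\<Sum>k<m. of_real (c k) * (entry (\<Phi> k) v1 v2 * entry (\<Psi> k) w2 w1))"
    by (rule loc_correlation_entry[OF 1]) blast
  obtain n :: nat and d \<Phi>' \<Psi>' where n: "\<And>k. k < n \<Longrightarrow> 0 \<le> d k"
    "\<And>k. k < n \<Longrightarrow> channel (\<Phi>' k)" "\<And>k. k < n \<Longrightarrow> channel (\<Psi>' k)" "(\<Sum>k<n. d k) = 1"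
    and e2: "\<And>v1 w2 v2 w1. entry \<Gamma>\<^sub>2 (v1, w2) (v2, w1) = (\<Sum>k<n. of_real (d k) * (entry (\<Phi>' k) v1 v2 * entry (\<Psi>' k) w2 w1))"
    by (rule loc_correlation_entry[OF 2]) blast
  show ?thesis
  proof (rule loc_correlationI[where I = "{..<m} \<times> {..<n}" and c = "\<lambda>(k, l). c k * d l"
      and \<Phi> = "\<lambda>(k, l). \<Phi> k \<circ> \<Phi>' l" and \<Psi> = "\<lambda>(k, l). \<Psi>' l \<circ> \<Psi> k"])
    show "ns_correlation (\<Gamma>\<^sub>2 \<star> \<Gamma>\<^sub>1)"
      using 1 2 by (intro ns_correlation_compose) (auto simp: loc_correlation_def)
    show "(\<Sum>i\<in>{..<m} \<times> {..<n}. case i of (k, l) \<Rightarrow> c k * d l) = 1"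
      using m(4) n(4) by (simp flip: sum.cartesian_product sum_distrib_left)
  next
    fix v1 w3 v3 w1
    have "entry (\<Gamma>\<^sub>2 \<star> \<Gamma>\<^sub>1) (v1, w3) (v3, w1) = (\<Sum>p\<in>UNIV. \<Sum>i\<in>{..<m} \<times> {..<n}. of_real (c (fst i) * d (snd i)) *
        ((entry (\<Phi> (fst i)) v1 (fst p) * entry (\<Phi>' (snd i)) (fst p) v3) *
         (entry (\<Psi>' (snd i)) w3 (snd p) * entry (\<Psi> (fst i)) (snd p) w1)))"
      by (simp add: entry_compose_corr sum_prod_UNIV e1 e2 sum_product sum_Times mult_ac)
    also have "\<dots> = (\<Sum>i\<in>{..<m} \<times> {..<n}. \<Sum>p\<in>UNIV. of_real (c (fst i) * d (snd i)) *
        ((entry (\<Phi> (fst i)) v1 (fst p) * entry (\<Phi>' (snd i)) (fst p) v3) *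
         (entry (\<Psi>' (snd i)) w3 (snd p) * entry (\<Psi> (fst i)) (snd p) w1)))"
      by (rule sum.swap)
    also have "\<dots> = (\<Sum>i\<in>{..<m} \<times> {..<n}. of_real (c (fst i) * d (snd i)) *
        (entry (\<Phi> (fst i) \<circ> \<Phi>' (snd i)) v1 v3 * entry (\<Psi>' (snd i) \<circ> \<Psi> (fst i)) w3 w1))"
      using m(2,3) n(2,3) by (intro sum.cong refl) (auto simp: sum_prod_UNIV sum_UNIV_product entry_comp)
    finally show "entry (\<Gamma>\<^sub>2 \<star> \<Gamma>\<^sub>1) (v1, w3) (v3, w1) = (\<Sum>i\<in>{..<m} \<times> {..<n}.
        of_real (case i of (k, l) \<Rightarrow> c k * d l) * (entry (case i of (k, l) \<Rightarrow> \<Phi> k \<circ> \<Phi>' l) v1 v3 *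
        entry (case i of (k, l) \<Rightarrow> \<Psi>' l \<circ> \<Psi> k) w3 w1))"
      by (simp add: case_prod_beta)
  qed (use m n in \<open>auto intro: channel_comp\<close>)
qed

section \<open>Positive semidefinite kernels\<close>

text \<open>Membership in the nonnegative reals makes the form real as well, and for finite index
  sets Hermitian symmetry follows from that (\<open>psd_on_hermitian\<close>).\<close>

definition psd_on :: "'i set \<Rightarrow> ('i \<Rightarrow> 'i \<Rightarrow> complex) \<Rightarrow> bool" where
  "psd_on I N \<longleftrightarrow> (\<forall>c. (\<Sum>i\<in>I. \<Sum>j\<in>I. c i * cnj (c j) * N i j) \<in> \<real>\<^sub>\<ge>\<^sub>0)"

lemma psd_onD: "psd_on I N \<Longrightarrow> (\<Sum>i\<in>I. \<Sum>j\<in>I. c i * cnj (c j) * N i j) \<in> \<real>\<^sub>\<ge>\<^sub>0"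
  by (simp add: psd_on_def)

lemma psd_on_subset:
  assumes N: "psd_on I N" and I: "finite I" "J \<subseteq> I"
  shows "psd_on J N"
  unfolding psd_on_def
proof
  fix c :: "'a \<Rightarrow> complex"
  define d where "d i = (if i \<in> J then c i else 0)" for i
  have "(\<Sum>i\<in>J. \<Sum>j\<in>J. c i * cnj (c j) * N i j) = (\<Sum>i\<in>J. \<Sum>j\<in>J. d i * cnj (d j) * N i j)"
    by (simp add: d_def)
  also have "\<dots> = (\<Sum>i\<in>J. \<Sum>j\<in>I. d i * cnj (d j) * N i j)"
    using I by (intro sum.cong refl sum.mono_neutral_left) (auto simp: d_def)
  also have "\<dots> = (\<Sum>i\<in>I. \<Sum>j\<in>I. d i * cnj (d j) * N i j)"
    using I by (intro sum.mono_neutral_left) (auto simp: d_def)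
  finally show "(\<Sum>i\<in>J. \<Sum>j\<in>J. c i * cnj (c j) * N i j) \<in> \<real>\<^sub>\<ge>\<^sub>0"
    using psd_onD[OF N] by simp
qed

lemma psd_on_pair:
  assumes "psd_on I N" "finite I" "i \<in> I" "j \<in> I" "i \<noteq> j"
  shows "s * cnj s * N i i + s * cnj t * N i j + t * cnj s * N j i + t * cnj t * N j j \<in> \<real>\<^sub>\<ge>\<^sub>0"
  using psd_onD[OF psd_on_subset[OF assms(1,2), of "{i, j}"], of "\<lambda>k. if k = i then s else t"] assms(3-)
  by (simp add: add_ac)

lemma psd_on_diag:
  assumes "psd_on I N" "finite I" "i \<in> I" shows "N i i \<in> \<real>\<^sub>\<ge>\<^sub>0"
  using psd_onD[OF psd_on_subset[OF assms(1,2), of "{i}"], of "\<lambda>k. 1"] assms(3) by simp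

lemma psd_on_hermitian:
  assumes "psd_on I N" "finite I" "i \<in> I" "j \<in> I"
  shows "N j i = cnj (N i j)"
proof (cases "i = j")
  case True thus ?thesis using psd_on_diag[OF assms(1-3)] by (simp add: nonneg_Reals_iff complex_eq_iff)
next
  case False
  have d: "Im (N i i) = 0" "Im (N j j) = 0" 
    using psd_on_diag[OF assms(1,2)] assms(3,4) by (auto simp: nonneg_Reals_iff)
  \<comment> \<open>Polarisation: the coefficients (1, 1) equate the imaginary parts of N_ij and of
    the conjugate of N_ji, the coefficients (\<i>, 1) the real parts.\<close>
  show ?thesis
    using psd_on_pair[OF assms False, of 1 1] psd_on_pair[OF assms False, of \<i> 1] d
    by (simp add: nonneg_Reals_iff complex_eq_iff)
qed

text \<open>If N_aa = 0, the form at the coefficients 1 for i and -s N_ia for a is N_ii - 2 s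
  |N_ia|^2. It is affine in s, so it becomes negative unless N_ia vanishes.\<close>

lemma psd_on_zero_column:
  assumes "psd_on I N" "finite I" "i \<in> I" "a \<in> I" "N a a = 0"
  shows "N i a = 0"
proof (cases "i = a")
  case False
  show ?thesis
  proof (rule ccontr)
    assume n: "N i a \<noteq> 0"
    define b where "b = (cmod (N i a))\<^sup>2"
    have b: "b > 0" "N i a * cnj (N i a) = of_real b" unfolding b_def complex_norm_square[symmetric] using n by simp_all
    \<comment> \<open>Chosen so that the form takes the value -1.\<close>
    define s where "s = (Re (N i i) + 1) / (2 * b)"
    have "N i i - 2 * of_real s * (N i a * cnj (N i a)) \<in> \<real>\<^sub>\<ge>\<^sub>0"
      using psd_on_pair[OF assms(1-4) False, of 1 "- (of_real s * N i a)"] assms(5)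
        psd_on_hermitian[OF assms(1-4)] by (simp add: algebra_simps)
    hence "0 \<le> Re (N i i) - 2 * s * b" unfolding b by (simp add: nonneg_Reals_iff)
    moreover have "2 * s * b = Re (N i i) + 1" using b by (simp add: s_def)
    ultimately show False by simp
  qed
qed (use assms in simp)

text \<open>One step of the Cholesky decomposition splits off the column of the new index.\<close>

lemma psd_on_Gram:
  assumes "finite I" "psd_on I N"
  shows "\<exists>u. \<forall>i\<in>I. \<forall>j\<in>I. N i j = (\<Sum>k\<in>I. u k i * cnj (u k j))"
  using assms
proof (induction I arbitrary: N rule: finite_induct)
  case (insert a I)
  have fin: "finite (insert a I)" using insert by simp
  note psd = insert.prems
  have herm: "N a i = cnj (N i a)" if "i \<in> insert a I" for i
    using psd_on_hermitian[OF psd fin that] by simp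
  define r where "r = Re (N a a)"
  have r: "r \<ge> 0" "N a a = of_real r"
    using psd_on_diag[OF psd fin, of a] by (auto simp: r_def nonneg_Reals_iff complex_eq_iff)
  have zero: "N i a = 0" if "i \<in> I" "r = 0" for i
    using psd_on_zero_column[OF psd fin, of i a] r that by simp
  \<comment> \<open>The column to be split off. For r = 0 the division yields v = 0, which agrees
    with \<open>zero\<close>: the whole column of \<open>N\<close> vanishes then.\<close>
  define v where "v i = N i a / of_real (sqrt r)" for i
  have vv: "v i * cnj (v j) = N i a * cnj (N j a) / of_real r" for i j
  proof -
    have "complex_of_real (sqrt r) * of_real (sqrt r) = of_real r"
      using r by (simp flip: of_real_mult)
    thus ?thesis by (simp add: v_def)
  qed
  define N' where "N' i j = N i j - v i * cnj (v j)" for i j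
  have "psd_on I N'"
    unfolding psd_on_def
  proof
    fix c :: "'a \<Rightarrow> complex"
    define s where "s = (\<Sum>i\<in>I. c i * N i a)"
    \<comment> \<open>For r > 0 the coefficient -s/r minimises the form of \<open>N\<close> over the
      coefficient at a, and the minimum is the form of the Schur complement \<open>N'\<close>. For r
      = 0 the coefficient is 0.\<close>
    define c' where "c' = c(a := - s / of_real r)"
    have c': "c' i = c i" if "i \<in> I" for i using that insert.hyps by (auto simp: c'_def)
    have s': "(\<Sum>j\<in>I. cnj (c j) * N a j) = cnj s"
      unfolding s_def cnj_sum complex_cnj_mult using herm by (intro sum.cong) auto
    have s'': "(\<Sum>j\<in>I. cnj (c j) * cnj (N j a)) = cnj s" by (simp add: s_def)
    have "(\<Sum>i\<in>I. \<Sum>j\<in>I. c i * cnj (c j) * N' i j)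
      = (\<Sum>i\<in>I. \<Sum>j\<in>I. c i * cnj (c j) * N i j) - (\<Sum>i\<in>I. \<Sum>j\<in>I. (c i * N i a) * (cnj (c j) * cnj (N j a)) / of_real r)"
      by (simp add: N'_def vv algebra_simps sum_subtractf)
    also have "(\<Sum>i\<in>I. \<Sum>j\<in>I. (c i * N i a) * (cnj (c j) * cnj (N j a)) / of_real r) = s * cnj s / of_real r"
      unfolding s''[symmetric] by (simp add: s_def sum_product sum_divide_distrib)
    finally have 1: "(\<Sum>i\<in>I. \<Sum>j\<in>I. c i * cnj (c j) * N' i j)
      = (\<Sum>i\<in>I. \<Sum>j\<in>I. c i * cnj (c j) * N i j) - s * cnj s / of_real r" .
    have "(\<Sum>i\<in>insert a I. \<Sum>j\<in>insert a I. c' i * cnj (c' j) * N i j)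
      = c' a * cnj (c' a) * N a a + c' a * (\<Sum>j\<in>I. cnj (c j) * N a j)
        + ((\<Sum>i\<in>I. c i * N i a) * cnj (c' a) + (\<Sum>i\<in>I. \<Sum>j\<in>I. c i * cnj (c j) * N i j))"
      using insert.hyps
      by (simp add: c' sum.distrib sum_distrib_left sum_distrib_right mult_ac)
    also have "\<dots> = c' a * cnj (c' a) * of_real r + c' a * cnj s + s * cnj (c' a)
        + (\<Sum>i\<in>I. \<Sum>j\<in>I. c i * cnj (c j) * N i j)"
      unfolding s' r(2) by (simp add: s_def)
    also have "\<dots> = (\<Sum>i\<in>I. \<Sum>j\<in>I. c i * cnj (c j) * N i j) - s * cnj s / of_real r"
      by (cases "r = 0") (simp_all add: c'_def field_simps)
    finally show "(\<Sum>i\<in>I. \<Sum>j\<in>I. c i * cnj (c j) * N' i j) \<in> \<real>\<^sub>\<ge>\<^sub>0"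
      unfolding 1 using psd_onD[OF psd, of c'] by simp
  qed
  then obtain u where u: "\<And>i j. i \<in> I \<Longrightarrow> j \<in> I \<Longrightarrow> N' i j = (\<Sum>k\<in>I. u k i * cnj (u k j))"
    using insert.IH by blast
  \<comment> \<open>The Gram vectors of \<open>N'\<close> are extended by 0 at the new index a, and
    the column \<open>v\<close> is added as the vector numbered a.\<close>
  define w where "w k i = (if k = a then v i else if i = a then 0 else u k i)" for k i
  have w: "(\<Sum>k\<in>insert a I. w k i * cnj (w k j)) = v i * cnj (v j) + (if i = a \<or> j = a then 0 else \<Sum>k\<in>I. u k i * cnj (u k j))" for i j
  proof -
    have "(\<Sum>k\<in>I. w k i * cnj (w k j)) = (\<Sum>k\<in>I. if i = a \<or> j = a then 0 else u k i * cnj (u k j))"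
      using insert.hyps by (intro sum.cong) (auto simp: w_def)
    thus ?thesis using insert.hyps by (simp add: w_def)
  qed
  have "N i j = (\<Sum>k\<in>insert a I. w k i * cnj (w k j))" if "i \<in> insert a I" "j \<in> insert a I" for i j
  proof (cases "i = a \<or> j = a")
    case True
    show ?thesis
    proof (cases "r = 0")
      case True
      have "N i a = 0" "N j a = 0" using that r zero True by auto
      thus ?thesis using \<open>i = a \<or> j = a\<close> herm[OF that(2)] unfolding w by (auto simp: v_def)
    next
      case False
      thus ?thesis using \<open>i = a \<or> j = a\<close> herm[OF that(2)] r unfolding w by (auto simp: vv)
    qed
  next
    case False
    thus ?thesis using that u[of i j] insert.hyps unfolding w by (auto simp: N'_def diff_eq_eq add.commute)
  qed
  thus ?case by blast
qed simp

text \<open>The sesquilinear form of a kernel on formal combinations of points. Lists of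
  coefficients and points admit repetitions and make addition of combinations plain
  concatenation.\<close>

definition ker_form :: "('x \<Rightarrow> 'x \<Rightarrow> complex) \<Rightarrow> (complex \<times> 'x) list \<Rightarrow> (complex \<times> 'x) list \<Rightarrow> complex" where
  "ker_form k u v = (\<Sum>x\<leftarrow>u. \<Sum>y\<leftarrow>v. fst x * cnj (fst y) * k (snd x) (snd y))"

definition psd :: "('x \<Rightarrow> 'x \<Rightarrow> complex) \<Rightarrow> bool" where
  "psd k \<longleftrightarrow> (\<forall>v. ker_form k v v \<in> \<real>\<^sub>\<ge>\<^sub>0)"

lemma ker_form_family:
  "ker_form k (map (\<lambda>i. (c i, x i)) [0..<n]) (map (\<lambda>i. (c i, x i)) [0..<n])
    = (\<Sum>i<n. \<Sum>j<n. c i * cnj (c j) * k (x i) (x j))"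
  by (simp add: ker_form_def comp_def interv_sum_list_conv_sum_set_nat lessThan_atLeast0)

lemma list_family: "v = map (\<lambda>i. (fst (v ! i), snd (v ! i))) [0..<length v]"
  by (simp add: map_nth)

text \<open>On finitely many points \<open>l\<close> is a sum of rank-one kernels by
  \<open>psd_on_Gram\<close>. Multiplying \<open>k\<close> by the m-th of them only replaces the
  coefficients c_i by c_i u_m(i), so the form of the product is a sum of forms of
  \<open>k\<close>.\<close>

lemma psd_Schur:
  assumes k: "psd k" and l: "psd l"
  shows "psd (\<lambda>p q. k p q * l p q)"
  unfolding psd_def
proof
  fix v :: "(complex \<times> 'a) list"
  define n where "n = length v"
  define c where "c i = fst (v ! i)" for i
  define x where "x i = snd (v ! i)" for i
  have "psd_on {..<n} (\<lambda>i j. l (x i) (x j))"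
    using l unfolding psd_on_def psd_def by (auto simp flip: ker_form_family)
  then obtain u where u: "\<And>i j. i < n \<Longrightarrow> j < n \<Longrightarrow> l (x i) (x j) = (\<Sum>m<n. u m i * cnj (u m j))"
    using psd_on_Gram[of "{..<n}" "\<lambda>i j. l (x i) (x j)"] by auto
  have "ker_form (\<lambda>p q. k p q * l p q) v v = (\<Sum>i<n. \<Sum>j<n. c i * cnj (c j) * (k (x i) (x j) * l (x i) (x j)))"
    unfolding n_def c_def x_def by (subst (1 2) list_family[of v], subst ker_form_family) (rule refl)
  also have "\<dots> = (\<Sum>i<n. \<Sum>j<n. \<Sum>m<n. (c i * u m i) * cnj (c j * u m j) * k (x i) (x j))"
    by (intro sum.cong refl) (simp add: u sum_distrib_left mult_ac)
  also have "\<dots> = (\<Sum>i<n. \<Sum>m<n. \<Sum>j<n. (c i * u m i) * cnj (c j * u m j) * k (x i) (x j))"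
    by (rule sum.cong[OF refl]) (rule sum.swap)
  also have "\<dots> = (\<Sum>m<n. \<Sum>i<n. \<Sum>j<n. (c i * u m i) * cnj (c j * u m j) * k (x i) (x j))"
    by (rule sum.swap)
  also have "\<dots> = (\<Sum>m<n. ker_form k (map (\<lambda>i. (c i * u m i, x i)) [0..<n]) (map (\<lambda>i. (c i * u m i, x i)) [0..<n]))"
    by (simp only: ker_form_family)
  also have "\<dots> \<in> \<real>\<^sub>\<ge>\<^sub>0"
    using k unfolding psd_def nonneg_Reals_iff by (auto intro!: sum_nonneg)
  finally show "ker_form (\<lambda>p q. k p q * l p q) v v \<in> \<real>\<^sub>\<ge>\<^sub>0" .
qed

lemma ker_form_add_kernel:
  "ker_form (\<lambda>p q. k p q + l p q) u v = ker_form k u v + ker_form l u v"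
  by (simp add: ker_form_def distrib_left sum_list_addf)

lemma ker_form_scale_kernel: "ker_form (\<lambda>p q. a * k p q) u v = a * ker_form k u v"
  by (simp add: ker_form_def sum_list_const_mult[symmetric] mult_ac)

lemma ker_form_diff_kernel:
  "ker_form (\<lambda>p q. k p q - l p q) u v = ker_form k u v - ker_form l u v"
  using ker_form_add_kernel[of k "\<lambda>p q. (-1) * l p q"] by (simp only: ker_form_scale_kernel) simp

lemma psd_add: "psd k \<Longrightarrow> psd l \<Longrightarrow> psd (\<lambda>p q. k p q + l p q)"
  by (simp add: psd_def ker_form_add_kernel nonneg_Reals_add_I)

lemma psd_scale: "a \<in> \<real>\<^sub>\<ge>\<^sub>0 \<Longrightarrow> psd k \<Longrightarrow> psd (\<lambda>p q. a * k p q)"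
  by (simp add: psd_def ker_form_scale_kernel nonneg_Reals_mult_I)

lemma ker_form_pullback:
  "ker_form k (map (map_prod id f) u) (map (map_prod id g) v) = ker_form (\<lambda>p q. k (f p) (g q)) u v"
  by (simp add: ker_form_def comp_def)

lemma psd_pullback: "psd k \<Longrightarrow> psd (\<lambda>p q. k (f p) (f q))"
  unfolding psd_def ker_form_pullback[symmetric] by blast

lemma psd_hermitian:
  assumes "psd k" shows "k q p = cnj (k p q)"
proof -
  have "ker_form k [(1, p)] [(1, p)] \<in> \<real>\<^sub>\<ge>\<^sub>0" "ker_form k [(1, q)] [(1, q)] \<in> \<real>\<^sub>\<ge>\<^sub>0"
    "ker_form k [(1, p), (1, q)] [(1, p), (1, q)] \<in> \<real>\<^sub>\<ge>\<^sub>0" 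
    "ker_form k [(\<i>, p), (1, q)] [(\<i>, p), (1, q)] \<in> \<real>\<^sub>\<ge>\<^sub>0" 
    using assms unfolding psd_def by blast+
  thus ?thesis by (simp add: ker_form_def nonneg_Reals_iff complex_eq_iff)
qed

section \<open>Hilbert spaces of functions\<close>

context pre_hilbert_space
begin

lemma hdist_commute: "\<lbrakk>x \<in> carrier H; y \<in> carrier H\<rbrakk> \<Longrightarrow> hnorm H (x \<ominus> y) = hnorm H (y \<ominus> x)"
  using ip_cnj[of x y] by (simp add: hdist_eq)

lemma hnorm_scale: "x \<in> carrier H \<Longrightarrow> hnorm H (c \<odot> x) = cmod c * hnorm H x"
proof -
  assume x: "x \<in> carrier H"
  have "ip H (c \<odot> x) (c \<odot> x) = (c * cnj c) * ip H x x"
    using x by (simp add: ip_scale ip_scale2)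
  also have "\<dots> = of_real ((cmod c * hnorm H x)\<^sup>2)"
    unfolding ip_self[OF x] complex_norm_square[symmetric] by (simp add: power_mult_distrib)
  finally have "ip H (c \<odot> x) (c \<odot> x) = of_real ((cmod c * hnorm H x)\<^sup>2)" .
  hence "Re (ip H (c \<odot> x) (c \<odot> x)) = (cmod c * hnorm H x)\<^sup>2" by simp
  thus ?thesis unfolding hnorm_def[of H "c \<odot> x"] using hnorm_nonneg[OF x] by simp
qed

lemma minus_add_cancel: "\<lbrakk>x \<in> carrier H; y \<in> carrier H\<rbrakk> \<Longrightarrow> (x \<ominus> y) \<oplus> y = x"
  by (simp add: M.minus_eq M.a_assoc M.l_neg)

lemma hnorm_diff_le:
  assumes x: "x \<in> carrier H" and y: "y \<in> carrier H"
  shows "\<bar>hnorm H x - hnorm H y\<bar> \<le> hnorm H (x \<ominus> y)"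
  using hnorm_triangle[of "x \<ominus> y" y] hnorm_triangle[of "y \<ominus> x" x] hdist_commute[OF x y]
  by (simp add: x y minus_add_cancel)

lemma hdist_triangle:
  assumes "x \<in> carrier H" "y \<in> carrier H" "z \<in> carrier H"
  shows "hnorm H (x \<ominus> z) \<le> hnorm H (x \<ominus> y) + hnorm H (y \<ominus> z)"
proof -
  have "(x \<ominus> y) \<oplus> (y \<ominus> z) = ((x \<ominus> y) \<oplus> y) \<ominus> z"
    using assms by (simp add: M.minus_eq M.a_assoc)
  hence "(x \<ominus> y) \<oplus> (y \<ominus> z) = x \<ominus> z" using assms by (simp add: minus_add_cancel)
  thus ?thesis using hnorm_triangle[of "x \<ominus> y" "y \<ominus> z"] assms by simp
qed

lemma ip_diff_le:
  assumes "a \<in> carrier H" "b \<in> carrier H" "a' \<in> carrier H" "b' \<in> carrier H"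
  shows "cmod (ip H a b - ip H a' b') \<le> hnorm H (a \<ominus> a') * hnorm H b + hnorm H a' * hnorm H (b \<ominus> b')"
proof -
  have "ip H a b - ip H a' b' = ip H (a \<ominus> a') b + ip H a' (b \<ominus> b')"
    using assms by (simp add: ip_minus ip_minus2)
  thus ?thesis
    using norm_triangle_ineq[of "ip H (a \<ominus> a') b" "ip H a' (b \<ominus> b')"]
      Cauchy_Schwarz[of "a \<ominus> a'" b] Cauchy_Schwarz[of a' "b \<ominus> b'"] assms by simp
qed

end

definition fun_space :: "('x \<Rightarrow> complex) set \<Rightarrow> (('x \<Rightarrow> complex) \<Rightarrow> ('x \<Rightarrow> complex) \<Rightarrow> complex)
    \<Rightarrow> ('x \<Rightarrow> complex) hilbert" where
  "fun_space S h = \<lparr>carrier = S, mult = (\<lambda>_ _ _. 0), one = (\<lambda>_. 0), zero = (\<lambda>_. 0),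
     add = (\<lambda>f g q. f q + g q), smult = (\<lambda>c f q. c * f q), ip = h\<rparr>"

lemma fun_space_simps [simp]:
  "carrier (fun_space S h) = S" "zero (fun_space S h) = (\<lambda>_. 0)"
  "f \<oplus>\<^bsub>fun_space S h\<^esub> g = (\<lambda>q. f q + g q)" "c \<odot>\<^bsub>fun_space S h\<^esub> f = (\<lambda>q. c * f q)"
  "ip (fun_space S h) = h"
  by (simp_all add: fun_space_def)

lemma fun_space_module:
  assumes "(\<lambda>_. 0) \<in> S" "\<And>f g. f \<in> S \<Longrightarrow> g \<in> S \<Longrightarrow> (\<lambda>q. f q + g q) \<in> S"
    "\<And>c f. f \<in> S \<Longrightarrow> (\<lambda>q. c * f q) \<in> S"
  shows "Module.module \<C> (fun_space S h)"
proof (rule moduleI[OF cring_complex_field])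
  show "abelian_group (fun_space S h)"
  proof (rule abelian_groupI)
    fix f assume "f \<in> carrier (fun_space S h)"
    thus "\<exists>g\<in>carrier (fun_space S h). g \<oplus>\<^bsub>fun_space S h\<^esub> f = \<zero>\<^bsub>fun_space S h\<^esub>"
      using assms(3)[of f "-1"] by (intro bexI[of _ "\<lambda>q. -1 * f q"]) auto
  qed (use assms in \<open>auto simp: add_ac\<close>)
qed (use assms in \<open>auto simp: ring_distribs mult_ac\<close>)

lemma fun_space_minus:
  assumes "abelian_group (fun_space S h)" "f \<in> S" "g \<in> S"
  shows "f \<ominus>\<^bsub>fun_space S h\<^esub> g = (\<lambda>q. f q - g q)"
proof -
  interpret M: abelian_group "fun_space S h" by fact
  have "(f \<ominus>\<^bsub>fun_space S h\<^esub> g) \<oplus>\<^bsub>fun_space S h\<^esub> g = f"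
    using assms(2,3) by (metis M.minus_eq M.a_assoc M.l_neg M.r_zero M.a_inv_closed fun_space_simps(1))
  hence "(f \<ominus>\<^bsub>fun_space S h\<^esub> g) q + g q = f q" for q by (auto dest: fun_cong)
  thus ?thesis by (auto simp: fun_eq_iff eq_diff_eq)
qed

lemma fun_space_finsum:
  assumes "abelian_group (fun_space S h)" "finite A" "\<And>a. a \<in> A \<Longrightarrow> F a \<in> S"
  shows "finsum (fun_space S h) F A = (\<lambda>q. \<Sum>a\<in>A. F a q)"
proof -
  interpret M: abelian_group "fun_space S h" by fact
  show ?thesis using assms(2,3)
  proof (induction A)
    case (insert a A)
    have "finsum (fun_space S h) F (insert a A) = F a \<oplus>\<^bsub>fun_space S h\<^esub> finsum (fun_space S h) F A"
      using insert by (intro M.finsum_insert) auto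
    thus ?case using insert by simp
  qed simp
qed

section \<open>The Hilbert space of a kernel\<close>

lemma cnj_sum_list: "cnj (sum_list xs) = (\<Sum>x\<leftarrow>xs. cnj x)"
  by (induction xs) auto

locale psd_kernel =
  fixes k :: "'x \<Rightarrow> 'x \<Rightarrow> complex"
  assumes psd: "psd k"
begin

definition ev :: "(complex \<times> 'x) list \<Rightarrow> 'x \<Rightarrow> complex" where
  "ev u = (\<lambda>q. \<Sum>x\<leftarrow>u. fst x * k (snd x) q)"

text \<open>The future inner product of f with \<open>ev v\<close>, computed from the values of f
  alone. It therefore depends on f as a function and not on a list representing it.\<close>

definition pairing :: "('x \<Rightarrow> complex) \<Rightarrow> (complex \<times> 'x) list \<Rightarrow> complex" where
  "pairing f v = (\<Sum>y\<leftarrow>v. cnj (fst y) * f (snd y))"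

lemma ker_form_ev: "ker_form k u v = pairing (ev u) v"
  by (induction u) (simp_all add: ker_form_def pairing_def ev_def distrib_left sum_list_addf mult_ac)

lemma ker_form_cnj: "ker_form k v u = cnj (ker_form k u v)"
  unfolding ker_form_ev[of v u] unfolding ker_form_def pairing_def ev_def
  by (simp add: cnj_sum_list comp_def sum_list_const_mult[symmetric] psd_hermitian[OF psd, symmetric] mult_ac)

lemma ev_Nil: "ev [] = (\<lambda>_. 0)" and ev_append: "ev (u @ v) = (\<lambda>q. ev u q + ev v q)"
  and ev_single: "ev [(1, p)] = k p"
  and ev_scale: "ev (map (map_prod ((*) c) id) u) = (\<lambda>q. c * ev u q)"
  by (simp_all add: ev_def comp_def sum_list_const_mult[symmetric] mult_ac)

lemma pairing_append: "pairing f (u @ v) = pairing f u + pairing f v"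
  and pairing_single: "pairing f [(1, p)] = f p"
  and pairing_scale: "pairing f (map (map_prod ((*) c) id) u) = cnj c * pairing f u"
  and pairing_add: "pairing (\<lambda>q. f q + g q) v = pairing f v + pairing g v"
  and pairing_scale_fun: "pairing (\<lambda>q. c * f q) v = c * pairing f v"
  by (simp_all add: pairing_def comp_def sum_list_const_mult[symmetric] distrib_left sum_list_addf mult_ac)

text \<open>\<open>P\<close> is the linear span of the functions \<open>k p\<close>; \<open>Hk\<close> completes it by the pointwise limits of its
  Cauchy sequences, so that vectors remain functions with the pointwise operations.\<close>

definition P :: "('x \<Rightarrow> complex) hilbert" where
  "P = fun_space (range ev) (\<lambda>f g. pairing f (SOME v. g = ev v))"

lemma P_simps [simp]:
  "carrier P = range ev" "zero P = (\<lambda>_. 0)"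
  "f \<oplus>\<^bsub>P\<^esub> g = (\<lambda>q. f q + g q)" "c \<odot>\<^bsub>P\<^esub> f = (\<lambda>q. c * f q)"
  by (simp_all add: P_def)

text \<open>By \<open>ker_form_ev\<close> the form depends on its first list only through the
  function it represents, and by conjugate symmetry the same holds for the second list. So the
  choice made by \<open>SOME\<close> is immaterial.\<close>

lemma P_ip [simp]: "ip P (ev u) (ev v) = ker_form k u v"
proof -
  define w where "w = (SOME w. ev v = ev w)"
  have w: "ev v = ev w" unfolding w_def by (rule someI) (rule refl)
  have "ip P (ev u) (ev v) = ker_form k u w" by (simp add: P_def ker_form_ev w_def)
  also have "\<dots> = ker_form k u v" by (metis w ker_form_ev ker_form_cnj)
  finally show ?thesis .
qed

lemma P_ip_pairing: "f \<in> carrier P \<Longrightarrow> ip P f (ev v) = pairing f v"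
  by (auto simp: ker_form_ev)

lemma P_zero [simp]: "(\<lambda>_. 0) \<in> range ev"
  using rangeI[of ev "[]"] by (simp only: ev_Nil)
lemma P_add [simp]: "f \<in> range ev \<Longrightarrow> g \<in> range ev \<Longrightarrow> (\<lambda>q. f q + g q) \<in> range ev" 
  by (elim rangeE) (simp flip: ev_append)
lemma P_scale [simp]: "f \<in> range ev \<Longrightarrow> (\<lambda>q. c * f q) \<in> range ev" 
  by (elim rangeE) (simp flip: ev_scale)
lemma P_point [simp]: "k p \<in> range ev"
  using rangeI[of ev "[(1, p)]"] by (simp only: ev_single)

lemma P_pre: "pre_hilbert_space P"
proof (intro pre_hilbert_space.intro pre_hilbert_space_axioms.intro)
  show "Module.module \<C> P" unfolding P_def by (rule fun_space_module) simp_all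
next
  fix f g h assume "f \<in> carrier P" "g \<in> carrier P" "h \<in> carrier P"
  then obtain w where "h = ev w" "f \<in> carrier P" "g \<in> carrier P" by auto
  thus "ip P (f \<oplus>\<^bsub>P\<^esub> g) h = ip P f h + ip P g h"
    by (simp add: P_ip_pairing pairing_add)
next
  fix c f g assume "f \<in> carrier P" "g \<in> carrier P"
  then obtain w where "g = ev w" "f \<in> carrier P" by auto
  thus "ip P (c \<odot>\<^bsub>P\<^esub> f) g = c * ip P f g"
    by (simp add: P_ip_pairing pairing_scale_fun)
next
  fix f g assume "f \<in> carrier P" "g \<in> carrier P"
  thus "ip P g f = cnj (ip P f g)" by (auto intro: ker_form_cnj)
next
  fix f assume "f \<in> carrier P"
  thus "ip P f f \<in> \<real>\<^sub>\<ge>\<^sub>0" using psd by (auto simp: psd_def)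
next
  fix f assume "f \<in> carrier P" and 0: "ip P f f = 0"
  then obtain u where u: "f = ev u" by auto
  have "f q = 0" for q
  proof (rule ccontr)
    assume "f q \<noteq> 0"
    \<comment> \<open>With <f, f> = 0 the form at s f + k q has no quadratic term in s. This s makes
      2 Re (s f q) equal to -Re (k q q) - 1, so the form would have real part -1.\<close>
    define s where "s = - (cnj (k q q) + 1) / (2 * (f q))"
    define v where "v = map (map_prod ((*) s) id) u @ [(1, q)]"
    have sf: "2 * (s * f q) = - (cnj (k q q) + 1)" using \<open>f q \<noteq> 0\<close> by (simp add: s_def)
    have uu: "pairing (ev u) u = 0" using 0 u by (simp add: ker_form_ev)
    have uq: "pairing (k q) u = cnj (f q)"
      using ker_form_cnj[of "[(1, q)]" u] by (simp add: ker_form_ev ev_single pairing_single u)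
    have "ker_form k v v = s * f q + cnj (s * f q) + k q q"
      unfolding ker_form_ev v_def ev_append ev_scale ev_single pairing_append pairing_scale
        pairing_add pairing_scale_fun pairing_single uu uq using u by simp
    hence "Re (ker_form k v v) = Re (2 * (s * f q)) + Re (k q q)" by simp
    also have "\<dots> = - 1" unfolding sf by simp
    finally show False using psd by (auto simp: psd_def nonneg_Reals_iff dest!: spec[of _ v])
  qed
  thus "f = \<zero>\<^bsub>P\<^esub>" by (simp add: fun_eq_iff)
qed

sublocale P: pre_hilbert_space P by (rule P_pre)

lemma P_minus [simp]: "f \<in> range ev \<Longrightarrow> g \<in> range ev \<Longrightarrow> f \<ominus>\<^bsub>P\<^esub> g = (\<lambda>q. f q - g q)"
  using fun_space_minus P.M.abelian_group_axioms unfolding P_def by blast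

lemma P_diff [simp]: "f \<in> range ev \<Longrightarrow> g \<in> range ev \<Longrightarrow> (\<lambda>q. f q - g q) \<in> range ev"
  using P.M.minus_closed[of f g] by simp

section \<open>Completion of the span by pointwise limits of Cauchy sequences\<close>

definition approx :: "(nat \<Rightarrow> 'x \<Rightarrow> complex) \<Rightarrow> ('x \<Rightarrow> complex) \<Rightarrow> bool" where
  "approx \<sigma> f \<longleftrightarrow> (\<forall>n. \<sigma> n \<in> range ev) \<and>
    (\<forall>e>0. \<exists>N. \<forall>m\<ge>N. \<forall>n\<ge>N. hnorm P (\<lambda>q. \<sigma> m q - \<sigma> n q) < e) \<and>
    (\<forall>q. (\<lambda>n. \<sigma> n q) \<longlonglongrightarrow> f q)"

lemma approx_in [simp]: "approx \<sigma> f \<Longrightarrow> \<sigma> n \<in> range ev"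
  by (simp add: approx_def)

lemma approxD: "approx \<sigma> f \<Longrightarrow> e > 0 \<Longrightarrow> \<exists>N. \<forall>m\<ge>N. \<forall>n\<ge>N. hnorm P (\<lambda>q. \<sigma> m q - \<sigma> n q) < e"
  by (simp add: approx_def)

lemma approx_pointwise: "approx \<sigma> f \<Longrightarrow> (\<lambda>n. \<sigma> n q) \<longlonglongrightarrow> f q"
  by (simp add: approx_def)

lemma approx_const: "f \<in> range ev \<Longrightarrow> approx (\<lambda>_. f) f"
  using P.hnorm_eq_0[of "\<lambda>_. 0"] by (simp add: approx_def)

lemma approx_add:
  assumes "approx \<sigma> f" "approx \<rho> g"
  shows "approx (\<lambda>n q. \<sigma> n q + \<rho> n q) (\<lambda>q. f q + g q)"
  unfolding approx_def
proof (intro conjI allI impI)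
  fix e :: real assume "e > 0"
  hence "e / 2 > 0" by simp
  then obtain M N where M: "\<And>m n. m \<ge> M \<Longrightarrow> n \<ge> M \<Longrightarrow> hnorm P (\<lambda>q. \<sigma> m q - \<sigma> n q) < e / 2"
    and N: "\<And>m n. m \<ge> N \<Longrightarrow> n \<ge> N \<Longrightarrow> hnorm P (\<lambda>q. \<rho> m q - \<rho> n q) < e / 2"
    using approxD[OF assms(1)] approxD[OF assms(2)] by meson
  have "hnorm P (\<lambda>q. (\<sigma> m q + \<rho> m q) - (\<sigma> n q + \<rho> n q)) < e" if "m \<ge> max M N" "n \<ge> max M N" for m n
    using P.hnorm_triangle[of "\<lambda>q. \<sigma> m q - \<sigma> n q" "\<lambda>q. \<rho> m q - \<rho> n q"] M[of m n] N[of m n] that assms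
    by (simp add: algebra_simps)
  thus "\<exists>N. \<forall>m\<ge>N. \<forall>n\<ge>N. hnorm P (\<lambda>q. (\<sigma> m q + \<rho> m q) - (\<sigma> n q + \<rho> n q)) < e" by blast
qed (use assms approx_pointwise[OF assms(1)] approx_pointwise[OF assms(2)] in \<open>auto intro!: tendsto_add\<close>)

lemma approx_scale:
  assumes "approx \<sigma> f"
  shows "approx (\<lambda>n q. c * \<sigma> n q) (\<lambda>q. c * f q)"
  unfolding approx_def
proof (intro conjI allI impI)
  fix e :: real assume "e > 0"
  \<comment> \<open>The summand 1 keeps the divisor positive when c = 0.\<close>
  then obtain N where N: "\<And>m n. m \<ge> N \<Longrightarrow> n \<ge> N \<Longrightarrow> hnorm P (\<lambda>q. \<sigma> m q - \<sigma> n q) < e / (cmod c + 1)"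
    using approxD[OF assms(1), of "e / (cmod c + 1)"] by (auto simp: add_nonneg_pos)
  have "hnorm P (\<lambda>q. c * \<sigma> m q - c * \<sigma> n q) < e" if "m \<ge> N" "n \<ge> N" for m n
  proof -
    have "hnorm P (\<lambda>q. c * \<sigma> m q - c * \<sigma> n q) = cmod c * hnorm P (\<lambda>q. \<sigma> m q - \<sigma> n q)"
      using P.hnorm_scale[of "\<lambda>q. \<sigma> m q - \<sigma> n q" c] assms by (simp add: algebra_simps)
    also have "\<dots> \<le> (cmod c + 1) * hnorm P (\<lambda>q. \<sigma> m q - \<sigma> n q)"
      using P.hnorm_nonneg[of "\<lambda>q. \<sigma> m q - \<sigma> n q"] assms by (intro mult_right_mono) auto
    also have "\<dots> < e" using N[OF that] by (simp add: less_divide_eq mult.commute add_nonneg_pos)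
    finally show ?thesis .
  qed
  thus "\<exists>N. \<forall>m\<ge>N. \<forall>n\<ge>N. hnorm P (\<lambda>q. c * \<sigma> m q - c * \<sigma> n q) < e" by blast
qed (use assms approx_pointwise[OF assms] in \<open>auto intro!: tendsto_mult_left\<close>)

lemma approx_diff:
  "approx \<sigma> f \<Longrightarrow> approx \<rho> g \<Longrightarrow> approx (\<lambda>n q. \<sigma> n q - \<rho> n q) (\<lambda>q. f q - g q)"
  using approx_add[OF _ approx_scale[of \<rho> g "-1"], of \<sigma> f] by simp

lemma approx_norm_convergent:
  assumes "approx \<sigma> f" shows "convergent (\<lambda>n. hnorm P (\<sigma> n))"
proof -
  have "\<bar>hnorm P (\<sigma> m) - hnorm P (\<sigma> n)\<bar> \<le> hnorm P (\<lambda>q. \<sigma> m q - \<sigma> n q)" for m n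
    using P.hnorm_diff_le[of "\<sigma> m" "\<sigma> n"] assms by simp
  hence "Cauchy (\<lambda>n. hnorm P (\<sigma> n))"
    using approxD[OF assms] unfolding Cauchy_def dist_real_def by (meson le_less_trans)
  thus ?thesis by (simp add: Cauchy_convergent_iff)
qed

lemma approx_bounded:
  assumes "approx \<sigma> f" obtains M where "M > 0" "\<And>n. hnorm P (\<sigma> n) \<le> M"
proof -
  obtain M where "M > 0" "\<And>n. \<bar>hnorm P (\<sigma> n)\<bar> \<le> M"
    using convergent_imp_Bseq[OF approx_norm_convergent[OF assms]] by (auto simp: Bseq_def)
  thus ?thesis using that by (metis abs_le_D1)
qed

lemma approx_pairing:
  assumes "approx \<sigma> f" shows "(\<lambda>n. pairing (\<sigma> n) v) \<longlonglongrightarrow> pairing f v"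
  unfolding pairing_def
  by (induction v) (auto intro!: tendsto_add tendsto_mult_left approx_pointwise[OF assms])

lemma approx_ip_convergent:
  assumes \<sigma>: "approx \<sigma> f" and \<rho>: "approx \<rho> g"
  shows "convergent (\<lambda>n. ip P (\<sigma> n) (\<rho> n))"
proof -
  obtain M where M: "M > 0" "\<And>n. hnorm P (\<sigma> n) \<le> M" using approx_bounded[OF \<sigma>] by blast
  obtain M' where M': "M' > 0" "\<And>n. hnorm P (\<rho> n) \<le> M'" using approx_bounded[OF \<rho>] by blast
  have "Cauchy (\<lambda>n. ip P (\<sigma> n) (\<rho> n))"
  proof (rule metric_CauchyI)
    fix e :: real assume "e > 0"
    hence "e / (2 * M') > 0" "e / (2 * M) > 0" using M M' by simp_all
    then obtain N N' where N: "\<And>m n. m \<ge> N \<Longrightarrow> n \<ge> N \<Longrightarrow> hnorm P (\<lambda>q. \<sigma> m q - \<sigma> n q) < e / (2 * M')"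
      and N': "\<And>m n. m \<ge> N' \<Longrightarrow> n \<ge> N' \<Longrightarrow> hnorm P (\<lambda>q. \<rho> m q - \<rho> n q) < e / (2 * M)"
      using approxD[OF \<sigma>] approxD[OF \<rho>] by meson
    have "dist (ip P (\<sigma> m) (\<rho> m)) (ip P (\<sigma> n) (\<rho> n)) < e" if "m \<ge> max N N'" "n \<ge> max N N'" for m n
    proof -
      have "cmod (ip P (\<sigma> m) (\<rho> m) - ip P (\<sigma> n) (\<rho> n))
          \<le> hnorm P (\<lambda>q. \<sigma> m q - \<sigma> n q) * hnorm P (\<rho> m) + hnorm P (\<sigma> n) * hnorm P (\<lambda>q. \<rho> m q - \<rho> n q)"
        using P.ip_diff_le[of "\<sigma> m" "\<rho> m" "\<sigma> n" "\<rho> n"] \<sigma> \<rho> by simp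
      also have "\<dots> \<le> hnorm P (\<lambda>q. \<sigma> m q - \<sigma> n q) * M' + M * hnorm P (\<lambda>q. \<rho> m q - \<rho> n q)"
        using M M' \<sigma> \<rho> P.hnorm_nonneg by (intro add_mono mult_left_mono mult_right_mono) auto
      also have "\<dots> < e / (2 * M') * M' + M * (e / (2 * M))"
        using N[of m n] N'[of m n] that M(1) M'(1) by (intro add_strict_mono mult_strict_left_mono mult_strict_right_mono) auto
      also have "\<dots> = e" using M(1) M'(1) by simp
      finally show ?thesis by (simp add: dist_norm)
    qed
    thus "\<exists>N. \<forall>m\<ge>N. \<forall>n\<ge>N. dist (ip P (\<sigma> m) (\<rho> m)) (ip P (\<sigma> n) (\<rho> n)) < e" by blast
  qed
  thus ?thesis by (simp add: Cauchy_convergent_iff)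
qed

text \<open>The fact that makes a completion by functions possible: a Cauchy sequence with pointwise
  limit 0 also tends to 0 in norm. For fixed m the vector \<open>\<delta> m\<close> is a finite
  combination of kernel functions, so <\<delta> n, \<delta> m> tends to 0 in n, while it differs
  from the squared norm of \<open>\<delta> m\<close> by at most e/2 once m and n are large.\<close>

lemma approx_null:
  assumes \<delta>: "approx \<delta> (\<lambda>_. 0)"
  shows "(\<lambda>n. hnorm P (\<delta> n)) \<longlonglongrightarrow> 0"
proof -
  obtain M where M: "M > 0" "\<And>n. hnorm P (\<delta> n) \<le> M" using approx_bounded[OF \<delta>] by blast
  have "(\<lambda>n. (hnorm P (\<delta> n))\<^sup>2) \<longlonglongrightarrow> 0"
  proof (rule LIMSEQ_I)
    fix e :: real assume e: "e > 0"
    obtain N where N: "\<And>m n. m \<ge> N \<Longrightarrow> n \<ge> N \<Longrightarrow> hnorm P (\<lambda>q. \<delta> m q - \<delta> n q) < e / (2 * M)"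
      using approxD[OF \<delta>, of "e / (2 * M)"] e M(1) by auto
    have "(hnorm P (\<delta> m))\<^sup>2 < e" if m: "m \<ge> N" for m
    proof -
      obtain v where v: "\<delta> m = ev v" using approx_in[OF \<delta>, of m] by blast
      have "(\<lambda>n. ip P (\<delta> n) (\<delta> m)) \<longlonglongrightarrow> 0"
        using approx_pairing[OF \<delta>, of v] \<delta> by (simp add: v P_ip_pairing pairing_def)
      hence lim: "(\<lambda>n. e / 2 + cmod (ip P (\<delta> n) (\<delta> m))) \<longlonglongrightarrow> e / 2"
        using tendsto_norm_zero tendsto_add[OF tendsto_const] by fastforce
      have "(hnorm P (\<delta> m))\<^sup>2 \<le> e / 2 + cmod (ip P (\<delta> n) (\<delta> m))" if n: "n \<ge> N" for n
      proof -
        have "(hnorm P (\<delta> m))\<^sup>2 = cmod (ip P (\<delta> m) (\<delta> m))"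
          using P.ip_self[of "\<delta> m"] \<delta> by (simp add: norm_power)
        also have "ip P (\<delta> m) (\<delta> m) = ip P (\<lambda>q. \<delta> m q - \<delta> n q) (\<delta> m) + ip P (\<delta> n) (\<delta> m)"
          using P.ip_minus[of "\<delta> m" "\<delta> n" "\<delta> m"] \<delta> by simp
        also have "cmod \<dots> \<le> hnorm P (\<lambda>q. \<delta> m q - \<delta> n q) * hnorm P (\<delta> m) + cmod (ip P (\<delta> n) (\<delta> m))"
          using P.Cauchy_Schwarz[of "\<lambda>q. \<delta> m q - \<delta> n q" "\<delta> m"] \<delta>
          by (intro order.trans[OF norm_triangle_ineq]) simp
        also have "hnorm P (\<lambda>q. \<delta> m q - \<delta> n q) * hnorm P (\<delta> m) \<le> e / (2 * M) * M"
          using N[OF m n] M(2)[of m] e M(1) P.hnorm_nonneg[of "\<delta> m"] \<delta> by (intro mult_mono) auto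
        finally show ?thesis using M(1) by simp
      qed
      hence "(hnorm P (\<delta> m))\<^sup>2 \<le> e / 2" by (intro LIMSEQ_le_const[OF lim]) blast
      thus ?thesis using e by simp
    qed
    thus "\<exists>N. \<forall>m\<ge>N. norm ((hnorm P (\<delta> m))\<^sup>2 - 0) < e" by auto
  qed
  hence "(\<lambda>n. sqrt ((hnorm P (\<delta> n))\<^sup>2)) \<longlonglongrightarrow> sqrt 0" by (rule tendsto_real_sqrt)
  thus ?thesis using P.hnorm_nonneg \<delta> by simp
qed

definition Hk :: "('x \<Rightarrow> complex) hilbert" where
  "Hk = fun_space {f. \<exists>\<sigma>. approx \<sigma> f}
     (\<lambda>f g. lim (\<lambda>n. ip P ((SOME \<sigma>. approx \<sigma> f) n) ((SOME \<rho>. approx \<rho> g) n)))"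

lemma Hk_simps [simp]:
  "zero Hk = (\<lambda>_. 0)" "f \<oplus>\<^bsub>Hk\<^esub> g = (\<lambda>q. f q + g q)" "c \<odot>\<^bsub>Hk\<^esub> f = (\<lambda>q. c * f q)"
  by (simp_all add: Hk_def)

lemma Hk_carrier: "f \<in> carrier Hk \<longleftrightarrow> (\<exists>\<sigma>. approx \<sigma> f)"
  by (simp add: Hk_def)

lemma P_sub_Hk: "f \<in> range ev \<Longrightarrow> f \<in> carrier Hk"
  using approx_const Hk_carrier by blast

text \<open>Independence of the representatives picked by \<open>SOME\<close>: two approximating
  sequences of one function differ by a sequence with pointwise limit 0, which is null in norm by
  \<open>approx_null\<close>.\<close>

lemma Hk_ip_lim:
  assumes \<sigma>: "approx \<sigma> f" and \<rho>: "approx \<rho> g"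
  shows "(\<lambda>n. ip P (\<sigma> n) (\<rho> n)) \<longlonglongrightarrow> ip Hk f g"
proof -
  define \<sigma>' where "\<sigma>' = (SOME \<sigma>. approx \<sigma> f)"
  define \<rho>' where "\<rho>' = (SOME \<rho>. approx \<rho> g)"
  have \<sigma>': "approx \<sigma>' f" unfolding \<sigma>'_def by (rule someI[of "\<lambda>\<sigma>. approx \<sigma> f", OF \<sigma>])
  have \<rho>': "approx \<rho>' g" unfolding \<rho>'_def by (rule someI[of "\<lambda>\<rho>. approx \<rho> g", OF \<rho>])
  have lim': "(\<lambda>n. ip P (\<sigma>' n) (\<rho>' n)) \<longlonglongrightarrow> ip Hk f g"
    using approx_ip_convergent[OF \<sigma>' \<rho>'] by (simp add: Hk_def \<sigma>'_def \<rho>'_def convergent_LIMSEQ_iff)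
  obtain M where M: "\<And>n. hnorm P (\<sigma>' n) \<le> M" using approx_bounded[OF \<sigma>'] by blast
  obtain M' where M': "\<And>n. hnorm P (\<rho> n) \<le> M'" using approx_bounded[OF \<rho>] by blast
  have 1: "(\<lambda>n. hnorm P (\<lambda>q. \<sigma> n q - \<sigma>' n q)) \<longlonglongrightarrow> 0"
    using approx_diff[OF \<sigma> \<sigma>'] by (intro approx_null) simp
  have 2: "(\<lambda>n. hnorm P (\<lambda>q. \<rho> n q - \<rho>' n q)) \<longlonglongrightarrow> 0"
    using approx_diff[OF \<rho> \<rho>'] by (intro approx_null) simp
  have "(\<lambda>n. ip P (\<sigma> n) (\<rho> n) - ip P (\<sigma>' n) (\<rho>' n)) \<longlonglongrightarrow> 0"
  proof (rule Lim_null_comparison)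
    show "(\<lambda>n. hnorm P (\<lambda>q. \<sigma> n q - \<sigma>' n q) * M' + M * hnorm P (\<lambda>q. \<rho> n q - \<rho>' n q)) \<longlonglongrightarrow> 0"
      using tendsto_add[OF tendsto_mult_right[OF 1, of M'] tendsto_mult_left[OF 2, of M]] by simp
    have "cmod (ip P (\<sigma> n) (\<rho> n) - ip P (\<sigma>' n) (\<rho>' n))
        \<le> hnorm P (\<lambda>q. \<sigma> n q - \<sigma>' n q) * M' + M * hnorm P (\<lambda>q. \<rho> n q - \<rho>' n q)" for n
    proof -
      have "cmod (ip P (\<sigma> n) (\<rho> n) - ip P (\<sigma>' n) (\<rho>' n))
          \<le> hnorm P (\<lambda>q. \<sigma> n q - \<sigma>' n q) * hnorm P (\<rho> n) + hnorm P (\<sigma>' n) * hnorm P (\<lambda>q. \<rho> n q - \<rho>' n q)"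
        using P.ip_diff_le[of "\<sigma> n" "\<rho> n" "\<sigma>' n" "\<rho>' n"] \<sigma> \<rho> \<sigma>' \<rho>' by simp
      also have "\<dots> \<le> hnorm P (\<lambda>q. \<sigma> n q - \<sigma>' n q) * M' + M * hnorm P (\<lambda>q. \<rho> n q - \<rho>' n q)"
        using M M' \<sigma> \<rho> \<sigma>' \<rho>' P.hnorm_nonneg by (intro add_mono mult_left_mono mult_right_mono) auto
      finally show ?thesis .
    qed
    thus "\<forall>\<^sub>F n in sequentially. norm (ip P (\<sigma> n) (\<rho> n) - ip P (\<sigma>' n) (\<rho>' n))
        \<le> hnorm P (\<lambda>q. \<sigma> n q - \<sigma>' n q) * M' + M * hnorm P (\<lambda>q. \<rho> n q - \<rho>' n q)" by simp
  qed
  from tendsto_add[OF this lim'] show ?thesis by simp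
qed

lemma Hk_ip_P: "f \<in> range ev \<Longrightarrow> g \<in> range ev \<Longrightarrow> ip Hk f g = ip P f g"
  using Hk_ip_lim[OF approx_const approx_const, of f g] LIMSEQ_unique[OF _ tendsto_const] by metis

text \<open>The reproducing property, inherited from the span by passing to the limit. It turns
  inner products with kernel functions into values and is the main means of computation on tensor
  products below.\<close>

lemma Hk_ip_point: "f \<in> carrier Hk \<Longrightarrow> ip Hk f (k q) = f q"
proof -
  assume "f \<in> carrier Hk"
  then obtain \<sigma> where \<sigma>: "approx \<sigma> f" by (auto simp: Hk_carrier)
  have "ip P (\<sigma> n) (k q) = \<sigma> n q" for n
    using P_ip_pairing[of "\<sigma> n" "[(1, q)]"] \<sigma> by (simp add: ev_single pairing_single)
  hence "(\<lambda>n. \<sigma> n q) \<longlonglongrightarrow> ip Hk f (k q)"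
    using Hk_ip_lim[OF \<sigma> approx_const[of "k q"]] by simp
  thus ?thesis using approx_pointwise[OF \<sigma>] LIMSEQ_unique by blast
qed

lemma Hk_pre: "pre_hilbert_space Hk"
proof (intro pre_hilbert_space.intro pre_hilbert_space_axioms.intro)
  show "Module.module \<C> Hk" unfolding Hk_def
    using approx_add approx_scale approx_const[OF P_zero] by (intro fun_space_module) blast+
next
  fix f g h assume "f \<in> carrier Hk" "g \<in> carrier Hk" "h \<in> carrier Hk"
  then obtain \<sigma> \<rho> \<tau> where a: "approx \<sigma> f" "approx \<rho> g" "approx \<tau> h" by (auto simp: Hk_carrier)
  have "(\<lambda>n. ip P (\<lambda>q. \<sigma> n q + \<rho> n q) (\<tau> n)) \<longlonglongrightarrow> ip Hk (\<lambda>q. f q + g q) h"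
    by (intro Hk_ip_lim approx_add a)
  moreover have "ip P (\<lambda>q. \<sigma> n q + \<rho> n q) (\<tau> n) = ip P (\<sigma> n) (\<tau> n) + ip P (\<rho> n) (\<tau> n)" for n
    using P.ip_add[of "\<sigma> n" "\<rho> n" "\<tau> n"] a by simp
  ultimately show "ip Hk (f \<oplus>\<^bsub>Hk\<^esub> g) h = ip Hk f h + ip Hk g h"
    using LIMSEQ_unique[OF _ tendsto_add[OF Hk_ip_lim[OF a(1,3)] Hk_ip_lim[OF a(2,3)]]] by simp
next
  fix c f g assume "f \<in> carrier Hk" "g \<in> carrier Hk"
  then obtain \<sigma> \<rho> where a: "approx \<sigma> f" "approx \<rho> g" by (auto simp: Hk_carrier)
  have "(\<lambda>n. ip P (\<lambda>q. c * \<sigma> n q) (\<rho> n)) \<longlonglongrightarrow> ip Hk (\<lambda>q. c * f q) g"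
    by (intro Hk_ip_lim approx_scale a)
  moreover have "ip P (\<lambda>q. c * \<sigma> n q) (\<rho> n) = c * ip P (\<sigma> n) (\<rho> n)" for n
    using P.ip_scale[of "\<sigma> n" "\<rho> n" c] a by simp
  ultimately show "ip Hk (c \<odot>\<^bsub>Hk\<^esub> f) g = c * ip Hk f g"
    using LIMSEQ_unique[OF _ tendsto_mult_left[OF Hk_ip_lim[OF a], of c]] by simp
next
  fix f g assume "f \<in> carrier Hk" "g \<in> carrier Hk"
  then obtain \<sigma> \<rho> where a: "approx \<sigma> f" "approx \<rho> g" by (auto simp: Hk_carrier)
  have "ip P (\<rho> n) (\<sigma> n) = cnj (ip P (\<sigma> n) (\<rho> n))" for n
    using a by (intro P.ip_cnj) simp_all
  hence "(\<lambda>n. cnj (ip P (\<sigma> n) (\<rho> n))) \<longlonglongrightarrow> ip Hk g f"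
    using Hk_ip_lim[OF a(2,1)] by presburger
  thus "ip Hk g f = cnj (ip Hk f g)"
    by (rule LIMSEQ_unique[OF _ tendsto_cnj[OF Hk_ip_lim[OF a]]])
next
  fix f assume "f \<in> carrier Hk"
  then obtain \<sigma> where a: "approx \<sigma> f" by (auto simp: Hk_carrier)
  show "ip Hk f f \<in> \<real>\<^sub>\<ge>\<^sub>0"
    by (rule closed_sequentially[OF closed_nonneg_Reals_complex _ Hk_ip_lim[OF a a]])
      (rule P.ip_nonneg, use a in simp)
next
  fix f assume "f \<in> carrier Hk" and 0: "ip Hk f f = 0"
  then obtain \<sigma> where a: "approx \<sigma> f" by (auto simp: Hk_carrier)
  have "(\<lambda>n. sqrt (Re (ip P (\<sigma> n) (\<sigma> n)))) \<longlonglongrightarrow> sqrt (Re 0)"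
    using Hk_ip_lim[OF a a] 0 by (intro tendsto_intros) simp
  hence n0: "(\<lambda>n. hnorm P (\<sigma> n)) \<longlonglongrightarrow> 0" by (simp add: hnorm_def)
  have "f q = 0" for q
  proof -
    have "(\<lambda>n. \<sigma> n q) \<longlonglongrightarrow> 0"
    proof (rule Lim_null_comparison)
      show "(\<lambda>n. hnorm P (\<sigma> n) * hnorm P (k q)) \<longlonglongrightarrow> 0"
        using tendsto_mult_right[OF n0, of "hnorm P (k q)"] by simp
      have "cmod (\<sigma> n q) \<le> hnorm P (\<sigma> n) * hnorm P (k q)" for n
        using P.Cauchy_Schwarz[of "\<sigma> n" "k q"] P_ip_pairing[of "\<sigma> n" "[(1, q)]"] a
        by (simp add: ev_single pairing_single)
      thus "\<forall>\<^sub>F n in sequentially. norm (\<sigma> n q) \<le> hnorm P (\<sigma> n) * hnorm P (k q)" by simp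
    qed
    thus ?thesis using approx_pointwise[OF a] LIMSEQ_unique by blast
  qed
  thus "f = \<zero>\<^bsub>Hk\<^esub>" by (simp add: fun_eq_iff)
qed

sublocale Hk: pre_hilbert_space Hk by (rule Hk_pre)

lemma fun_space_Hk: "fun_space (carrier Hk) (ip Hk) = Hk" by (simp add: Hk_def)

lemma Hk_minus: "f \<in> carrier Hk \<Longrightarrow> g \<in> carrier Hk \<Longrightarrow> f \<ominus>\<^bsub>Hk\<^esub> g = (\<lambda>q. f q - g q)"
  using fun_space_minus[of "carrier Hk" "ip Hk", unfolded fun_space_Hk] Hk.M.abelian_group_axioms by blast

lemma Hk_norm_lim: "approx \<sigma> f \<Longrightarrow> (\<lambda>n. hnorm P (\<sigma> n)) \<longlonglongrightarrow> hnorm Hk f"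
  unfolding hnorm_def by (intro tendsto_intros Hk_ip_lim)

lemma Hk_norm_P: "f \<in> range ev \<Longrightarrow> hnorm Hk f = hnorm P f"
  by (simp add: hnorm_def Hk_ip_P)

lemma approx_dense:
  assumes \<sigma>: "approx \<sigma> f"
  shows "(\<lambda>n. hnorm Hk (f \<ominus>\<^bsub>Hk\<^esub> \<sigma> n)) \<longlonglongrightarrow> 0"
proof (rule LIMSEQ_I)
  fix e :: real assume e: "e > 0"
  then obtain N where N: "\<And>m n. m \<ge> N \<Longrightarrow> n \<ge> N \<Longrightarrow> hnorm P (\<lambda>q. \<sigma> m q - \<sigma> n q) < e / 2"
    using approxD[OF \<sigma>, of "e / 2"] by auto
  have fc: "f \<in> carrier Hk" "\<And>n. \<sigma> n \<in> carrier Hk" using \<sigma> P_sub_Hk[OF approx_in[OF \<sigma>]] Hk_carrier by blast+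
  have "hnorm Hk (f \<ominus>\<^bsub>Hk\<^esub> \<sigma> n) < e" if n: "n \<ge> N" for n
  proof -
    have "(\<lambda>m. hnorm P (\<lambda>q. \<sigma> m q - \<sigma> n q)) \<longlonglongrightarrow> hnorm Hk (\<lambda>q. f q - \<sigma> n q)"
      using \<sigma> by (intro Hk_norm_lim approx_diff approx_const) simp_all
    hence "hnorm Hk (\<lambda>q. f q - \<sigma> n q) \<le> e / 2"
      by (rule LIMSEQ_le_const2) (use N n in \<open>auto intro!: exI[of _ N] less_imp_le\<close>)
    thus ?thesis using e fc by (simp add: Hk_minus)
  qed
  thus "\<exists>N. \<forall>n\<ge>N. norm (hnorm Hk (f \<ominus>\<^bsub>Hk\<^esub> \<sigma> n) - 0) < e"
    using fc Hk.hnorm_nonneg by auto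
qed

text \<open>Each \<open>F n\<close> is replaced by some \<open>g n\<close> in the span at distance
  below 1/(n+1). The sequence \<open>g\<close> is Cauchy in the span, and point evaluations are
  bounded by Cauchy-Schwarz, so \<open>g\<close> has a pointwise limit f; then \<open>F\<close>
  tends to f in norm.\<close>

lemma Hk_hilbert: "hilbert_space Hk"
proof (intro hilbert_space.intro hilbert_space_axioms.intro Hk_pre)
  fix F :: "nat \<Rightarrow> 'x \<Rightarrow> complex" assume F: "\<And>n. F n \<in> carrier Hk"
    and C: "\<And>e. e > 0 \<Longrightarrow> \<exists>N. \<forall>m\<ge>N. \<forall>n\<ge>N. hnorm Hk (F m \<ominus>\<^bsub>Hk\<^esub> F n) < e"
  have "\<exists>g\<in>range ev. hnorm Hk (F n \<ominus>\<^bsub>Hk\<^esub> g) < 1 / real (Suc n)" for n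
  proof -
    obtain \<sigma> where \<sigma>: "approx \<sigma> (F n)" using F[of n] Hk_carrier by blast
    then obtain m where "norm (hnorm Hk (F n \<ominus>\<^bsub>Hk\<^esub> \<sigma> m) - 0) < 1 / real (Suc n)"
      using LIMSEQ_D[OF approx_dense[OF \<sigma>], of "1 / real (Suc n)"] by auto
    thus ?thesis using \<sigma> by (intro bexI[of _ "\<sigma> m"]) auto
  qed
  then obtain g where g: "\<And>n. g n \<in> range ev" "\<And>n. hnorm Hk (F n \<ominus>\<^bsub>Hk\<^esub> g n) < 1 / real (Suc n)"
    by metis
  have gc: "g n \<in> carrier Hk" for n using g by (simp add: P_sub_Hk)
  have inv: "(\<lambda>n. 1 / real (Suc n)) \<longlonglongrightarrow> 0" by (rule lim_1_over_n[THEN LIMSEQ_Suc])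
  have gC: "\<exists>N. \<forall>m\<ge>N. \<forall>n\<ge>N. hnorm P (\<lambda>q. g m q - g n q) < e" if e: "e > 0" for e
  proof -
    obtain N where N: "\<And>m n. m \<ge> N \<Longrightarrow> n \<ge> N \<Longrightarrow> hnorm Hk (F m \<ominus>\<^bsub>Hk\<^esub> F n) < e / 3"
      using C[of "e / 3"] e by auto
    obtain N' where N': "\<And>n. n \<ge> N' \<Longrightarrow> 1 / real (Suc n) < e / 3"
      using LIMSEQ_D[OF inv, of "e / 3"] e by auto
    have "hnorm P (\<lambda>q. g m q - g n q) < e" if "m \<ge> max N N'" "n \<ge> max N N'" for m n
    proof -
      have "hnorm P (\<lambda>q. g m q - g n q) = hnorm Hk (g m \<ominus>\<^bsub>Hk\<^esub> g n)"
        using g gc by (simp add: Hk_minus Hk_norm_P)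
      also have "\<dots> \<le> hnorm Hk (g m \<ominus>\<^bsub>Hk\<^esub> F m) + (hnorm Hk (F m \<ominus>\<^bsub>Hk\<^esub> F n) + hnorm Hk (F n \<ominus>\<^bsub>Hk\<^esub> g n))"
        using Hk.hdist_triangle[of "g m" "F m" "g n"] Hk.hdist_triangle[of "F m" "F n" "g n"] F gc
        by fastforce
      also have "\<dots> < e"
        using g(2)[of m] g(2)[of n] N[of m n] N'[of m] N'[of n] that Hk.hdist_commute[OF F gc, of m m] by simp
      finally show ?thesis .
    qed
    thus ?thesis by blast
  qed
  have "\<exists>y. (\<lambda>n. g n q) \<longlonglongrightarrow> y" for q
  proof -
    have "Cauchy (\<lambda>n. g n q)"
    proof (rule metric_CauchyI)
      fix e :: real assume e: "e > 0"
      \<comment> \<open>The summand 1 keeps the divisor positive when \<open>k q\<close> is the zero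
        vector.\<close>
      define K where "K = hnorm P (k q) + 1"
      have K: "K > 0" using P.hnorm_nonneg[of "k q"] by (simp add: K_def)
      have "e / K > 0" using e K by simp
      then obtain N where N: "\<And>m n. m \<ge> N \<Longrightarrow> n \<ge> N \<Longrightarrow> hnorm P (\<lambda>q. g m q - g n q) < e / K"
        using gC by meson
      have "dist (g m q) (g n q) < e" if mn: "m \<ge> N" "n \<ge> N" for m n
      proof -
        have "cmod (g m q - g n q) \<le> hnorm P (\<lambda>q. g m q - g n q) * hnorm P (k q)"
          using P.Cauchy_Schwarz[of "\<lambda>q. g m q - g n q" "k q"]
            P_ip_pairing[of "\<lambda>q. g m q - g n q" "[(1, q)]"] g by (simp add: ev_single pairing_single)
        also have "\<dots> \<le> hnorm P (\<lambda>q. g m q - g n q) * K"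
          using P.hnorm_nonneg[of "\<lambda>q. g m q - g n q"] g by (intro mult_left_mono) (auto simp: K_def)
        also have "\<dots> < e" using N[OF mn] K by (simp add: less_divide_eq)
        finally show ?thesis by (simp add: dist_norm)
      qed
      thus "\<exists>N. \<forall>m\<ge>N. \<forall>n\<ge>N. dist (g m q) (g n q) < e" by blast
    qed
    thus ?thesis by (simp add: Cauchy_convergent_iff convergent_def)
  qed
  then obtain f where "\<And>q. (\<lambda>n. g n q) \<longlonglongrightarrow> f q" by metis
  hence ap: "approx g f" using g gC by (simp add: approx_def)
  hence fc: "f \<in> carrier Hk" by (auto simp: Hk_carrier)
  have "(\<lambda>n. hnorm Hk (F n \<ominus>\<^bsub>Hk\<^esub> f)) \<longlonglongrightarrow> 0"
  proof (rule Lim_null_comparison)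
    show "(\<lambda>n. 1 / real (Suc n) + hnorm Hk (f \<ominus>\<^bsub>Hk\<^esub> g n)) \<longlonglongrightarrow> 0"
      using tendsto_add[OF inv approx_dense[OF ap]] by simp
    have "hnorm Hk (F n \<ominus>\<^bsub>Hk\<^esub> f) \<le> 1 / real (Suc n) + hnorm Hk (f \<ominus>\<^bsub>Hk\<^esub> g n)" for n
      using Hk.hdist_triangle[of "F n" "g n" f] F gc fc g(2)[of n] Hk.hdist_commute[OF fc gc, of n]
      by simp
    thus "\<forall>\<^sub>F n in sequentially. norm (hnorm Hk (F n \<ominus>\<^bsub>Hk\<^esub> f)) \<le> 1 / real (Suc n) + hnorm Hk (f \<ominus>\<^bsub>Hk\<^esub> g n)"
      using Hk.hnorm_nonneg F fc by simp
  qed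
  thus "\<exists>x\<in>carrier Hk. (\<lambda>n. hnorm Hk (F n \<ominus>\<^bsub>Hk\<^esub> x)) \<longlonglongrightarrow> 0" using fc by blast
qed

lemma Hk_finsum:
  assumes "finite A" "\<And>a. a \<in> A \<Longrightarrow> F a \<in> carrier Hk"
  shows "finsum Hk F A = (\<lambda>q. \<Sum>a\<in>A. F a q)"
  using fun_space_finsum[of "carrier Hk" "ip Hk", unfolded fun_space_Hk] assms Hk.M.abelian_group_axioms by blast

text \<open>Serves for the regrouped state of the quantum case, a finite sum of simple tensors: an
  inner product with it is a sum of values.\<close>

lemma Hk_ip_sum_points:
  assumes "finite A"
  shows "(\<lambda>q. \<Sum>a\<in>A. k (p a) q) \<in> carrier Hk \<and>
    (\<forall>f\<in>carrier Hk. ip Hk f (\<lambda>q. \<Sum>a\<in>A. k (p a) q) = (\<Sum>a\<in>A. f (p a)))"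
  using assms
proof (induction A)
  case empty
  show ?case using Hk.ip_zero2 Hk.M.zero_closed by simp
next
  case (insert a A)
  have "k (p a) \<in> carrier Hk" by (simp add: P_sub_Hk)
  thus ?case
    using insert Hk.M.a_closed[of "k (p a)" "\<lambda>q. \<Sum>a\<in>A. k (p a) q"]
      Hk.ip_add2[of "k (p a)" "\<lambda>q. \<Sum>a\<in>A. k (p a) q"] by (simp add: Hk_ip_point)
qed

text \<open>Since \<open>f q\<close> is the inner product of \<open>f\<close> with \<open>k q\<close>, the operator \<open>k q \<mapsto> k (\<theta> q)\<close> with
  self-adjoint \<open>\<theta>\<close> acts on functions by composition.\<close>

lemma positive_operator_comp:
  assumes adj: "\<And>p q. k (\<theta> p) q = k p (\<theta> q)" and C: "C \<in> \<real>\<^sub>\<ge>\<^sub>0"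
    and bound: "psd (\<lambda>p q. C * k p q - k (\<theta> p) (\<theta> q))" and pos: "psd (\<lambda>p q. k (\<theta> p) q)"
  shows "positive_operator Hk (\<lambda>f. f \<circ> \<theta>)"
proof -
  \<comment> \<open>By \<open>adj\<close>, the composition of \<open>k p\<close> with \<theta> is
    \<open>k (\<theta> p)\<close>; hence composition maps the span into itself, moving the points of
    a list.\<close>
  have ev: "ev v \<circ> \<theta> = ev (map (map_prod id \<theta>) v)" for v
    by (simp add: ev_def fun_eq_iff adj comp_def)
  have evP: "f \<circ> \<theta> \<in> range ev" if "f \<in> range ev" for f using that ev by force
  \<comment> \<open>Read on a list representing f, the hypothesis \<open>bound\<close> says that the
    squared norm of the composition of f with \<theta> is at most Re C times that of f.\<close>
  define K where "K = sqrt (Re C)"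
  have normP: "hnorm P (f \<circ> \<theta>) \<le> K * hnorm P f" if f: "f \<in> range ev" for f
  proof -
    obtain v where v: "f = ev v" using f by blast
    have "ker_form (\<lambda>p q. C * k p q - k (\<theta> p) (\<theta> q)) v v \<in> \<real>\<^sub>\<ge>\<^sub>0" using bound unfolding psd_def by blast
    hence "Re (ker_form k (map (map_prod id \<theta>) v) (map (map_prod id \<theta>) v)) \<le> Re (C * ker_form k v v)"
      by (simp add: ker_form_diff_kernel ker_form_scale_kernel ker_form_pullback nonneg_Reals_iff)
    also have "\<dots> = Re C * Re (ker_form k v v)"
      using C by (simp add: nonneg_Reals_iff)
    finally show ?thesis by (simp add: v hnorm_def ev K_def real_sqrt_mult[symmetric])
  qed
  have K: "K \<ge> 0" using C by (simp add: K_def nonneg_Reals_iff)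
  have ap: "approx (\<lambda>n. \<sigma> n \<circ> \<theta>) (f \<circ> \<theta>)" if \<sigma>: "approx \<sigma> f" for \<sigma> f
    unfolding approx_def
  proof (intro conjI allI impI)
    fix e :: real assume e: "e > 0"
    obtain N where N: "\<And>m n. m \<ge> N \<Longrightarrow> n \<ge> N \<Longrightarrow> hnorm P (\<lambda>q. \<sigma> m q - \<sigma> n q) < e / (K + 1)"
      using approxD[OF \<sigma>, of "e / (K + 1)"] e K by auto
    have "hnorm P (\<lambda>q. (\<sigma> m \<circ> \<theta>) q - (\<sigma> n \<circ> \<theta>) q) < e" if "m \<ge> N" "n \<ge> N" for m n
    proof -
      have "hnorm P (\<lambda>q. (\<sigma> m \<circ> \<theta>) q - (\<sigma> n \<circ> \<theta>) q) \<le> K * hnorm P (\<lambda>q. \<sigma> m q - \<sigma> n q)"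
        using normP[of "\<lambda>q. \<sigma> m q - \<sigma> n q"] \<sigma> by (simp add: comp_def)
      also have "\<dots> \<le> (K + 1) * hnorm P (\<lambda>q. \<sigma> m q - \<sigma> n q)"
        using P.hnorm_nonneg[of "\<lambda>q. \<sigma> m q - \<sigma> n q"] \<sigma> by (intro mult_right_mono) auto
      also have "\<dots> < e" using N[OF that] K by (simp add: less_divide_eq mult.commute)
      finally show ?thesis .
    qed
    thus "\<exists>N. \<forall>m\<ge>N. \<forall>n\<ge>N. hnorm P (\<lambda>q. (\<sigma> m \<circ> \<theta>) q - (\<sigma> n \<circ> \<theta>) q) < e" by blast
  qed (use \<sigma> evP approx_pointwise in \<open>auto simp: comp_def\<close>)
  have "hnorm Hk (f \<circ> \<theta>) \<le> K * hnorm Hk f" if f: "f \<in> carrier Hk" for f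
  proof -
    obtain \<sigma> where \<sigma>: "approx \<sigma> f" using f by (auto simp: Hk_carrier)
    show ?thesis
      by (rule LIMSEQ_le[OF Hk_norm_lim[OF ap[OF \<sigma>]] tendsto_mult_left[OF Hk_norm_lim[OF \<sigma>]]])
        (use normP \<sigma> in auto)
  qed
  moreover have "f \<circ> \<theta> \<in> carrier Hk" if "f \<in> carrier Hk" for f
    using that ap by (auto simp: Hk_carrier)
  moreover have "ip Hk (f \<circ> \<theta>) f \<in> \<real>\<^sub>\<ge>\<^sub>0" if f: "f \<in> carrier Hk" for f
  proof -
    obtain \<sigma> where \<sigma>: "approx \<sigma> f" using f by (auto simp: Hk_carrier)
    have "ip P (\<sigma> n \<circ> \<theta>) (\<sigma> n) \<in> \<real>\<^sub>\<ge>\<^sub>0" for n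
    proof -
      obtain v where v: "\<sigma> n = ev v" using approx_in[OF \<sigma>, of n] by blast
      have "ker_form k (map (map_prod id \<theta>) v) (map (map_prod id id) v) \<in> \<real>\<^sub>\<ge>\<^sub>0"
        unfolding ker_form_pullback using pos by (simp add: psd_def)
      moreover have "map_prod id id = (id :: complex \<times> 'x \<Rightarrow> _)" by (rule map_prod.id)
      ultimately show ?thesis by (simp add: v ev)
    qed
    thus ?thesis
      using closed_sequentially[OF closed_nonneg_Reals_complex _ Hk_ip_lim[OF ap[OF \<sigma>] \<sigma>]] by blast
  qed
  ultimately show ?thesis
    unfolding positive_operator_def bounded_operator_def by (auto simp: comp_def)
qed

end

section \<open>Operators and spans in pre-Hilbert spaces\<close>

lemma bounded_operatorD:
  assumes "bounded_operator H T"
  shows "x \<in> carrier H \<Longrightarrow> T x \<in> carrier H"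
    and "x \<in> carrier H \<Longrightarrow> y \<in> carrier H \<Longrightarrow> T (x \<oplus>\<^bsub>H\<^esub> y) = T x \<oplus>\<^bsub>H\<^esub> T y"
    and "x \<in> carrier H \<Longrightarrow> T (c \<odot>\<^bsub>H\<^esub> x) = c \<odot>\<^bsub>H\<^esub> T x"
  using assms by (auto simp: bounded_operator_def)

lemma positive_operator_bounded: "positive_operator H T \<Longrightarrow> bounded_operator H T"
  by (simp add: positive_operator_def)

lemma positive_operator_in: "positive_operator H T \<Longrightarrow> x \<in> carrier H \<Longrightarrow> T x \<in> carrier H"
  by (rule bounded_operatorD(1)[OF positive_operator_bounded])

lemma povm_positive: "povm H E \<Longrightarrow> positive_operator H (E a)"
  by (simp add: povm_def)

lemma povm_finsum: "povm H E \<Longrightarrow> x \<in> carrier H \<Longrightarrow> finsum H (\<lambda>a. E a x) UNIV = x"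
  by (simp add: povm_def)

context pre_hilbert_space
begin

lemma hnorm_zero: "hnorm H \<zero> = 0"
  by (simp add: hnorm_eq_0)

lemma hnorm_eq_1: "x \<in> carrier H \<Longrightarrow> hnorm H x = 1 \<longleftrightarrow> ip H x x = 1"
  using hnorm_nonneg[of x] by (auto simp: ip_self power2_eq_1_iff simp flip: of_real_power)

lemma ip_eqI:
  assumes "x \<in> carrier H" "y \<in> carrier H" "\<And>u. u \<in> carrier H \<Longrightarrow> ip H x u = ip H y u"
  shows "x = y"
proof -
  have "x \<ominus> y = \<zero>" using assms by (intro ip_definite) (simp_all add: ip_minus)
  thus ?thesis using minus_add_cancel[OF assms(1,2)] assms(2) by simp
qed

lemma ip_finsum:
  assumes "finite A" "\<And>a. a \<in> A \<Longrightarrow> F a \<in> carrier H" "y \<in> carrier H"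
  shows "ip H (finsum H F A) y = (\<Sum>a\<in>A. ip H (F a) y)"
  using assms(1,2)
proof (induction A)
  case (insert a A)
  have "finsum H F (insert a A) = F a \<oplus> finsum H F A"
    using insert by (intro M.finsum_insert) auto
  moreover have "finsum H F A \<in> carrier H" using insert by (intro M.finsum_closed) auto
  ultimately show ?case using insert assms(3) by (simp add: ip_add)
qed (simp add: assms(3) ip_zero)

lemma bounded_id: "bounded_operator H id" "bounded_operator H (\<lambda>x. x)"
  by (auto simp: bounded_operator_def intro!: exI[of _ 1])

lemma positive_id: "positive_operator H id"
  using ip_nonneg bounded_id by (simp add: positive_operator_def)

lemma bounded_operator_bound:
  assumes "bounded_operator H T"
  obtains C where "C \<ge> 0" "\<And>x. x \<in> carrier H \<Longrightarrow> hnorm H (T x) \<le> C * hnorm H x"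
proof -
  obtain K where K: "\<And>x. x \<in> carrier H \<Longrightarrow> hnorm H (T x) \<le> K * hnorm H x"
    using assms unfolding bounded_operator_def by blast
  have "hnorm H (T x) \<le> max K 0 * hnorm H x" if "x \<in> carrier H" for x
    using K[OF that] hnorm_nonneg[OF that] mult_right_mono[of K "max K 0" "hnorm H x"] by linarith
  thus ?thesis using that[of "max K 0"] by simp
qed

lemma positive_operator_cong:
  assumes "\<And>x. x \<in> carrier H \<Longrightarrow> S x = T x" "positive_operator H T"
  shows "positive_operator H S"
proof -
  have "bounded_operator H S"
    using assms(2) unfolding positive_operator_def bounded_operator_def by (simp add: assms(1) Pi_def)
  thus ?thesis using assms by (simp add: positive_operator_def)
qed

lemma positive_operator_zero: "positive_operator H (\<lambda>_. \<zero>)"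
  by (auto simp: positive_operator_def bounded_operator_def ip_zero hnorm_zero smult_r_null intro!: exI[of _ 0])

lemma positive_operator_add:
  assumes S: "positive_operator H S" and T: "positive_operator H T"
  shows "positive_operator H (\<lambda>x. S x \<oplus> T x)"
proof -
  note bS = positive_operator_bounded[OF S] and bT = positive_operator_bounded[OF T]
  note D = bounded_operatorD[OF bS] bounded_operatorD[OF bT]
  obtain C where C: "\<And>x. x \<in> carrier H \<Longrightarrow> hnorm H (S x) \<le> C * hnorm H x"
    using bounded_operator_bound[OF bS] by blast
  obtain C' where C': "\<And>x. x \<in> carrier H \<Longrightarrow> hnorm H (T x) \<le> C' * hnorm H x"
    using bounded_operator_bound[OF bT] by blast
  have "hnorm H (S x \<oplus> T x) \<le> (C + C') * hnorm H x" if "x \<in> carrier H" for x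
    using hnorm_triangle[of "S x" "T x"] C[OF that] C'[OF that] D that by (simp add: distrib_right)
  moreover have "ip H (S x \<oplus> T x) x \<in> \<real>\<^sub>\<ge>\<^sub>0" if "x \<in> carrier H" for x
    using S T that D by (simp add: ip_add positive_operator_def nonneg_Reals_add_I)
  ultimately show ?thesis
    unfolding positive_operator_def bounded_operator_def
    by (auto simp: D M.a_ac smult_r_distr)
qed

lemma positive_operator_finsum:
  assumes "finite A" "\<And>a. a \<in> A \<Longrightarrow> positive_operator H (T a)"
  shows "positive_operator H (\<lambda>x. finsum H (\<lambda>a. T a x) A)"
  using assms
proof (induction A)
  case empty
  show ?case by (simp add: positive_operator_zero)
next
  case (insert a A)
  show ?case
  proof (rule positive_operator_cong)
    show "positive_operator H (\<lambda>x. T a x \<oplus> finsum H (\<lambda>a. T a x) A)"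
      using insert by (intro positive_operator_add) auto
  next
    fix x assume x: "x \<in> carrier H"
    have "T b x \<in> carrier H" if "b \<in> insert a A" for b
      using positive_operator_in[OF insert.prems[OF that] x] .
    thus "finsum H (\<lambda>a. T a x) (insert a A) = T a x \<oplus> finsum H (\<lambda>a. T a x) A"
      using insert.hyps by (intro M.finsum_insert) auto
  qed
qed

text \<open>Moving points outside the carrier to zero turns inner products into total kernels.\<close>

definition cl :: "'h \<Rightarrow> 'h" where "cl x = (if x \<in> carrier H then x else \<zero>)"

lemma cl_in [simp]: "cl x \<in> carrier H" and cl_id [simp]: "x \<in> carrier H \<Longrightarrow> cl x = x"
  by (simp_all add: cl_def)

fun lincomb :: "(complex \<times> 'h) list \<Rightarrow> 'h" where
  "lincomb [] = \<zero>"
| "lincomb (p # v) = fst p \<odot> cl (snd p) \<oplus> lincomb v"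

lemma lincomb_in [simp]: "lincomb v \<in> carrier H"
  by (induction v) simp_all

lemma bounded_operator_zero: "bounded_operator H T \<Longrightarrow> T \<zero> = \<zero>"
  using bounded_operatorD(3)[of H T \<zero> 0] bounded_operatorD(1)[of H T \<zero>] smult_l_null smult_r_null by simp

text \<open>The link between operators and kernels: sesquilinearity gathers a formal combination
  into one vector, so semidefiniteness of a kernel built from operators becomes an inequality at a
  single vector \<open>lincomb v\<close>.\<close>

lemma ker_form_operators:
  assumes S: "bounded_operator H S" and T: "bounded_operator H T"
  shows "ker_form (\<lambda>x y. ip H (S (cl x)) (T (cl y))) u v = ip H (S (lincomb u)) (T (lincomb v))"
proof -
  note D = bounded_operatorD[OF S] bounded_operatorD[OF T] bounded_operator_zero[OF S] bounded_operator_zero[OF T]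
  have 1: "(\<Sum>y\<leftarrow>v. c * cnj (fst y) * ip H z (T (cl (snd y)))) = c * ip H z (T (lincomb v))"
    if "z \<in> carrier H" for c z
    using that by (induction v) (simp_all add: D ip_zero2 ip_add2 ip_scale2 distrib_left mult_ac)
  show ?thesis unfolding ker_form_def
    by (induction u) (simp_all add: D 1 ip_zero ip_add ip_scale)
qed

lemma psd_positive_operator:
  assumes "positive_operator H T" shows "psd (\<lambda>x y. ip H (T (cl x)) (cl y))"
  using ker_form_operators[OF positive_operator_bounded[OF assms] bounded_id(2)] assms
  by (simp add: psd_def positive_operator_def)

lemma psd_operator_square:
  assumes "bounded_operator H T" shows "psd (\<lambda>x y. ip H (T (cl x)) (T (cl y)))"
  using ker_form_operators[OF assms assms] bounded_operatorD(1)[OF assms] ip_nonneg by (simp add: psd_def)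

lemma psd_ip: "psd (\<lambda>x y. ip H (cl x) (cl y))"
  using psd_operator_square[OF bounded_id(2)] .

text \<open>Boundedness in the form the Schur product theorem can use: the estimate of the squared
  norm of T z by K^2 times that of z, at all z = \<open>lincomb v\<close>, is semidefiniteness of
  the difference kernel.\<close>

lemma psd_operator_bound:
  assumes T: "bounded_operator H T"
  obtains C where "C \<in> \<real>\<^sub>\<ge>\<^sub>0" "psd (\<lambda>x y. C * ip H (cl x) (cl y) - ip H (T (cl x)) (T (cl y)))"
proof -
  obtain K where K: "K \<ge> 0" "\<And>x. x \<in> carrier H \<Longrightarrow> hnorm H (T x) \<le> K * hnorm H x"
    using bounded_operator_bound[OF T] by blast
  have "of_real (K\<^sup>2) * ip H z z - ip H (T z) (T z) \<in> \<real>\<^sub>\<ge>\<^sub>0" if z: "z \<in> carrier H" for z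
  proof -
    have "(hnorm H (T z))\<^sup>2 \<le> (K * hnorm H z)\<^sup>2"
      using K(2)[OF z] hnorm_nonneg bounded_operatorD(1)[OF T z] by (intro power_mono) auto
    moreover have "of_real (K\<^sup>2) * ip H z z - ip H (T z) (T z) = of_real ((K * hnorm H z)\<^sup>2 - (hnorm H (T z))\<^sup>2)"
      using z bounded_operatorD(1)[OF T z] by (simp add: ip_self power_mult_distrib)
    ultimately show ?thesis by (simp only: complex_nonneg_Reals_iff Re_complex_of_real Im_complex_of_real) simp
  qed
  hence "psd (\<lambda>x y. of_real (K\<^sup>2) * ip H (cl x) (cl y) - ip H (T (cl x)) (T (cl y)))"
    using ker_form_operators[OF bounded_id(2) bounded_id(2)] ker_form_operators[OF T T]
    by (simp add: psd_def ker_form_diff_kernel ker_form_scale_kernel)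
  thus ?thesis using that[of "of_real (K\<^sup>2)"] by (simp only: nonneg_Reals_of_real_iff) simp
qed

section \<open>Spans of finite sets and orthogonal projection onto them\<close>

lemma hspan_submodule:
  assumes "B \<subseteq> carrier H"
  shows "\<zero> \<in> hspan H B" "x \<in> hspan H B \<Longrightarrow> y \<in> hspan H B \<Longrightarrow> x \<oplus> y \<in> hspan H B"
    "x \<in> hspan H B \<Longrightarrow> c \<odot> x \<in> hspan H B"
proof -
  have "\<zero> \<in> S" "x \<in> S \<Longrightarrow> y \<in> S \<Longrightarrow> x \<oplus> y \<in> S" "x \<in> S \<Longrightarrow> c \<odot> x \<in> S"
    if "submodule S \<C> H" for S x y c
  proof -
    interpret S: submodule S \<C> H by fact
    show "\<zero> \<in> S" using S.one_closed by simp
    show "x \<in> S \<Longrightarrow> y \<in> S \<Longrightarrow> x \<oplus> y \<in> S" using S.m_closed[of x y] by simp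
    show "x \<in> S \<Longrightarrow> c \<odot> x \<in> S" using S.smult_closed[of c x] by simp
  qed
  thus "\<zero> \<in> hspan H B" "x \<in> hspan H B \<Longrightarrow> y \<in> hspan H B \<Longrightarrow> x \<oplus> y \<in> hspan H B"
    "x \<in> hspan H B \<Longrightarrow> c \<odot> x \<in> hspan H B"
    by (auto simp: hspan_def)
qed

lemma hspan_superset: "B \<subseteq> hspan H B"
  by (auto simp: hspan_def)

lemma hspan_in: "B \<subseteq> carrier H \<Longrightarrow> x \<in> hspan H B \<Longrightarrow> x \<in> carrier H"
  using hspan_subset[OF pre_hilbert_space_axioms] by blast

lemma hspan_mono: "A \<subseteq> B \<Longrightarrow> hspan H A \<subseteq> hspan H B"
  by (auto simp: hspan_def)

lemma orth_hspan:
  assumes "z \<in> carrier H" "B \<subseteq> carrier H" "\<And>b. b \<in> B \<Longrightarrow> ip H z b = 0" "x \<in> hspan H B"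
  shows "ip H z x = 0"
  using hspanD[OF assms(4) orth_submodule[OF assms(1)]] assms(2,3) by blast

text \<open>Gram-Schmidt: the component \<open>z0\<close> of the new vector b orthogonal to B
  corrects the projection m onto the old span.\<close>

lemma finite_projection:
  assumes "finite B" "B \<subseteq> carrier H" "x \<in> carrier H"
  shows "\<exists>m\<in>hspan H B. \<forall>b\<in>B. ip H (x \<ominus> m) b = 0"
  using assms
proof (induction B arbitrary: x)
  case empty
  thus ?case using hspan_submodule(1)[of "{}"] by auto
next
  case (insert b B)
  have B: "B \<subseteq> carrier H" and b: "b \<in> carrier H" using insert.prems by auto
  obtain m0 where m0: "m0 \<in> hspan H B" "\<And>y. y \<in> B \<Longrightarrow> ip H (b \<ominus> m0) y = 0"
    using insert.IH[OF B b] by blast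
  obtain m where m: "m \<in> hspan H B" "\<And>y. y \<in> B \<Longrightarrow> ip H (x \<ominus> m) y = 0"
    using insert.IH[OF B insert.prems(2)] by blast
  have c: "m0 \<in> carrier H" "m \<in> carrier H" using m0 m hspan_in[OF B] by auto
  define z0 where "z0 = b \<ominus> m0"
  \<comment> \<open>The coefficient that makes the new remainder orthogonal to \<open>z0\<close>. If
    \<open>z0\<close> is zero, orthogonality to it holds anyway and a is 0.\<close>
  define a where "a = ip H (x \<ominus> m) z0 / ip H z0 z0"
  define m' where "m' = m \<oplus> a \<odot> z0"
  have z0: "z0 \<in> carrier H" using b c by (simp add: z0_def)
  have m'c: "m' \<in> carrier H" using c z0 by (simp add: m'_def)
  have ipm': "ip H (x \<ominus> m') y = ip H (x \<ominus> m) y - a * ip H z0 y" if "y \<in> carrier H" for y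
    using that insert.prems(2) c z0 m'c by (simp add: ip_minus ip_add ip_scale m'_def)
  have B': "ip H (x \<ominus> m') y = 0" if "y \<in> B" for y
    using that B m(2)[OF that] m0(2)[OF that] ipm'[of y] by (auto simp: z0_def)
  have "b = z0 \<oplus> m0" using minus_add_cancel[OF b c(1)] by (simp add: z0_def)
  hence "ip H (x \<ominus> m') b = ip H (x \<ominus> m') z0 + ip H (x \<ominus> m') m0"
    using z0 c m'c insert.prems(2) by (simp add: ip_add2)
  also have "ip H (x \<ominus> m') m0 = 0"
    using m'c insert.prems(2) by (intro orth_hspan[OF _ B B' m0(1)]) auto
  also have "ip H (x \<ominus> m') z0 = 0"
    using ipm'[OF z0] ip_definite[OF z0] ip_zero2[of "x \<ominus> m"] c insert.prems(2) by (auto simp: a_def)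
  finally have "ip H (x \<ominus> m') b = 0" by simp
  moreover have "m' \<in> hspan H (insert b B)"
  proof -
    note sub = hspan_submodule[OF insert.prems(1)]
    have s: "m \<in> hspan H (insert b B)" "m0 \<in> hspan H (insert b B)" "b \<in> hspan H (insert b B)"
      using m m0 hspan_mono[of B "insert b B"] hspan_superset by blast+
    have "z0 = b \<oplus> (-1) \<odot> m0"
      using b c z0 by (intro ip_eqI) (simp_all add: z0_def ip_minus ip_add ip_scale)
    thus ?thesis using s sub by (simp add: m'_def)
  qed
  ultimately show ?case using B' by blast
qed

text \<open>A vector minus its projection onto the span is orthogonal to B, hence zero. Spanning is
  thus reduced to the absence of orthogonal vectors, which is easy to test on functions.\<close>

lemma finite_hspan_total:
  assumes B: "finite B" "B \<subseteq> carrier H"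
    and tot: "\<And>z. z \<in> carrier H \<Longrightarrow> (\<And>b. b \<in> B \<Longrightarrow> ip H z b = 0) \<Longrightarrow> z = \<zero>"
  shows "hspan H B = carrier H"
proof
  show "carrier H \<subseteq> hspan H B"
  proof
    fix x assume x: "x \<in> carrier H"
    obtain m where m: "m \<in> hspan H B" "\<And>b. b \<in> B \<Longrightarrow> ip H (x \<ominus> m) b = 0"
      using finite_projection[OF B x] by blast
    have mc: "m \<in> carrier H" using m hspan_in B by blast
    have "x \<ominus> m = \<zero>" using tot[of "x \<ominus> m"] m x mc by auto
    thus "x \<in> hspan H B" using minus_add_cancel[OF x mc] m mc by simp
  qed
qed (use hspan_in B in blast)

end

section \<open>Tensor products of Hilbert spaces\<close>

locale hilbert_tensor = H1: hilbert_space H1 + H2: hilbert_space H2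
  for H1 :: "'a hilbert" and H2 :: "'b hilbert"
begin

definition tk :: "'a \<times> 'b \<Rightarrow> 'a \<times> 'b \<Rightarrow> complex" where
  "tk p q = ip H1 (H1.cl (fst p)) (H1.cl (fst q)) * ip H2 (H2.cl (snd p)) (H2.cl (snd q))"

sublocale psd_kernel tk
  unfolding tk_def
  by unfold_locales (rule psd_Schur[OF psd_pullback[OF H1.psd_ip, of fst] psd_pullback[OF H2.psd_ip, of snd]])

lemma tk_in [simp]: "tk p \<in> carrier Hk"
  by (simp add: P_sub_Hk)

lemma tk_cl: "tk (H1.cl x, H2.cl y) = tk (x, y)"
  by (simp add: tk_def fun_eq_iff)

lemma fun_cl: "f \<in> carrier Hk \<Longrightarrow> f (H1.cl x, H2.cl y) = f (x, y)"
  using Hk_ip_point[of f "(x, y)"] Hk_ip_point[of f "(H1.cl x, H2.cl y)"] by (simp add: tk_cl)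

lemma tk_add:
  "x \<in> carrier H1 \<Longrightarrow> x' \<in> carrier H1 \<Longrightarrow> tk (x \<oplus>\<^bsub>H1\<^esub> x', y) = tk (x, y) \<oplus>\<^bsub>Hk\<^esub> tk (x', y)"
  "y \<in> carrier H2 \<Longrightarrow> y' \<in> carrier H2 \<Longrightarrow> tk (x, y \<oplus>\<^bsub>H2\<^esub> y') = tk (x, y) \<oplus>\<^bsub>Hk\<^esub> tk (x, y')"
  by (simp_all add: tk_def fun_eq_iff H1.ip_add H2.ip_add ring_distribs)

lemma tk_scale:
  "x \<in> carrier H1 \<Longrightarrow> tk (c \<odot>\<^bsub>H1\<^esub> x, y) = c \<odot>\<^bsub>Hk\<^esub> tk (x, y)"
  "y \<in> carrier H2 \<Longrightarrow> tk (x, c \<odot>\<^bsub>H2\<^esub> y) = c \<odot>\<^bsub>Hk\<^esub> tk (x, y)"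
  by (simp_all add: tk_def fun_eq_iff H1.ip_scale H2.ip_scale)

lemma tk_zero: "tk (\<zero>\<^bsub>H1\<^esub>, y) = \<zero>\<^bsub>Hk\<^esub>" "tk (x, \<zero>\<^bsub>H2\<^esub>) = \<zero>\<^bsub>Hk\<^esub>"
  by (simp_all add: tk_def fun_eq_iff H1.ip_zero H2.ip_zero)

lemma fun_add:
  assumes "f \<in> carrier Hk"
  shows "x \<in> carrier H1 \<Longrightarrow> x' \<in> carrier H1 \<Longrightarrow> f (x \<oplus>\<^bsub>H1\<^esub> x', y) = f (x, y) + f (x', y)"
    "y \<in> carrier H2 \<Longrightarrow> y' \<in> carrier H2 \<Longrightarrow> f (x, y \<oplus>\<^bsub>H2\<^esub> y') = f (x, y) + f (x, y')"
  using assms by (simp_all only: Hk_ip_point[OF assms, symmetric] tk_add Hk.ip_add2 tk_in)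

text \<open>The values are antilinear in each argument, because f (x, y) is the inner product of f
  with \<open>tk (x, y)\<close>, whose second slot is antilinear.\<close>

lemma fun_scale:
  assumes "f \<in> carrier Hk"
  shows "x \<in> carrier H1 \<Longrightarrow> f (c \<odot>\<^bsub>H1\<^esub> x, y) = cnj c * f (x, y)"
    "y \<in> carrier H2 \<Longrightarrow> f (x, c \<odot>\<^bsub>H2\<^esub> y) = cnj c * f (x, y)"
  using assms by (simp_all only: Hk_ip_point[OF assms, symmetric] tk_scale Hk.ip_scale2 tk_in)

lemma fun_zero:
  assumes "f \<in> carrier Hk"
  shows "f (\<zero>\<^bsub>H1\<^esub>, y) = 0" "f (x, \<zero>\<^bsub>H2\<^esub>) = 0"
  using Hk.ip_zero2[OF assms] by (simp_all only: Hk_ip_point[OF assms, symmetric] tk_zero)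

lemma fun_finsum:
  assumes "f \<in> carrier Hk" "finite A"
  shows "(\<And>a. a \<in> A \<Longrightarrow> X a \<in> carrier H1) \<Longrightarrow> f (finsum H1 X A, y) = (\<Sum>a\<in>A. f (X a, y))"
    and "(\<And>a. a \<in> A \<Longrightarrow> Y a \<in> carrier H2) \<Longrightarrow> f (x, finsum H2 Y A) = (\<Sum>a\<in>A. f (x, Y a))"
proof -
  show "(\<And>a. a \<in> A \<Longrightarrow> X a \<in> carrier H1) \<Longrightarrow> f (finsum H1 X A, y) = (\<Sum>a\<in>A. f (X a, y))"
    using assms(2)
  proof (induction A)
    case (insert a A)
    have "finsum H1 X (insert a A) = X a \<oplus>\<^bsub>H1\<^esub> finsum H1 X A" "finsum H1 X A \<in> carrier H1"
      using insert by (auto intro!: H1.M.finsum_insert H1.M.finsum_closed)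
    thus ?case using insert by (simp add: fun_add(1)[OF assms(1)])
  qed (simp add: fun_zero[OF assms(1)])
  show "(\<And>a. a \<in> A \<Longrightarrow> Y a \<in> carrier H2) \<Longrightarrow> f (x, finsum H2 Y A) = (\<Sum>a\<in>A. f (x, Y a))"
    using assms(2)
  proof (induction A)
    case (insert a A)
    have "finsum H2 Y (insert a A) = Y a \<oplus>\<^bsub>H2\<^esub> finsum H2 Y A" "finsum H2 Y A \<in> carrier H2"
      using insert by (auto intro!: H2.M.finsum_insert H2.M.finsum_closed)
    thus ?case using insert by (simp add: fun_add(2)[OF assms(1)])
  qed (simp add: fun_zero[OF assms(1)])
qed

lemma tk_eval:
  "x \<in> carrier H1 \<Longrightarrow> y \<in> carrier H2 \<Longrightarrow> x' \<in> carrier H1 \<Longrightarrow> y' \<in> carrier H2 \<Longrightarrow>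
    tk (x, y) (x', y') = ip H1 x x' * ip H2 y y'"
  by (simp add: tk_def)

text \<open>\<open>tsum A B\<close> is the sum over \<open>c\<close> of the tensor products of \<open>A c\<close> and \<open>B c\<close>.\<close>

definition pair_op :: "('a \<Rightarrow> 'a) \<Rightarrow> ('b \<Rightarrow> 'b) \<Rightarrow> 'a \<times> 'b \<Rightarrow> 'a \<times> 'b" where
  "pair_op A B p = (A (H1.cl (fst p)), B (H2.cl (snd p)))"

definition tsum :: "('c::finite \<Rightarrow> 'a \<Rightarrow> 'a) \<Rightarrow> ('c \<Rightarrow> 'b \<Rightarrow> 'b) \<Rightarrow> ('a \<times> 'b \<Rightarrow> complex) \<Rightarrow> 'a \<times> 'b \<Rightarrow> complex" where
  "tsum A B f p = (\<Sum>c\<in>UNIV. f (pair_op (A c) (B c) p))"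

text \<open>Self-adjointness of A and B supplies the adjointness condition of
  \<open>positive_operator_comp\<close>; the kernel expressing positivity of the tensor product is
  the pointwise product of those for A and B.\<close>

lemma positive_pair_op:
  assumes A: "positive_operator H1 A" and B: "positive_operator H2 B"
  shows "positive_operator Hk (\<lambda>f. f \<circ> pair_op A B)"
proof -
  note bA = positive_operator_bounded[OF A] and bB = positive_operator_bounded[OF B]
  have cl: "H1.cl (A (H1.cl x)) = A (H1.cl x)" "H2.cl (B (H2.cl y)) = B (H2.cl y)" for x y
    using positive_operator_in[OF A] positive_operator_in[OF B] by simp_all
  obtain C where C: "C \<in> \<real>\<^sub>\<ge>\<^sub>0" "psd (\<lambda>x y. C * ip H1 (H1.cl x) (H1.cl y) - ip H1 (A (H1.cl x)) (A (H1.cl y)))"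
    using H1.psd_operator_bound[OF bA] by blast
  obtain D where D: "D \<in> \<real>\<^sub>\<ge>\<^sub>0" "psd (\<lambda>x y. D * ip H2 (H2.cl x) (H2.cl y) - ip H2 (B (H2.cl x)) (B (H2.cl y)))"
    using H2.psd_operator_bound[OF bB] by blast
  show ?thesis
  proof (rule positive_operator_comp)
    show "tk (pair_op A B p) q = tk p (pair_op A B q)" for p q
      using H1.positive_selfadjoint[OF A] H2.positive_selfadjoint[OF B] by (simp add: tk_def pair_op_def cl)
    show "C * D \<in> \<real>\<^sub>\<ge>\<^sub>0" using C D by (simp add: nonneg_Reals_mult_I)
    have "psd (\<lambda>p q. ip H1 (A (H1.cl (fst p))) (H1.cl (fst q)) * ip H2 (B (H2.cl (snd p))) (H2.cl (snd q)))"
      by (rule psd_Schur[OF psd_pullback[OF H1.psd_positive_operator[OF A], of fst]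
            psd_pullback[OF H2.psd_positive_operator[OF B], of snd]])
    thus "psd (\<lambda>p q. tk (pair_op A B p) q)"
      by (simp add: tk_def pair_op_def cl)
    let ?g1 = "\<lambda>x y. ip H1 (H1.cl x) (H1.cl y)" and ?g2 = "\<lambda>x y. ip H2 (H2.cl x) (H2.cl y)"
    let ?t1 = "\<lambda>x y. ip H1 (A (H1.cl x)) (A (H1.cl y))" and ?t2 = "\<lambda>x y. ip H2 (B (H2.cl x)) (B (H2.cl y))"
    \<comment> \<open>The bound C D g1 g2 - t1 t2 is not itself a product of semidefinite kernels,
      but it equals (C g1 - t1) D g2 + t1 (D g2 - t2), a sum of two such products.\<close>
    have "psd (\<lambda>p q. (C * ?g1 (fst p) (fst q) - ?t1 (fst p) (fst q)) * (D * ?g2 (snd p) (snd q))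
        + ?t1 (fst p) (fst q) * (D * ?g2 (snd p) (snd q) - ?t2 (snd p) (snd q)))"
      by (rule psd_add[OF
            psd_Schur[OF psd_pullback[OF C(2), of fst] psd_pullback[OF psd_scale[OF D(1) H2.psd_ip], of snd]]
            psd_Schur[OF psd_pullback[OF H1.psd_operator_square[OF bA], of fst] psd_pullback[OF D(2), of snd]]])
    moreover have "(C * ?g1 (fst p) (fst q) - ?t1 (fst p) (fst q)) * (D * ?g2 (snd p) (snd q))
        + ?t1 (fst p) (fst q) * (D * ?g2 (snd p) (snd q) - ?t2 (snd p) (snd q))
      = C * D * tk p q - tk (pair_op A B p) (pair_op A B q)" for p q
      by (simp add: tk_def pair_op_def cl algebra_simps)
    ultimately show "psd (\<lambda>p q. C * D * tk p q - tk (pair_op A B p) (pair_op A B q))" by (simp only:)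
  qed
qed

lemma positive_tsum:
  fixes A :: "'c::finite \<Rightarrow> 'a \<Rightarrow> 'a"
  assumes "\<And>c. positive_operator H1 (A c)" "\<And>c. positive_operator H2 (B c)"
  shows "positive_operator Hk (tsum A B)"
proof (rule Hk.positive_operator_cong)
  have pos: "positive_operator Hk (\<lambda>f. f \<circ> pair_op (A c) (B c))" for c
    using assms by (rule positive_pair_op)
  show "positive_operator Hk (\<lambda>f. finsum Hk (\<lambda>c. f \<circ> pair_op (A c) (B c)) UNIV)"
    using pos by (intro Hk.positive_operator_finsum) auto
  fix f assume "f \<in> carrier Hk"
  hence "finsum Hk (\<lambda>c. f \<circ> pair_op (A c) (B c)) UNIV = (\<lambda>p. \<Sum>c\<in>UNIV. (f \<circ> pair_op (A c) (B c)) p)"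
    using positive_operator_in[OF pos] by (intro Hk_finsum) auto
  thus "tsum A B f = finsum Hk (\<lambda>c. f \<circ> pair_op (A c) (B c)) UNIV"
    by (simp add: tsum_def fun_eq_iff)
qed

text \<open>The outcome c of e on the second factor selects the POVM \<open>E c\<close> on the
  first. Summing over a gives the identity on the first factor for each c; summing over c then gives
  it on the second. Additivity of f in each argument moves both sums inside.\<close>

lemma povm_tsum_left:
  fixes E :: "'c::finite \<Rightarrow> 'd::finite \<Rightarrow> 'a \<Rightarrow> 'a"
  assumes E: "\<And>c. povm H1 (E c)" and e: "povm H2 e"
  shows "povm Hk (\<lambda>a. tsum (\<lambda>c. E c a) e)"
  unfolding povm_def
proof (intro conjI allI ballI)
  have pos: "positive_operator Hk (tsum (\<lambda>c. E c a) e)" for a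
    by (intro positive_tsum povm_positive[OF E] povm_positive[OF e])
  thus "positive_operator Hk (tsum (\<lambda>c. E c a) e)" for a .
  fix f assume f: "f \<in> carrier Hk"
  have "finsum Hk (\<lambda>a. tsum (\<lambda>c. E c a) e f) UNIV = (\<lambda>p. \<Sum>a\<in>UNIV. tsum (\<lambda>c. E c a) e f p)"
    using positive_operator_in[OF pos f] by (intro Hk_finsum) auto
  also have "\<dots> = f"
  proof
    fix p
    let ?x = "H1.cl (fst p)" and ?y = "H2.cl (snd p)"
    have "(\<Sum>a\<in>UNIV. tsum (\<lambda>c. E c a) e f p) = (\<Sum>c\<in>UNIV. \<Sum>a\<in>UNIV. f (E c a ?x, e c ?y))"
      unfolding tsum_def pair_op_def by (rule sum.swap)
    also have "\<dots> = (\<Sum>c\<in>UNIV. f (finsum H1 (\<lambda>a. E c a ?x) UNIV, e c ?y))"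
      by (simp add: fun_finsum(1)[OF f] positive_operator_in[OF povm_positive[OF E]])
    also have "\<dots> = f (?x, finsum H2 (\<lambda>c. e c ?y) UNIV)"
      by (simp add: fun_finsum(2)[OF f] positive_operator_in[OF povm_positive[OF e]] povm_finsum[OF E])
    also have "\<dots> = f p" using fun_cl[OF f, of "fst p" "snd p"] by (simp add: povm_finsum[OF e])
    finally show "(\<Sum>a\<in>UNIV. tsum (\<lambda>c. E c a) e f p) = f p" .
  qed
  finally show "finsum Hk (\<lambda>a. tsum (\<lambda>c. E c a) e f) UNIV = f" .
qed

lemma povm_tsum_right:
  fixes E :: "'c::finite \<Rightarrow> 'd::finite \<Rightarrow> 'b \<Rightarrow> 'b"
  assumes e: "povm H1 e" and E: "\<And>c. povm H2 (E c)"
  shows "povm Hk (\<lambda>a. tsum e (\<lambda>c. E c a))"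
  unfolding povm_def
proof (intro conjI allI ballI)
  have pos: "positive_operator Hk (tsum e (\<lambda>c. E c a))" for a
    by (intro positive_tsum povm_positive[OF E] povm_positive[OF e])
  thus "positive_operator Hk (tsum e (\<lambda>c. E c a))" for a .
  fix f assume f: "f \<in> carrier Hk"
  have "finsum Hk (\<lambda>a. tsum e (\<lambda>c. E c a) f) UNIV = (\<lambda>p. \<Sum>a\<in>UNIV. tsum e (\<lambda>c. E c a) f p)"
    using positive_operator_in[OF pos f] by (intro Hk_finsum) auto
  also have "\<dots> = f"
  proof
    fix p
    let ?x = "H1.cl (fst p)" and ?y = "H2.cl (snd p)"
    have "(\<Sum>a\<in>UNIV. tsum e (\<lambda>c. E c a) f p) = (\<Sum>c\<in>UNIV. \<Sum>a\<in>UNIV. f (e c ?x, E c a ?y))"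
      unfolding tsum_def pair_op_def by (rule sum.swap)
    also have "\<dots> = (\<Sum>c\<in>UNIV. f (e c ?x, finsum H2 (\<lambda>a. E c a ?y) UNIV))"
      by (simp add: fun_finsum(2)[OF f] positive_operator_in[OF povm_positive[OF E]])
    also have "\<dots> = f (finsum H1 (\<lambda>c. e c ?x) UNIV, ?y)"
      by (simp add: fun_finsum(1)[OF f] positive_operator_in[OF povm_positive[OF e]] povm_finsum[OF E])
    also have "\<dots> = f p" using fun_cl[OF f, of "fst p" "snd p"] by (simp add: povm_finsum[OF e])
    finally show "(\<Sum>a\<in>UNIV. tsum e (\<lambda>c. E c a) f p) = f p" .
  qed
  finally show "finsum Hk (\<lambda>a. tsum e (\<lambda>c. E c a) f) UNIV = f" .
qed

text \<open>Composition of functions reverses the order: the operators of the outer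
  \<open>tsum\<close> are the first to act on the point.\<close>

lemma tsum_tsum:
  assumes "\<And>c x. x \<in> carrier H1 \<Longrightarrow> A c x \<in> carrier H1" "\<And>c x. x \<in> carrier H2 \<Longrightarrow> B c x \<in> carrier H2"
  shows "tsum A B (tsum A' B' f) p =
    (\<Sum>c\<in>UNIV. \<Sum>d\<in>UNIV. f (A' d (A c (H1.cl (fst p))), B' d (B c (H2.cl (snd p)))))"
  using assms by (simp add: tsum_def pair_op_def)

lemma tsum_commute:
  fixes A :: "'c::finite \<Rightarrow> 'a \<Rightarrow> 'a" and A' :: "'d::finite \<Rightarrow> 'a \<Rightarrow> 'a"
  assumes "\<And>c x. x \<in> carrier H1 \<Longrightarrow> A c x \<in> carrier H1" "\<And>c x. x \<in> carrier H2 \<Longrightarrow> B c x \<in> carrier H2"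
    and "\<And>c x. x \<in> carrier H1 \<Longrightarrow> A' c x \<in> carrier H1" "\<And>c x. x \<in> carrier H2 \<Longrightarrow> B' c x \<in> carrier H2"
    and "\<And>c d x. x \<in> carrier H1 \<Longrightarrow> A c (A' d x) = A' d (A c x)"
    and "\<And>c d x. x \<in> carrier H2 \<Longrightarrow> B c (B' d x) = B' d (B c x)"
  shows "tsum A B (tsum A' B' f) = tsum A' B' (tsum A B f)"
proof
  fix p
  have "tsum A B (tsum A' B' f) p =
      (\<Sum>c\<in>UNIV. \<Sum>d\<in>UNIV. f (A' d (A c (H1.cl (fst p))), B' d (B c (H2.cl (snd p)))))"
    using assms(1,2) by (rule tsum_tsum)
  also have "\<dots> = (\<Sum>d\<in>UNIV. \<Sum>c\<in>UNIV. f (A' d (A c (H1.cl (fst p))), B' d (B c (H2.cl (snd p)))))"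
    by (rule sum.swap)
  also have "\<dots> = (\<Sum>d\<in>UNIV. \<Sum>c\<in>UNIV. f (A c (A' d (H1.cl (fst p))), B c (B' d (H2.cl (snd p)))))"
    by (simp add: assms(5,6))
  also have "\<dots> = tsum A' B' (tsum A B f) p"
    using assms(3,4) by (rule tsum_tsum[symmetric])
  finally show "tsum A B (tsum A' B' f) p = tsum A' B' (tsum A B f) p" .
qed

lemma tsum_tk:
  assumes A: "\<And>c. positive_operator H1 (A c)" and B: "\<And>c. positive_operator H2 (B c)"
    and x: "x \<in> carrier H1" "y \<in> carrier H2" "x' \<in> carrier H1" "y' \<in> carrier H2"
  shows "tsum A B (tk (x, y)) (x', y') = (\<Sum>c\<in>UNIV. ip H1 (A c x) x' * ip H2 (B c y) y')"
  using x positive_operator_in[OF A] positive_operator_in[OF B]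
    H1.positive_selfadjoint[OF A x(1,3)] H2.positive_selfadjoint[OF B x(2,4)]
  by (simp add: tsum_def pair_op_def tk_eval)

text \<open>The inner product is a value at (x, y) by the reproducing property. Self-adjointness
  then moves the operators from the point to the vector, which restores their order.\<close>

lemma tsum_tsum_tk:
  assumes A: "\<And>c. positive_operator H1 (A c)" and B: "\<And>c. positive_operator H2 (B c)"
    and A': "\<And>c. positive_operator H1 (A' c)" and B': "\<And>c. positive_operator H2 (B' c)"
    and x: "x \<in> carrier H1" "y \<in> carrier H2"
  shows "ip Hk (tsum A B (tsum A' B' (tk (x, y)))) (tk (x, y)) =
    (\<Sum>c\<in>UNIV. \<Sum>d\<in>UNIV. ip H1 (A c (A' d x)) x * ip H2 (B c (B' d y)) y)"
proof -
  note ins = positive_operator_in[OF A] positive_operator_in[OF B]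
    positive_operator_in[OF A'] positive_operator_in[OF B']
  have "positive_operator Hk (tsum A B)" "positive_operator Hk (tsum A' B')"
    using A B A' B' by (auto intro: positive_tsum)
  hence "tsum A B (tsum A' B' (tk (x, y))) \<in> carrier Hk"
    by (intro positive_operator_in[of Hk "tsum A B"] positive_operator_in[of Hk "tsum A' B'"] tk_in)
  hence "ip Hk (tsum A B (tsum A' B' (tk (x, y)))) (tk (x, y)) = tsum A B (tsum A' B' (tk (x, y))) (x, y)"
    by (rule Hk_ip_point)
  also have "\<dots> = (\<Sum>c\<in>UNIV. \<Sum>d\<in>UNIV. ip H1 (A c (A' d x)) x * ip H2 (B c (B' d y)) y)"
    using ins x by (simp add: tsum_tsum tk_eval H1.positive_selfadjoint[OF A] H2.positive_selfadjoint[OF B]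
        H1.positive_selfadjoint[OF A'] H2.positive_selfadjoint[OF B'])
  finally show ?thesis .
qed

text \<open>A function orthogonal to the products of the two spanning sets vanishes on B1 x B2;
  antilinearity in one argument at a time extends this to B1 x H2 and then to all points.
  \<open>finite_hspan_total\<close> concludes.\<close>

lemma tensor_finite_dim:
  assumes "finite_dim H1" "finite_dim H2"
  shows "finite_dim Hk" and "hspan Hk {tk (x, y) | x y. x \<in> carrier H1 \<and> y \<in> carrier H2} = carrier Hk"
proof -
  obtain B1 where B1: "finite B1" "B1 \<subseteq> carrier H1" "hspan H1 B1 = carrier H1"
    using assms by (auto simp: finite_dim_def)
  obtain B2 where B2: "finite B2" "B2 \<subseteq> carrier H2" "hspan H2 B2 = carrier H2"
    using assms by (auto simp: finite_dim_def)
  define B where "B = tk ` (B1 \<times> B2)"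
  have B: "finite B" "B \<subseteq> carrier Hk" using B1 B2 by (auto simp: B_def)
  have span: "hspan Hk B = carrier Hk"
  proof (rule Hk.finite_hspan_total[OF B])
    fix z assume z: "z \<in> carrier Hk" and o: "\<And>b. b \<in> B \<Longrightarrow> ip Hk z b = 0"
    have 0: "z (b1, b2) = 0" if "b1 \<in> B1" "b2 \<in> B2" for b1 b2
      using o[of "tk (b1, b2)"] Hk_ip_point[OF z, of "(b1, b2)"] that by (simp add: B_def)
    have 1: "z (b1, y) = 0" if "b1 \<in> B1" "y \<in> carrier H2" for b1 y
    proof -
      have "submodule {y \<in> carrier H2. z (b1, y) = 0} \<C> H2"
        by (rule H2.submoduleI') (auto simp: fun_add[OF z] fun_scale[OF z] fun_zero[OF z])
      thus ?thesis using hspanD[of y H2 B2] B2 that 0 by blast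
    qed
    have 2: "z (x, y) = 0" if "x \<in> carrier H1" "y \<in> carrier H2" for x y
    proof -
      have "submodule {x \<in> carrier H1. z (x, y) = 0} \<C> H1"
        by (rule H1.submoduleI') (auto simp: fun_add[OF z] fun_scale[OF z] fun_zero[OF z])
      thus ?thesis using hspanD[of x H1 B1] B1 that 1 by blast
    qed
    show "z = \<zero>\<^bsub>Hk\<^esub>"
    proof
      fix p show "z p = \<zero>\<^bsub>Hk\<^esub> p"
        using fun_cl[OF z, of "fst p" "snd p"] 2[of "H1.cl (fst p)" "H2.cl (snd p)"] by simp
    qed
  qed
  show "finite_dim Hk" using B span by (auto simp: finite_dim_def)
  let ?S = "{tk (x, y) | x y. x \<in> carrier H1 \<and> y \<in> carrier H2}"
  have "B \<subseteq> ?S" using B1(2) B2(2) unfolding B_def by blast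
  hence "carrier Hk \<subseteq> hspan Hk ?S" using Hk.hspan_mono[of B ?S] span by simp
  moreover have "hspan Hk ?S \<subseteq> carrier Hk" by (rule hspan_subset[OF Hk_pre]) auto
  ultimately show "hspan Hk ?S = carrier Hk" by (rule subset_antisym[rotated])
qed

lemma tensor_space_Hk:
  assumes "finite_dim H1" "finite_dim H2"
  shows "tensor_space H1 H2 Hk (\<lambda>x y. tk (x, y))"
  unfolding tensor_space_def
proof (intro conjI ballI allI)
  fix x x' y y' assume "x \<in> carrier H1" "x' \<in> carrier H1" "y \<in> carrier H2" "y' \<in> carrier H2"
  thus "ip Hk (tk (x, y)) (tk (x', y')) = ip H1 x x' * ip H2 y y'"
    by (simp add: Hk_ip_point tk_eval)
next
  show "hspan Hk {tk (x, y) |x y. x \<in> carrier H1 \<and> y \<in> carrier H2} = carrier Hk"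
    by (rule tensor_finite_dim(2)[OF assms])
qed (simp_all only: tk_in tk_add tk_scale)

end

section \<open>Quantum correlations\<close>

lemma qc_correlation_compose:
  fixes \<Gamma>\<^sub>1 :: "('v2::finite, 'w1::finite, 'v1::finite, 'w2::finite) corr"
    and \<Gamma>\<^sub>2 :: "('v3::finite, 'w2, 'v2, 'w3::finite) corr"
  assumes 1: "qc_correlation \<Gamma>\<^sub>1" and 2: "qc_correlation \<Gamma>\<^sub>2"
  shows "qc_correlation (\<Gamma>\<^sub>2 \<star> \<Gamma>\<^sub>1)"
proof -
  obtain H1 :: "universe hilbert" and \<xi>\<^sub>1 E1 F1 where m1: "qc_model H1 \<xi>\<^sub>1 E1 F1 \<Gamma>\<^sub>1"
    using 1 unfolding qc_correlation_def by blast
  obtain H2 :: "universe hilbert" and \<xi>\<^sub>2 E2 F2 where m2: "qc_model H2 \<xi>\<^sub>2 E2 F2 \<Gamma>\<^sub>2"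
    using 2 unfolding qc_correlation_def by blast
  have hil: "hilbert_space H1" "hilbert_space H2" using m1 m2 by (simp_all add: qc_model_def)
  interpret hilbert_tensor H1 H2 using hil by (rule hilbert_tensor.intro)
  have E1: "povm H1 (E1 v)" and F1: "povm H1 (F1 w)" and E2: "povm H2 (E2 v')" and F2: "povm H2 (F2 w')"
    for v w v' w' using m1 m2 by (simp_all add: qc_model_def)
  have com1: "E1 v2 v1 (F1 w1 w2 x) = F1 w1 w2 (E1 v2 v1 x)" if "x \<in> carrier H1" for v2 v1 w1 w2 x
    using m1 that unfolding qc_model_def by blast
  have com2: "E2 v3 v2 (F2 w2 w3 x) = F2 w2 w3 (E2 v3 v2 x)" if "x \<in> carrier H2" for v3 v2 w2 w3 x
    using m2 that unfolding qc_model_def by blast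
  have ent: "entry \<Gamma>\<^sub>1 (v1, w2) (v2, w1) = ip H1 (E1 v2 v1 (F1 w1 w2 \<xi>\<^sub>1)) \<xi>\<^sub>1"
    "entry \<Gamma>\<^sub>2 (v2, w3) (v3, w2) = ip H2 (E2 v3 v2 (F2 w2 w3 \<xi>\<^sub>2)) \<xi>\<^sub>2" for v1 v2 v3 w1 w2 w3
    using m1 m2 by (simp_all add: qc_model_def)
  have \<xi>c: "\<xi>\<^sub>1 \<in> carrier H1" "\<xi>\<^sub>2 \<in> carrier H2" "hnorm H1 \<xi>\<^sub>1 = 1" "hnorm H2 \<xi>\<^sub>2 = 1"
    using m1 m2 by (simp_all add: qc_model_def)
  note \<xi> = \<xi>c(1,2) \<xi>c(3)[unfolded H1.hnorm_eq_1[OF \<xi>c(1)]] \<xi>c(4)[unfolded H2.hnorm_eq_1[OF \<xi>c(2)]]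
  note pos = povm_positive[OF E1] povm_positive[OF E2] povm_positive[OF F1] povm_positive[OF F2]
  \<comment> \<open>On the V side the outcome v2 of \<open>E2 v3\<close> is the setting of
    \<open>E1\<close>; on the W side the outcome w2 of \<open>F1 w1\<close> is the setting of
    \<open>F2\<close>. So the selecting POVM sits on the second factor for E and on the first for
    F.\<close>
  define E where "E v3 v1 = tsum (\<lambda>v2. E1 v2 v1) (E2 v3)" for v3 v1
  define F where "F w1 w3 = tsum (F1 w1) (\<lambda>w2. F2 w2 w3)" for w1 w3
  have "qc_model Hk (tk (\<xi>\<^sub>1, \<xi>\<^sub>2)) E F (\<Gamma>\<^sub>2 \<star> \<Gamma>\<^sub>1)"
    unfolding qc_model_def
  proof (intro conjI allI ballI)
    show "hnorm Hk (tk (\<xi>\<^sub>1, \<xi>\<^sub>2)) = 1"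
      using \<xi> by (simp add: Hk.hnorm_eq_1 Hk_ip_point tk_eval)
    show "povm Hk (E v3)" for v3 unfolding E_def by (rule povm_tsum_left[OF E1 E2])
    show "povm Hk (F w1)" for w1 unfolding F_def by (rule povm_tsum_right[OF F1 F2])
    show "E v3 v1 (F w1 w3 f) = F w1 w3 (E v3 v1 f)" for v3 v1 w1 w3 f
      unfolding E_def F_def by (rule tsum_commute) (simp_all add: positive_operator_in pos com1 com2)
    show "entry (\<Gamma>\<^sub>2 \<star> \<Gamma>\<^sub>1) (v1, w3) (v3, w1) = ip Hk (E v3 v1 (F w1 w3 (tk (\<xi>\<^sub>1, \<xi>\<^sub>2)))) (tk (\<xi>\<^sub>1, \<xi>\<^sub>2))"
      for v1 w3 v3 w1
      unfolding E_def F_def entry_compose_corr ent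
      by (rule tsum_tsum_tk[symmetric]) (simp_all add: pos \<xi>)
  qed (simp_all add: Hk_hilbert)
  moreover have "ns_correlation (\<Gamma>\<^sub>2 \<star> \<Gamma>\<^sub>1)"
    using 1 2 by (intro ns_correlation_compose) (simp_all add: qc_correlation_def)
  \<comment> \<open>The model lives on complex functions on pairs from \<open>universe\<close>;
    \<open>qc_correlationI\<close> brings it back to \<open>universe\<close>.\<close>
  ultimately show ?thesis by (rule qc_correlationI[rotated])
qed

lemma (in hilbert_tensor) tk_pair_op:
  assumes A: "positive_operator H1 A" and B: "positive_operator H2 B" and "x \<in> carrier H1" "y \<in> carrier H2"
  shows "tk (x, y) \<circ> pair_op A B = tk (A x, B y)"
  using assms(3,4) positive_operator_in[OF A] positive_operator_in[OF B]
    H1.positive_selfadjoint[OF A] H2.positive_selfadjoint[OF B]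
  by (simp add: fun_eq_iff tk_def pair_op_def)

text \<open>The identity is a POVM with one outcome. Indexing \<open>tsum\<close> by
  \<open>unit\<close> therefore yields the operators of the form E (x) I and I (x) F, and the
  results on sums of tensor products give that they are commuting POVMs.\<close>

lemma (in hilbert_tensor) q_correlation_tensorI:
  fixes \<Gamma> :: "('v2::finite, 'w1::finite, 'v1::finite, 'w2::finite) corr"
  assumes ns: "ns_correlation \<Gamma>" and fin: "finite_dim H1" "finite_dim H2"
    and E: "\<And>v2. povm H1 (E v2)" and F: "\<And>w1. povm H2 (F w1)"
    and \<xi>: "\<xi> \<in> carrier Hk" "ip Hk \<xi> \<xi> = 1"
    and ent: "\<And>v1 w2 v2 w1. entry \<Gamma> (v1, w2) (v2, w1) = ip Hk (\<xi> \<circ> pair_op (E v2 v1) (F w1 w2)) \<xi>"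
  shows "q_correlation \<Gamma>"
proof -
  have id: "povm H1 (\<lambda>_::unit. id)" "povm H2 (\<lambda>_::unit. id)"
    using H1.positive_id H2.positive_id by (simp_all add: povm_def UNIV_unit)
  note pos = povm_positive[OF E] povm_positive[OF F] H1.positive_id H2.positive_id
  define E' where "E' v2 v1 = tsum (\<lambda>_::unit. E v2 v1) (\<lambda>_. id)" for v2 v1
  define F' where "F' w1 w2 = tsum (\<lambda>_::unit. id) (\<lambda>_. F w1 w2)" for w1 w2
  have E'F': "E' v2 v1 (F' w1 w2 f) = f \<circ> pair_op (E v2 v1) (F w1 w2)" for v2 v1 w1 w2 f
  proof
    fix p show "E' v2 v1 (F' w1 w2 f) p = (f \<circ> pair_op (E v2 v1) (F w1 w2)) p"
      unfolding E'_def F'_def by (subst tsum_tsum) (simp_all add: positive_operator_in pos UNIV_unit pair_op_def)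
  qed
  have "qc_model Hk \<xi> E' F' \<Gamma>"
    unfolding qc_model_def
  proof (intro conjI allI ballI)
    show "povm Hk (E' v2)" for v2 unfolding E'_def by (rule povm_tsum_left[OF E id(2)])
    show "povm Hk (F' w1)" for w1 unfolding F'_def by (rule povm_tsum_right[OF id(1) F])
    show "E' v2 v1 (F' w1 w2 f) = F' w1 w2 (E' v2 v1 f)" for v2 v1 w1 w2 f
      unfolding E'_def F'_def by (rule tsum_commute) (simp_all add: positive_operator_in pos)
  qed (simp_all add: Hk_hilbert \<xi> Hk.hnorm_eq_1 ent E'F')
  moreover have "E' v2 v1 (tk (x, y)) = tk (E v2 v1 x, y)" "F' w1 w2 (tk (x, y)) = tk (x, F w1 w2 y)"
    if "x \<in> carrier H1" "y \<in> carrier H2" for v2 v1 w1 w2 x y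
    using tk_pair_op[OF pos(1) pos(4) that, of v2 v1] tk_pair_op[OF pos(3) pos(2) that, of w1 w2]
    by (simp_all add: E'_def F'_def tsum_def fun_eq_iff UNIV_unit)
  ultimately have "q_model H1 H2 Hk (\<lambda>x y. tk (x, y)) \<xi> E F E' F' \<Gamma>"
    unfolding q_model_def
    by (simp add: fin tensor_space_Hk H1.hilbert_space_axioms H2.hilbert_space_axioms positive_operator_bounded pos)
  thus ?thesis by (rule q_correlationI[OF ns])
qed

section \<open>From a quantum model to POVMs and simple tensors on its factors\<close>

lemma tensor_space_flip:
  assumes "tensor_space HV HW H \<tau>" shows "tensor_space HW HV H (\<lambda>y x. \<tau> x y)"
proof -
  have "{\<tau> y x | x y. x \<in> carrier HW \<and> y \<in> carrier HV} = {\<tau> x y | x y. x \<in> carrier HV \<and> y \<in> carrier HW}"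
    by blast
  thus ?thesis using assms unfolding tensor_space_def by (simp add: mult.commute)
qed

text \<open>A quantum model provides the \<open>E'\<close> only as bounded operators. On vectors
  \<open>\<tau> x y\<close> with fixed y the inner products of H are those of HV times <y, y>, so
  positivity and the sum to the identity descend from E after division by <y, y> > 0.\<close>

lemma tensor_povm:
  assumes hil: "hilbert_space HV" "hilbert_space HW" "hilbert_space H"
    and ten: "tensor_space HV HW H \<tau>" and E: "povm H E" and bd: "\<And>a. bounded_operator HV (E' a)"
    and eq: "\<And>a x y. x \<in> carrier HV \<Longrightarrow> y \<in> carrier HW \<Longrightarrow> E a (\<tau> x y) = \<tau> (E' a x) y"
    and y: "y \<in> carrier HW" "ip HW y y \<noteq> 0"
  shows "povm HV E'"
proof -
  interpret HV: hilbert_space HV by fact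
  interpret HW: hilbert_space HW by fact
  interpret H: hilbert_space H by fact
  have \<tau>: "\<tau> x y \<in> carrier H" if "x \<in> carrier HV" for x
    using ten y that by (simp add: tensor_space_def)
  have \<tau>_ip: "ip H (\<tau> x y) (\<tau> u y) = ip HV x u * ip HW y y" if "x \<in> carrier HV" "u \<in> carrier HV" for x u
    using ten y that by (simp add: tensor_space_def)
  note D = bounded_operatorD(1)[OF bd]
  have yy: "Im (ip HW y y) = 0" "Re (ip HW y y) > 0"
    using HW.ip_nonneg[OF y(1)] y(2) by (auto simp: nonneg_Reals_iff complex_eq_iff)
  have "ip HV (E' a x) x \<in> \<real>\<^sub>\<ge>\<^sub>0" if x: "x \<in> carrier HV" for a x
  proof -
    have "ip HV (E' a x) x * ip HW y y = ip H (E a (\<tau> x y)) (\<tau> x y)"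
      using x D y by (simp add: eq \<tau>_ip)
    also have "\<dots> \<in> \<real>\<^sub>\<ge>\<^sub>0" using povm_positive[OF E] \<tau>[OF x] by (simp add: positive_operator_def)
    finally show ?thesis using yy by (simp add: nonneg_Reals_iff zero_le_mult_iff)
  qed
  moreover have "finsum HV (\<lambda>a. E' a x) UNIV = x" if x: "x \<in> carrier HV" for x
  proof (rule HV.ip_eqI)
    show "finsum HV (\<lambda>a. E' a x) UNIV \<in> carrier HV" using x D by (intro HV.M.finsum_closed) auto
    fix u assume u: "u \<in> carrier HV"
    have "ip HV (finsum HV (\<lambda>a. E' a x) UNIV) u * ip HW y y = (\<Sum>a\<in>UNIV. ip HV (E' a x) u * ip HW y y)"
      using x u D by (simp add: HV.ip_finsum sum_distrib_right)
    also have "\<dots> = (\<Sum>a\<in>UNIV. ip H (E a (\<tau> x y)) (\<tau> u y))"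
      using x u y D by (simp add: eq \<tau>_ip)
    also have "\<dots> = ip H (finsum H (\<lambda>a. E a (\<tau> x y)) UNIV) (\<tau> u y)"
      using positive_operator_in[OF povm_positive[OF E]] \<tau> x u by (simp add: H.ip_finsum)
    also have "\<dots> = ip HV x u * ip HW y y"
      using \<tau> x u by (simp add: povm_finsum[OF E] \<tau>_ip)
    finally show "ip HV (finsum HV (\<lambda>a. E' a x) UNIV) u = ip HV x u" using y(2) by simp
  qed fact
  ultimately show ?thesis using bd by (simp add: povm_def positive_operator_def)
qed

text \<open>Supplies the fixed vectors for \<open>tensor_povm\<close>. A unit vector cannot be
  orthogonal to all simple tensors, so some simple tensor is nonzero, and its squared norm is the
  product of those of its two components.\<close>

lemma tensor_space_nonzero:
  assumes hil: "hilbert_space HV" "hilbert_space HW" "hilbert_space H"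
    and ten: "tensor_space HV HW H \<tau>" and \<xi>: "\<xi> \<in> carrier H" "hnorm H \<xi> = 1"
  obtains x y where "x \<in> carrier HV" "y \<in> carrier HW" "ip HV x x \<noteq> 0" "ip HW y y \<noteq> 0"
proof -
  interpret HV: hilbert_space HV by fact
  interpret HW: hilbert_space HW by fact
  interpret H: hilbert_space H by fact
  define S where "S = {\<tau> x y | x y. x \<in> carrier HV \<and> y \<in> carrier HW}"
  have S: "hspan H S = carrier H" "S \<subseteq> carrier H" using ten by (auto simp: tensor_space_def S_def)
  have "\<xi> \<noteq> \<zero>\<^bsub>H\<^esub>" using \<xi> H.hnorm_zero by auto
  hence "\<not> (\<forall>s\<in>S. ip H \<xi> s = 0)" using H.span_orth[OF S \<xi>(1)] by blast
  then obtain x y where xy: "x \<in> carrier HV" "y \<in> carrier HW" "ip H \<xi> (\<tau> x y) \<noteq> 0" by (auto simp: S_def)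
  have "\<tau> x y \<in> carrier H" using S xy by (auto simp: S_def)
  moreover have "\<tau> x y \<noteq> \<zero>\<^bsub>H\<^esub>" using xy H.ip_zero2[OF \<xi>(1)] by auto
  ultimately have "ip H (\<tau> x y) (\<tau> x y) \<noteq> 0" using H.ip_definite by blast
  thus ?thesis using that[of x y] xy ten by (simp add: tensor_space_def)
qed

text \<open>Finite sums of simple tensors form a submodule containing the simple tensors, hence are
  everything. The sum is expressed through its inner products under all bounded T, the form in which
  it is used, with complex sums in place of sums in H.\<close>

lemma tensor_space_expansion:
  assumes hil: "hilbert_space HV" "hilbert_space HW" "hilbert_space H"
    and ten: "tensor_space HV HW H \<tau>" and \<xi>: "\<xi> \<in> carrier H"
  obtains n :: nat and a b where "\<And>i. i < n \<Longrightarrow> a i \<in> carrier HV" "\<And>i. i < n \<Longrightarrow> b i \<in> carrier HW"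
    "\<And>T u. bounded_operator H T \<Longrightarrow> u \<in> carrier H \<Longrightarrow> ip H (T \<xi>) u = (\<Sum>i<n. ip H (T (\<tau> (a i) (b i))) u)"
proof -
  interpret HV: hilbert_space HV by fact
  interpret HW: hilbert_space HW by fact
  interpret H: hilbert_space H by fact
  have \<tau>: "\<tau> x y \<in> carrier H" "\<tau> (c \<odot>\<^bsub>HV\<^esub> x) y = c \<odot>\<^bsub>H\<^esub> \<tau> x y" if "x \<in> carrier HV" "y \<in> carrier HW" for x y c
    using ten that by (simp_all add: tensor_space_def)
  define good where "good l x \<longleftrightarrow> set l \<subseteq> carrier HV \<times> carrier HW \<and>
    (\<forall>T u. bounded_operator H T \<longrightarrow> u \<in> carrier H \<longrightarrow> ip H (T x) u = (\<Sum>p\<leftarrow>l. ip H (T (\<tau> (fst p) (snd p))) u))" for l x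
  have "submodule {x \<in> carrier H. \<exists>l. good l x} \<C> H"
  proof (rule H.submoduleI')
    have "good [] \<zero>\<^bsub>H\<^esub>"
      by (simp add: good_def H.bounded_operator_zero H.ip_zero)
    thus "\<zero>\<^bsub>H\<^esub> \<in> {x \<in> carrier H. \<exists>l. good l x}" by blast
  next
    fix x x' assume "x \<in> {x \<in> carrier H. \<exists>l. good l x}" "x' \<in> {x \<in> carrier H. \<exists>l. good l x}"
    then obtain l l' where "good l x" "good l' x'" and x: "x \<in> carrier H" "x' \<in> carrier H" by blast
    hence "good (l @ l') (x \<oplus>\<^bsub>H\<^esub> x')"
      by (simp add: good_def bounded_operatorD H.ip_add)
    thus "x \<oplus>\<^bsub>H\<^esub> x' \<in> {x \<in> carrier H. \<exists>l. good l x}" using x by auto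
  next
    fix c x assume "x \<in> {x \<in> carrier H. \<exists>l. good l x}"
    then obtain l where l: "good l x" and x: "x \<in> carrier H" by blast
    \<comment> \<open>A scalar is absorbed into the first component of every simple tensor.\<close>
    have "good (map (map_prod (\<lambda>z. c \<odot>\<^bsub>HV\<^esub> z) id) l) (c \<odot>\<^bsub>H\<^esub> x)"
      unfolding good_def
    proof (intro conjI allI impI)
      show "set (map (map_prod (\<lambda>z. c \<odot>\<^bsub>HV\<^esub> z) id) l) \<subseteq> carrier HV \<times> carrier HW"
        using l by (auto simp: good_def)
      fix T u assume T: "bounded_operator H T" and u: "u \<in> carrier H"
      have "ip H (T (\<tau> (c \<odot>\<^bsub>HV\<^esub> fst p) (snd p))) u = c * ip H (T (\<tau> (fst p) (snd p))) u" if "p \<in> set l" for p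
      proof -
        have p: "fst p \<in> carrier HV" "snd p \<in> carrier HW" using l that by (auto simp: good_def)
        show ?thesis using p \<tau>(1)[OF p] u by (simp add: \<tau>(2) bounded_operatorD[OF T] H.ip_scale)
      qed
      hence "(\<Sum>p\<leftarrow>map (map_prod (\<lambda>z. c \<odot>\<^bsub>HV\<^esub> z) id) l. ip H (T (\<tau> (fst p) (snd p))) u)
          = c * (\<Sum>p\<leftarrow>l. ip H (T (\<tau> (fst p) (snd p))) u)"
        by (simp add: comp_def sum_list_const_mult[symmetric] cong: map_cong)
      thus "ip H (T (c \<odot>\<^bsub>H\<^esub> x)) u = (\<Sum>p\<leftarrow>map (map_prod (\<lambda>z. c \<odot>\<^bsub>HV\<^esub> z) id) l. ip H (T (\<tau> (fst p) (snd p))) u)"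
        using l T u x by (simp add: good_def bounded_operatorD[OF T] H.ip_scale)
    qed
    thus "c \<odot>\<^bsub>H\<^esub> x \<in> {x \<in> carrier H. \<exists>l. good l x}" using x by auto
  qed auto
  note sub = this
  have P: "{\<tau> x y | x y. x \<in> carrier HV \<and> y \<in> carrier HW} \<subseteq> {x \<in> carrier H. \<exists>l. good l x}"
  proof clarify
    fix x y assume xy: "x \<in> carrier HV" "y \<in> carrier HW"
    have "good [(x, y)] (\<tau> x y)" using xy by (simp add: good_def)
    thus "\<tau> x y \<in> carrier H \<and> (\<exists>l. good l (\<tau> x y))" using \<tau>(1)[OF xy] by blast
  qed
  have "\<xi> \<in> hspan H {\<tau> x y | x y. x \<in> carrier HV \<and> y \<in> carrier HW}"
    using ten \<xi> by (simp add: tensor_space_def)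
  hence "\<xi> \<in> {x \<in> carrier H. \<exists>l. good l x}" by (rule hspanD[OF _ sub P])
  then obtain l where l: "good l \<xi>" by blast
  have "fst (l ! i) \<in> carrier HV" "snd (l ! i) \<in> carrier HW" if "i < length l" for i
    using l nth_mem[OF that] by (auto simp: good_def)
  thus ?thesis
    using that[of "length l" "\<lambda>i. fst (l ! i)" "\<lambda>i. snd (l ! i)"] l
    by (simp add: good_def sum_list_sum_nth lessThan_atLeast0)
qed

lemma (in pre_hilbert_space) bounded_operator_comp:
  assumes S: "bounded_operator H S" and T: "bounded_operator H T"
  shows "bounded_operator H (\<lambda>x. S (T x))"
proof -
  obtain C where C: "C \<ge> 0" "\<And>x. x \<in> carrier H \<Longrightarrow> hnorm H (S x) \<le> C * hnorm H x"
    using bounded_operator_bound[OF S] by blast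
  obtain D where D: "\<And>x. x \<in> carrier H \<Longrightarrow> hnorm H (T x) \<le> D * hnorm H x"
    using bounded_operator_bound[OF T] by blast
  note B = bounded_operatorD[OF S] bounded_operatorD[OF T]
  have "hnorm H (S (T x)) \<le> (C * D) * hnorm H x" if "x \<in> carrier H" for x
    using C(2)[OF bounded_operatorD(1)[OF T that]] mult_left_mono[OF D[OF that] C(1)] by (simp add: mult.assoc)
  thus ?thesis unfolding bounded_operator_def using B by auto
qed

text \<open>The entries and the normalisation are rewritten with data on HV and HW alone. Once H has
  disappeared, the factors of two models can be regrouped freely.\<close>

lemma q_model_expansion:
  assumes q: "q_model HV HW H \<tau> \<xi> E' F' E F \<Gamma>"
  shows "\<And>v. povm HV (E' v)" "\<And>w. povm HW (F' w)"
    and "\<exists>(n::nat) a b. (\<forall>i<n. a i \<in> carrier HV \<and> b i \<in> carrier HW) \<and>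
      (\<Sum>i<n. \<Sum>j<n. ip HV (a i) (a j) * ip HW (b i) (b j)) = 1 \<and>
      (\<forall>v1 w2 v2 w1. entry \<Gamma> (v1, w2) (v2, w1)
        = (\<Sum>i<n. \<Sum>j<n. ip HV (E' v2 v1 (a i)) (a j) * ip HW (F' w1 w2 (b i)) (b j)))"
proof -
  have hil: "hilbert_space HV" "hilbert_space HW" "hilbert_space H" and ten: "tensor_space HV HW H \<tau>"
    and \<xi>: "\<xi> \<in> carrier H" "hnorm H \<xi> = 1"
    and E: "\<And>v. povm H (E v)" and F: "\<And>w. povm H (F w)"
    and bE: "\<And>v a. bounded_operator HV (E' v a)" and bF: "\<And>w a. bounded_operator HW (F' w a)"
    and ent: "\<And>v1 w2 v2 w1. entry \<Gamma> (v1, w2) (v2, w1) = ip H (E v2 v1 (F w1 w2 \<xi>)) \<xi>"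
    using q by (simp_all add: q_model_def qc_model_def)
  have eq: "E v a (\<tau> x y) = \<tau> (E' v a x) y" "F w b (\<tau> x y) = \<tau> x (F' w b y)"
    if "x \<in> carrier HV" "y \<in> carrier HW" for v a w b x y
    using q that by (simp_all add: q_model_def)
  interpret H: hilbert_space H by fact
  obtain x y where xy: "x \<in> carrier HV" "y \<in> carrier HW" "ip HV x x \<noteq> 0" "ip HW y y \<noteq> 0"
    using tensor_space_nonzero[OF hil ten \<xi>] by blast
  show "povm HV (E' v)" for v
    using tensor_povm[OF hil ten E bE eq(1) xy(2,4)] .
  show "povm HW (F' w)" for w
    using tensor_povm[OF hil(2,1,3) tensor_space_flip[OF ten] F bF eq(2) xy(1,3)] .
  obtain n :: nat and a b where ab: "\<And>i. i < n \<Longrightarrow> a i \<in> carrier HV" "\<And>i. i < n \<Longrightarrow> b i \<in> carrier HW"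
    and exp: "\<And>T u. bounded_operator H T \<Longrightarrow> u \<in> carrier H \<Longrightarrow> ip H (T \<xi>) u = (\<Sum>i<n. ip H (T (\<tau> (a i) (b i))) u)"
    using tensor_space_expansion[OF hil ten \<xi>(1)] by blast
  have \<tau>: "\<tau> x y \<in> carrier H" if "x \<in> carrier HV" "y \<in> carrier HW" for x y
    using ten that by (simp add: tensor_space_def)
  have \<tau>_ip: "ip H (\<tau> x y) (\<tau> x' y') = ip HV x x' * ip HW y y'"
    if "x \<in> carrier HV" "x' \<in> carrier HV" "y \<in> carrier HW" "y' \<in> carrier HW" for x x' y y'
    using ten that by (simp add: tensor_space_def)
  have exp2: "ip H u \<xi> = (\<Sum>i<n. ip H u (\<tau> (a i) (b i)))" if u: "u \<in> carrier H" for u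
  proof -
    have "ip H u \<xi> = cnj (ip H \<xi> u)" using H.ip_cnj[OF \<xi>(1) u] .
    also have "\<dots> = (\<Sum>i<n. cnj (ip H (\<tau> (a i) (b i)) u))"
      using exp[OF H.bounded_id(2) u] by simp
    also have "\<dots> = (\<Sum>i<n. ip H u (\<tau> (a i) (b i)))"
      using H.ip_cnj[OF \<tau> u] ab by (intro sum.cong) auto
    finally show ?thesis .
  qed
  \<comment> \<open>The state is expanded in both slots of the inner product, the second one by
    conjugate symmetry.\<close>
  have exp3: "ip H (T \<xi>) \<xi> = (\<Sum>i<n. \<Sum>j<n. ip H (T (\<tau> (a i) (b i))) (\<tau> (a j) (b j)))"
    if T: "bounded_operator H T" for T
    using exp[OF T \<xi>(1)] exp2 bounded_operatorD(1)[OF T \<tau>] ab by simp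
  have "(\<Sum>i<n. \<Sum>j<n. ip HV (a i) (a j) * ip HW (b i) (b j)) = ip H \<xi> \<xi>"
    using exp3[OF H.bounded_id(2)] ab by (simp add: \<tau>_ip)
  also have "\<dots> = 1" using \<xi> H.hnorm_eq_1 by simp
  finally have "(\<Sum>i<n. \<Sum>j<n. ip HV (a i) (a j) * ip HW (b i) (b j)) = 1" .
  moreover have "entry \<Gamma> (v1, w2) (v2, w1)
      = (\<Sum>i<n. \<Sum>j<n. ip HV (E' v2 v1 (a i)) (a j) * ip HW (F' w1 w2 (b i)) (b j))" for v1 w2 v2 w1
  proof -
    have "bounded_operator H (\<lambda>x. E v2 v1 (F w1 w2 x))"
      by (rule H.bounded_operator_comp[OF positive_operator_bounded[OF povm_positive[OF E]]
            positive_operator_bounded[OF povm_positive[OF F]]])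
    hence "entry \<Gamma> (v1, w2) (v2, w1) = (\<Sum>i<n. \<Sum>j<n. ip H (E v2 v1 (F w1 w2 (\<tau> (a i) (b i)))) (\<tau> (a j) (b j)))"
      unfolding ent by (rule exp3)
    also have "\<dots> = (\<Sum>i<n. \<Sum>j<n. ip HV (E' v2 v1 (a i)) (a j) * ip HW (F' w1 w2 (b i)) (b j))"
      using ab bounded_operatorD(1)[OF bE] bounded_operatorD(1)[OF bF] by (simp add: eq \<tau>_ip)
    finally show ?thesis .
  qed
  ultimately show "\<exists>(n::nat) a b. (\<forall>i<n. a i \<in> carrier HV \<and> b i \<in> carrier HW) \<and>
      (\<Sum>i<n. \<Sum>j<n. ip HV (a i) (a j) * ip HW (b i) (b j)) = 1 \<and>
      (\<forall>v1 w2 v2 w1. entry \<Gamma> (v1, w2) (v2, w1)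
        = (\<Sum>i<n. \<Sum>j<n. ip HV (E' v2 v1 (a i)) (a j) * ip HW (F' w1 w2 (b i)) (b j)))"
    using ab by (intro exI[of _ n] exI[of _ a] exI[of _ b]) simp
qed

text \<open>The transposed indices match the use below, where z is the point of evaluation and z'
  runs through the summands of the state; the two final exchanges of sums undo the
  transposition.\<close>

lemma sum_pairs_product:
  fixes f :: "'i \<Rightarrow> 'i \<Rightarrow> 'a::comm_semiring_0"
  shows "(\<Sum>z\<in>I \<times> J. \<Sum>z'\<in>I \<times> J. f (fst z') (fst z) * g (snd z') (snd z))
    = (\<Sum>i\<in>I. \<Sum>i'\<in>I. f i i') * (\<Sum>j\<in>J. \<Sum>j'\<in>J. g j j')"
proof -
  have "(\<Sum>z\<in>I \<times> J. \<Sum>z'\<in>I \<times> J. f (fst z') (fst z) * g (snd z') (snd z))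
      = (\<Sum>i\<in>I. \<Sum>i'\<in>I. f i' i) * (\<Sum>j\<in>J. \<Sum>j'\<in>J. g j' j)"
    by (simp add: sum_Times flip: sum_distrib_left sum_distrib_right)
  also have "(\<Sum>i\<in>I. \<Sum>i'\<in>I. f i' i) = (\<Sum>i\<in>I. \<Sum>i'\<in>I. f i i')" by (rule sum.swap)
  also have "(\<Sum>j\<in>J. \<Sum>j'\<in>J. g j' j) = (\<Sum>j\<in>J. \<Sum>j'\<in>J. g j j')" by (rule sum.swap)
  finally show ?thesis .
qed

lemma q_correlation_compose:
  fixes \<Gamma>\<^sub>1 :: "('v2::finite, 'w1::finite, 'v1::finite, 'w2::finite) corr"
    and \<Gamma>\<^sub>2 :: "('v3::finite, 'w2, 'v2, 'w3::finite) corr"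
  assumes 1: "q_correlation \<Gamma>\<^sub>1" and 2: "q_correlation \<Gamma>\<^sub>2"
  shows "q_correlation (\<Gamma>\<^sub>2 \<star> \<Gamma>\<^sub>1)"
proof -
  obtain HV1 HW1 H1 :: "universe hilbert" and \<tau>1 \<xi>1 E1 F1 E1' F1'
    where m1: "q_model HV1 HW1 H1 \<tau>1 \<xi>1 E1 F1 E1' F1' \<Gamma>\<^sub>1"
    using 1 unfolding q_correlation_def by blast
  obtain HV2 HW2 H2 :: "universe hilbert" and \<tau>2 \<xi>2 E2 F2 E2' F2'
    where m2: "q_model HV2 HW2 H2 \<tau>2 \<xi>2 E2 F2 E2' F2' \<Gamma>\<^sub>2"
    using 2 unfolding q_correlation_def by blast
  have hil: "hilbert_space HV1" "hilbert_space HW1" "hilbert_space HV2" "hilbert_space HW2"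
    and fin: "finite_dim HV1" "finite_dim HW1" "finite_dim HV2" "finite_dim HW2"
    using m1 m2 by (simp_all add: q_model_def)
  interpret V: hilbert_tensor HV1 HV2 using hil by (intro hilbert_tensor.intro)
  interpret W: hilbert_tensor HW1 HW2 using hil by (intro hilbert_tensor.intro)
  \<comment> \<open>\<open>X\<close> is the tensor product of HV1 (x) HV2 with HW1 (x) HW2, the
    bipartition of the composed model.\<close>
  interpret X: hilbert_tensor V.Hk W.Hk using V.Hk_hilbert W.Hk_hilbert by (intro hilbert_tensor.intro)
  note povm1 = q_model_expansion(1,2)[OF m1] and povm2 = q_model_expansion(1,2)[OF m2]
  note pos1 = povm_positive[OF povm1(1)] povm_positive[OF povm1(2)]
    and pos2 = povm_positive[OF povm2(1)] povm_positive[OF povm2(2)]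
  obtain n :: nat and a b where ab: "\<And>i. i < n \<Longrightarrow> a i \<in> carrier HV1" "\<And>i. i < n \<Longrightarrow> b i \<in> carrier HW1"
    and n1: "(\<Sum>i<n. \<Sum>j<n. ip HV1 (a i) (a j) * ip HW1 (b i) (b j)) = 1"
    and e1: "\<And>v1 w2 v2 w1. entry \<Gamma>\<^sub>1 (v1, w2) (v2, w1)
        = (\<Sum>i<n. \<Sum>j<n. ip HV1 (E1 v2 v1 (a i)) (a j) * ip HW1 (F1 w1 w2 (b i)) (b j))"
    using q_model_expansion(3)[OF m1] by blast
  obtain m :: nat and c d where cd: "\<And>i. i < m \<Longrightarrow> c i \<in> carrier HV2" "\<And>i. i < m \<Longrightarrow> d i \<in> carrier HW2"
    and n2: "(\<Sum>i<m. \<Sum>j<m. ip HV2 (c i) (c j) * ip HW2 (d i) (d j)) = 1"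
    and e2: "\<And>v2 w3 v3 w2. entry \<Gamma>\<^sub>2 (v2, w3) (v3, w2)
        = (\<Sum>i<m. \<Sum>j<m. ip HV2 (E2 v3 v2 (c i)) (c j) * ip HW2 (F2 w2 w3 (d i)) (d j))"
    using q_model_expansion(3)[OF m2] by blast
  define I where "I = {..<n} \<times> {..<m}"
  define pV where "pV z = V.tk (a (fst z), c (snd z))" for z
  define pW where "pW z = W.tk (b (fst z), d (snd z))" for z
  have pVW: "pV z \<in> carrier V.Hk" "pW z \<in> carrier W.Hk" for z by (simp_all add: pV_def pW_def)
  \<comment> \<open>The product of the states sum a_i (x) b_i and sum c_k (x) d_k, rebracketed as
    the sum over z = (i, k) of (a_i (x) c_k) (x) (b_i (x) d_k).\<close>
  define \<xi> where "\<xi> = (\<lambda>q. \<Sum>z\<in>I. X.tk (pV z, pW z) q)"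
  have "finite I" by (simp add: I_def)
  hence \<xi>: "\<xi> \<in> carrier X.Hk" and ip\<xi>: "\<And>f. f \<in> carrier X.Hk \<Longrightarrow> ip X.Hk f \<xi> = (\<Sum>z\<in>I. f (pV z, pW z))"
    using X.Hk_ip_sum_points[of I "\<lambda>z. (pV z, pW z)"] by (auto simp: \<xi>_def)
  have in_I: "a (fst z) \<in> carrier HV1" "b (fst z) \<in> carrier HW1" "c (snd z) \<in> carrier HV2" "d (snd z) \<in> carrier HW2"
    if "z \<in> I" for z using that ab cd by (auto simp: I_def)
  define E where "E v3 v1 = V.tsum (\<lambda>v2. E1 v2 v1) (E2 v3)" for v3 v1
  define F where "F w1 w3 = W.tsum (F1 w1) (\<lambda>w2. F2 w2 w3)" for w1 w3
  have povmE: "povm V.Hk (E v3)" for v3 unfolding E_def by (rule V.povm_tsum_left[OF povm1(1) povm2(1)])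
  have povmF: "povm W.Hk (F w1)" for w1 unfolding F_def by (rule W.povm_tsum_right[OF povm1(2) povm2(2)])
  note posE = povm_positive[OF povmE] and posF = povm_positive[OF povmF]
  have "ns_correlation (\<Gamma>\<^sub>2 \<star> \<Gamma>\<^sub>1)"
    using 1 2 by (intro ns_correlation_compose) (simp_all add: q_correlation_def)
  moreover have "ip X.Hk \<xi> \<xi> = 1"
  proof -
    have "ip X.Hk \<xi> \<xi> = (\<Sum>z\<in>I. \<Sum>z'\<in>I. X.tk (pV z', pW z') (pV z, pW z))"
      unfolding ip\<xi>[OF \<xi>] by (simp add: \<xi>_def)
    also have "\<dots> = (\<Sum>z\<in>I. \<Sum>z'\<in>I. (ip HV1 (a (fst z')) (a (fst z)) * ip HW1 (b (fst z')) (b (fst z))) *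
        (ip HV2 (c (snd z')) (c (snd z)) * ip HW2 (d (snd z')) (d (snd z))))"
      by (intro sum.cong refl)
        (simp add: X.tk_eval pVW, simp add: pV_def pW_def V.Hk_ip_point W.Hk_ip_point V.tk_eval W.tk_eval in_I)
    also have "\<dots> = (\<Sum>i<n. \<Sum>j<n. ip HV1 (a i) (a j) * ip HW1 (b i) (b j)) *
        (\<Sum>i<m. \<Sum>j<m. ip HV2 (c i) (c j) * ip HW2 (d i) (d j))"
      unfolding I_def by (rule sum_pairs_product)
    finally show ?thesis by (simp add: n1 n2)
  qed
  moreover have "entry (\<Gamma>\<^sub>2 \<star> \<Gamma>\<^sub>1) (v1, w3) (v3, w1) = ip X.Hk (\<xi> \<circ> X.pair_op (E v3 v1) (F w1 w3)) \<xi>" for v1 w3 v3 w1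
  proof -
    let ?f = "\<lambda>q i j. ip HV1 (E1 (fst q) v1 (a i)) (a j) * ip HW1 (F1 w1 (snd q) (b i)) (b j)"
    let ?g = "\<lambda>q i j. ip HV2 (E2 v3 (fst q) (c i)) (c j) * ip HW2 (F2 (snd q) w3 (d i)) (d j)"
    \<comment> \<open>Composition with \<open>pair_op\<close> places E on the point of evaluation,
      that is in the second slot; self-adjointness moves it to the first, where
      \<open>tsum_tk\<close> applies.\<close>
    have EpV: "ip V.Hk (pV z') (E v3 v1 (pV z)) =
        (\<Sum>v2\<in>UNIV. ip HV1 (E1 v2 v1 (a (fst z'))) (a (fst z)) * ip HV2 (E2 v3 v2 (c (snd z'))) (c (snd z)))"
      if "z \<in> I" "z' \<in> I" for z z'
    proof -
      have "ip V.Hk (pV z') (E v3 v1 (pV z)) = ip V.Hk (E v3 v1 (pV z')) (pV z)"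
        using V.Hk.positive_selfadjoint[OF posE pVW(1) pVW(1)] by simp
      also have "\<dots> = E v3 v1 (pV z') (a (fst z), c (snd z))"
        unfolding pV_def[of z] by (rule V.Hk_ip_point[OF positive_operator_in[OF posE pVW(1)]])
      also have "\<dots> = (\<Sum>v2\<in>UNIV. ip HV1 (E1 v2 v1 (a (fst z'))) (a (fst z)) * ip HV2 (E2 v3 v2 (c (snd z'))) (c (snd z)))"
        unfolding E_def pV_def by (rule V.tsum_tk) (simp_all add: pos1 pos2 in_I that)
      finally show ?thesis .
    qed
    have FpW: "ip W.Hk (pW z') (F w1 w3 (pW z)) =
        (\<Sum>w2\<in>UNIV. ip HW1 (F1 w1 w2 (b (fst z'))) (b (fst z)) * ip HW2 (F2 w2 w3 (d (snd z'))) (d (snd z)))"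
      if "z \<in> I" "z' \<in> I" for z z'
    proof -
      have "ip W.Hk (pW z') (F w1 w3 (pW z)) = ip W.Hk (F w1 w3 (pW z')) (pW z)"
        using W.Hk.positive_selfadjoint[OF posF pVW(2) pVW(2)] by simp
      also have "\<dots> = F w1 w3 (pW z') (b (fst z), d (snd z))"
        unfolding pW_def[of z] by (rule W.Hk_ip_point[OF positive_operator_in[OF posF pVW(2)]])
      also have "\<dots> = (\<Sum>w2\<in>UNIV. ip HW1 (F1 w1 w2 (b (fst z'))) (b (fst z)) * ip HW2 (F2 w2 w3 (d (snd z'))) (d (snd z)))"
        unfolding F_def pW_def by (rule W.tsum_tk) (simp_all add: pos1 pos2 in_I that)
      finally show ?thesis .
    qed
    have "\<xi> \<circ> X.pair_op (E v3 v1) (F w1 w3) \<in> carrier X.Hk"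
      by (rule positive_operator_in[OF X.positive_pair_op[OF posE posF] \<xi>])
    hence "ip X.Hk (\<xi> \<circ> X.pair_op (E v3 v1) (F w1 w3)) \<xi> = (\<Sum>z\<in>I. (\<xi> \<circ> X.pair_op (E v3 v1) (F w1 w3)) (pV z, pW z))"
      by (rule ip\<xi>)
    also have "\<dots> = (\<Sum>z\<in>I. \<Sum>z'\<in>I. ip V.Hk (pV z') (E v3 v1 (pV z)) * ip W.Hk (pW z') (F w1 w3 (pW z)))"
      by (simp add: \<xi>_def X.pair_op_def X.tk_eval pVW positive_operator_in[OF posE] positive_operator_in[OF posF])
    \<comment> \<open>With q = (v2, w2) the four scalar factors are regrouped from (V1 V2)(W1 W2) to
      (V1 W1)(V2 W2), so that for each q the double sum splits into an entry of
      \<open>\<Gamma>\<^sub>1\<close> times an entry of \<open>\<Gamma>\<^sub>2\<close>.\<close>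
    also have "\<dots> = (\<Sum>z\<in>I. \<Sum>z'\<in>I. \<Sum>q\<in>UNIV. ?f q (fst z') (fst z) * ?g q (snd z') (snd z))"
      by (intro sum.cong refl) (simp add: EpV FpW sum_prod_UNIV sum_product mult_ac)
    also have "\<dots> = (\<Sum>z\<in>I. \<Sum>q\<in>UNIV. \<Sum>z'\<in>I. ?f q (fst z') (fst z) * ?g q (snd z') (snd z))"
      by (rule sum.cong[OF refl]) (rule sum.swap)
    also have "\<dots> = (\<Sum>q\<in>UNIV. \<Sum>z\<in>I. \<Sum>z'\<in>I. ?f q (fst z') (fst z) * ?g q (snd z') (snd z))"
      by (rule sum.swap)
    also have "\<dots> = (\<Sum>q\<in>UNIV. (\<Sum>i<n. \<Sum>j<n. ?f q i j) * (\<Sum>i<m. \<Sum>j<m. ?g q i j))"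
      unfolding I_def by (rule sum.cong[OF refl]) (rule sum_pairs_product)
    also have "\<dots> = entry (\<Gamma>\<^sub>2 \<star> \<Gamma>\<^sub>1) (v1, w3) (v3, w1)"
      by (simp add: entry_compose_corr e1 e2 sum_prod_UNIV)
    finally show ?thesis ..
  qed
  ultimately show ?thesis
    using V.tensor_finite_dim(1)[OF fin(1,3)] W.tensor_finite_dim(1)[OF fin(2,4)] povmE povmF \<xi>
    by (intro X.q_correlation_tensorI[of _ E F \<xi>]) auto
qed

text \<open>The entries of a composition are polynomials in the entries of its factors, so composing
  the approximating quantum correlations termwise approximates the composition.\<close>

lemma qa_correlation_compose:
  fixes \<Gamma>\<^sub>1 :: "('v2::finite, 'w1::finite, 'v1::finite, 'w2::finite) corr"
    and \<Gamma>\<^sub>2 :: "('v3::finite, 'w2, 'v2, 'w3::finite) corr"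
  assumes 1: "qa_correlation \<Gamma>\<^sub>1" and 2: "qa_correlation \<Gamma>\<^sub>2"
  shows "qa_correlation (\<Gamma>\<^sub>2 \<star> \<Gamma>\<^sub>1)"
proof -
  obtain S1 where S1: "\<And>n. q_correlation (S1 n)" "\<And>A. A \<in> \<D> \<Longrightarrow> (\<lambda>n. S1 n A) \<longlonglongrightarrow> \<Gamma>\<^sub>1 A"
    using 1 unfolding qa_correlation_def by blast
  obtain S2 where S2: "\<And>n. q_correlation (S2 n)" "\<And>A. A \<in> \<D> \<Longrightarrow> (\<lambda>n. S2 n A) \<longlonglongrightarrow> \<Gamma>\<^sub>2 A"
    using 2 unfolding qa_correlation_def by blast
  have e1: "(\<lambda>n. entry (S1 n) p q) \<longlonglongrightarrow> entry \<Gamma>\<^sub>1 p q" for p q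
    unfolding entry_def by (intro tendsto_vec_nth S1 diag_unit_diagonal)
  have e2: "(\<lambda>n. entry (S2 n) p q) \<longlonglongrightarrow> entry \<Gamma>\<^sub>2 p q" for p q
    unfolding entry_def by (intro tendsto_vec_nth S2 diag_unit_diagonal)
  have e: "(\<lambda>n. entry (S2 n \<star> S1 n) p q) \<longlonglongrightarrow> entry (\<Gamma>\<^sub>2 \<star> \<Gamma>\<^sub>1) p q" for p q
    by (cases p; cases q) (auto simp: entry_compose_corr intro!: tendsto_sum tendsto_mult e1 e2)
  \<comment> \<open>A composition is rebuilt from its entries on every matrix, so convergence of the
    entries suffices.\<close>
  have map: "map_of_entries (entry (\<Gamma> \<star> \<Gamma>')) = \<Gamma> \<star> \<Gamma>'"
    for \<Gamma> :: "('v3, 'w2, 'v2, 'w3) corr" and \<Gamma>' :: "('v2, 'w1, 'v1, 'w2) corr"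
    unfolding compose_corr_def entry_map_of_entries ..
  have "(\<lambda>n. map_of_entries (entry (S2 n \<star> S1 n)) A) \<longlonglongrightarrow> map_of_entries (entry (\<Gamma>\<^sub>2 \<star> \<Gamma>\<^sub>1)) A" for A
    by (intro vec_tendstoI) (auto simp: map_of_entries_nth intro!: tendsto_sum tendsto_mult e)
  hence "(\<lambda>n. (S2 n \<star> S1 n) A) \<longlonglongrightarrow> (\<Gamma>\<^sub>2 \<star> \<Gamma>\<^sub>1) A" for A by (simp only: map)
  moreover have "q_correlation (S2 n \<star> S1 n)" for n by (rule q_correlation_compose[OF S1(1) S2(1)])
  moreover have "ns_correlation (\<Gamma>\<^sub>2 \<star> \<Gamma>\<^sub>1)"
    using 1 2 by (intro ns_correlation_compose) (simp_all add: qa_correlation_def)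
  ultimately show ?thesis unfolding qa_correlation_def by (intro conjI exI[of _ "\<lambda>n. S2 n \<star> S1 n"]) auto
qed

theorem theorem2p1:
  fixes \<Gamma>\<^sub>1 :: "('v2::finite, 'w1::finite, 'v1::finite, 'w2::finite) corr"
    and \<Gamma>\<^sub>2 :: "('v3::finite, 'w2, 'v2, 'w3::finite) corr"
  assumes "ns_correlation \<Gamma>\<^sub>1" and "ns_correlation \<Gamma>\<^sub>2"
  shows "ns_correlation (\<Gamma>\<^sub>2 \<star> \<Gamma>\<^sub>1) \<and>
    (\<forall>t. \<Gamma>\<^sub>1 \<in> corr_class t \<longrightarrow> \<Gamma>\<^sub>2 \<in> corr_class t \<longrightarrow> \<Gamma>\<^sub>2 \<star> \<Gamma>\<^sub>1 \<in> corr_class t) \<and>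
    (\<forall>\<E> :: 'v1 sqmat \<Rightarrow> 'w1 sqmat. channel \<E> \<longrightarrow>
      (\<forall>A\<in>\<D>. simulate (\<Gamma>\<^sub>2 \<star> \<Gamma>\<^sub>1) \<E> A = simulate \<Gamma>\<^sub>2 (simulate \<Gamma>\<^sub>1 \<E>) A))"
proof -
  have "\<Gamma>\<^sub>2 \<star> \<Gamma>\<^sub>1 \<in> corr_class t" if "\<Gamma>\<^sub>1 \<in> corr_class t" "\<Gamma>\<^sub>2 \<in> corr_class t" for t
    using that
    by (cases t) (simp_all add: loc_correlation_compose q_correlation_compose qa_correlation_compose
        qc_correlation_compose ns_correlation_compose)
  thus ?thesis using ns_correlation_compose[OF assms] by (simp add: simulate_compose)
qed

end
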